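(* Let $G$ be a locally compact group, $1<p<\infty$, and suppose $A_p(G)$ is Arens regular. Suppose moreover that for every finitely generated subgroup $H$ of $G$, Arens regularity of $A_p(H)$ implies that $H$ is finite. Then $G$ is finite.
   Context: For a locally compact group $G$ with left Haar measure and $1<p<\infty$, $\frac1p+\frac1q=1$, $A_p(G)$ is the space of functions $u=\sum_{i=1}^\infty g_i*f_i^{\vee}$ with $f_i\in L_p(G)$, $g_i\in L_q(G)$, $\sum_i\|f_i\|_p\|g_i\|_q<\infty$, where $f^{\vee}(x)=f(x^{-1})$; with pointwise multiplication and norm $\|u\|_{A_p(G)}=\inf\{\sum_i\|f_i\|_p\|g_i\|_q\}$ over all such representations it is a commutative Banach algebra (the Herz algebra). A Banach algebra $A$ is Arens regular if the two Arens products on $A^{**}$ coincide; equivalently, for all sequences $(a_n),(b_m)$ in the closed unit ball of $A$ and all $T\in A^*$, the iterated limits $\lim_n\lim_m T(a_nb_m)$ and $\lim_m\lim_n T(a_nb_m)$ are equal whenever both exist. *)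

theory Defs
  imports "HOL-Analysis.Analysis" "HOL-Algebra.Generated_Groups"
begin

definition lc_group :: "('a, 'b) monoid_scheme \<Rightarrow> 'a topology \<Rightarrow> bool" where
  "lc_group G T \<longleftrightarrow> group G \<and> topspace T = carrier G \<and> Hausdorff_space T \<and>
     locally_compact_space T \<and>
     continuous_map (prod_topology T T) T (\<lambda>(x, y). x \<otimes>\<^bsub>G\<^esub> y) \<and>
     continuous_map T T (\<lambda>x. inv\<^bsub>G\<^esub> x)"

definition left_haar :: "('a, 'b) monoid_scheme \<Rightarrow> 'a topology \<Rightarrow> 'a measure \<Rightarrow> bool" where
  "left_haar G T \<mu> \<longleftrightarrow>
     space \<mu> = carrier G \<and>
     sets \<mu> = sigma_sets (topspace T) {U. openin T U} \<and>
     (\<forall>g\<in>carrier G. \<forall>A\<in>sets \<mu>. emeasure \<mu> ((\<lambda>x. g \<otimes>\<^bsub>G\<^esub> x) ` A) = emeasure \<mu> A) \<and>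
     (\<forall>K. compactin T K \<longrightarrow> emeasure \<mu> K < \<infinity>) \<and>
     (\<forall>U. openin T U \<and> U \<noteq> {} \<longrightarrow> emeasure \<mu> U > 0) \<and>
     (\<forall>A\<in>sets \<mu>. emeasure \<mu> A = (INF U\<in>{U. openin T U \<and> A \<subseteq> U}. emeasure \<mu> U)) \<and>
     (\<forall>U. openin T U \<longrightarrow> emeasure \<mu> U = (SUP K\<in>{K. compactin T K \<and> K \<subseteq> U}. emeasure \<mu> K))"

definition in_Lp :: "'a measure \<Rightarrow> real \<Rightarrow> ('a \<Rightarrow> complex) \<Rightarrow> bool" where
  "in_Lp \<mu> p f \<longleftrightarrow> f \<in> borel_measurable \<mu> \<and> integrable \<mu> (\<lambda>x. norm (f x) powr p)"

definition Lp_norm :: "'a measure \<Rightarrow> real \<Rightarrow> ('a \<Rightarrow> complex) \<Rightarrow> real" where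
  "Lp_norm \<mu> p f = (\<integral>x. norm (f x) powr p \<partial>\<mu>) powr (1 / p)"

definition check :: "('a, 'b) monoid_scheme \<Rightarrow> ('a \<Rightarrow> complex) \<Rightarrow> 'a \<Rightarrow> complex" where
  "check G f = (\<lambda>x. f (inv\<^bsub>G\<^esub> x))"

definition conv :: "('a, 'b) monoid_scheme \<Rightarrow> 'a measure \<Rightarrow> ('a \<Rightarrow> complex) \<Rightarrow> ('a \<Rightarrow> complex) \<Rightarrow> 'a \<Rightarrow> complex" where
  "conv G \<mu> g h = (\<lambda>x. \<integral>y. g y * h (inv\<^bsub>G\<^esub> y \<otimes>\<^bsub>G\<^esub> x) \<partial>\<mu>)"

definition conj_exp :: "real \<Rightarrow> real" where
  "conj_exp p = p / (p - 1)"

definition herz_rep :: "('a, 'b) monoid_scheme \<Rightarrow> 'a measure \<Rightarrow> real \<Rightarrow>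
    (nat \<Rightarrow> 'a \<Rightarrow> complex) \<Rightarrow> (nat \<Rightarrow> 'a \<Rightarrow> complex) \<Rightarrow> ('a \<Rightarrow> complex) \<Rightarrow> bool" where
  "herz_rep G \<mu> p f g u \<longleftrightarrow>
     (\<forall>i. in_Lp \<mu> p (f i) \<and> in_Lp \<mu> (conj_exp p) (g i)) \<and>
     summable (\<lambda>i. Lp_norm \<mu> p (f i) * Lp_norm \<mu> (conj_exp p) (g i)) \<and>
     (\<forall>x\<in>carrier G. (\<lambda>i. conv G \<mu> (g i) (check G (f i)) x) sums u x) \<and>
     (\<forall>x. x \<notin> carrier G \<longrightarrow> u x = 0)"

definition herz :: "('a, 'b) monoid_scheme \<Rightarrow> 'a measure \<Rightarrow> real \<Rightarrow> ('a \<Rightarrow> complex) set" where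
  "herz G \<mu> p = {u. \<exists>f g. herz_rep G \<mu> p f g u}"

definition herz_norm :: "('a, 'b) monoid_scheme \<Rightarrow> 'a measure \<Rightarrow> real \<Rightarrow> ('a \<Rightarrow> complex) \<Rightarrow> real" where
  "herz_norm G \<mu> p u = Inf {(\<Sum>i. Lp_norm \<mu> p (f i) * Lp_norm \<mu> (conj_exp p) (g i)) | f g. herz_rep G \<mu> p f g u}"

section \<open>Arens regularity (iterated-limit characterisation)\<close>

definition bounded_functional :: "('a \<Rightarrow> complex) set \<Rightarrow> (('a \<Rightarrow> complex) \<Rightarrow> real) \<Rightarrow>
    (('a \<Rightarrow> complex) \<Rightarrow> complex) \<Rightarrow> bool" where
  "bounded_functional A N T \<longleftrightarrow>
     (\<forall>u\<in>A. \<forall>v\<in>A. T (\<lambda>x. u x + v x) = T u + T v) \<and>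
     (\<forall>c. \<forall>u\<in>A. T (\<lambda>x. c * u x) = c * T u) \<and>
     (\<exists>C. \<forall>u\<in>A. norm (T u) \<le> C * N u)"

definition arens_regular :: "('a \<Rightarrow> complex) set \<Rightarrow> (('a \<Rightarrow> complex) \<Rightarrow> real) \<Rightarrow> bool" where
  "arens_regular A N \<longleftrightarrow>
     (\<forall>a b T L1 L2 l1 l2.
        (\<forall>n. a n \<in> A \<and> N (a n) \<le> 1) \<and> (\<forall>m. b m \<in> A \<and> N (b m) \<le> 1) \<and>
        bounded_functional A N T \<and>
        (\<forall>n. (\<lambda>m. T (\<lambda>x. a n x * b m x)) \<longlonglongrightarrow> L1 n) \<and> L1 \<longlonglongrightarrow> l1 \<and>
        (\<forall>m. (\<lambda>n. T (\<lambda>x. a n x * b m x)) \<longlonglongrightarrow> L2 m) \<and> L2 \<longlonglongrightarrow> l2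
        \<longrightarrow> l1 = l2)"

definition herz_arens_regular :: "('a, 'b) monoid_scheme \<Rightarrow> 'a measure \<Rightarrow> real \<Rightarrow> bool" where
  "herz_arens_regular G \<mu> p \<longleftrightarrow> arens_regular (herz G \<mu> p) (herz_norm G \<mu> p)"

end

theory Submission
  imports Defs
begin

text \<open>
  Let \<open>A\<^sub>s F(y) = (F(y) + F(s\<^sup>-\<^sup>1y))/2\<close>. For elements \<open>s\<^sub>1, \<dots>, s\<^sub>N\<close> of \<open>G\<close> and signs \<open>\<epsilon>\<^sub>k\<close> the functional
  \<open>g * f\<^sup>\<or> \<mapsto> \<Sum>\<^sub>k \<epsilon>\<^sub>k (\<langle>F\<^sub>k\<^sub>-\<^sub>1, K\<^sub>k\<^sub>-\<^sub>1\<rangle> - \<langle>F\<^sub>k, K\<^sub>k\<rangle>)\<close>, where \<open>F\<^sub>k = A\<^sub>s\<^sub>k F\<^sub>k\<^sub>-\<^sub>1\<close>, \<open>F\<^sub>0 = f\<close> and likewise \<open>K\<^sub>0 = g\<close>, is a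
  finite combination of point evaluations, and its norm on \<open>A\<^sub>p(G)\<close> is bounded independently of \<open>N\<close>, the
  \<open>s\<^sub>k\<close> and the signs. Each difference is the integral of a covariance, which is dominated by the increment of
  \<open>\<integral> B(F\<^sub>k, K\<^sub>k)\<close> for a Bellman function \<open>B\<close> with \<open>B(x, y) \<plusminus> xy\<close> convex; \<open>B\<close> is a partial Legendre transform of
  Burkholder's zigzag-concave function.

  If \<open>G\<close> is not discrete, take bumps \<open>v\<^sub>n\<close> in \<open>A\<^sub>p(G)\<close> at the identity with \<open>v\<^sub>n v\<^sub>m\<close> proportional to \<open>v\<close> of index
  \<open>max n m\<close>, and \<open>s\<^sub>k\<close> tending to the identity between the supports; a Banach limit of the functionals
  above, with alternating signs, oscillates along \<open>v\<^sub>n\<close> and contradicts regularity. So \<open>G\<close> is discrete, Arens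
  regularity passes to subgroups, and the hypothesis makes \<open>G\<close> locally finite. If \<open>G\<close> were infinite, the indicators
  of a strictly increasing sequence of finite subgroups would give the same contradiction, now with index \<open>min n m\<close>.
\<close>

section \<open>The Burkholder function and its Bellman transform\<close>

text \<open>If all signs were equal, the sum would telescope and be trivially bounded, but its
  limits along even and odd indices would agree. The weight of the argument is that signs may be
  inserted: for one product of real functions even the sum of the absolute differences is bounded.
  For \<open>p = 2\<close> the Bellman function is \<open>x^2 + y^2/4\<close>, and adding
  \<open>\<plusminus> x y\<close> gives the squares \<open>(x \<plusminus> y/2)^2\<close>. For other
  exponents no quadratic form is comparable with
  \<open>\<bar>x\<bar> powr p + \<bar>y\<bar> powr q\<close>, which is why Burkholder's function
  enters. The constants are crude; only their independence of the list of group elements matters.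
  The signs of the oscillation come from halving: on the test functions a step either keeps the
  coefficient at the identity or halves it, and which steps halve depends on \<open>n\<close>. The
  alternating geometric series that results tends to \<open>(-1)^n / 6\<close>, exactly or up to a
  vanishing error. The passage to subgroups is the restriction theorem of Herz for discrete groups:
  functions are split along right cosets, and Hoelder's inequality is applied once more over the
  cosets.\<close>

lemma concave_on_cong:
  assumes "\<And>x. x \<in> A \<Longrightarrow> f x = g x" and "concave_on A f"
  shows "concave_on A g"
proof -
  have "convex A" using assms(2) by (simp add: concave_on_iff)
  then have "u *\<^sub>R x + v *\<^sub>R y \<in> A" if "x \<in> A" "y \<in> A" "u \<ge> 0" "v \<ge> 0" "u + v = 1" for x y u v
    using that by (simp add: convex_def)
  then show ?thesis using assms(2) by (simp add: concave_on_iff assms(1)[symmetric])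
qed

text \<open>A common supporting line at the junction is what joins two concave halves: a chord
  across \<open>a\<close> lies below the broken line through the point over \<open>a\<close>,
  because the end values can be traded for values on the supporting line. This covers corners as
  well as smooth junctions.\<close>

lemma concave_on_glue:
  fixes f :: "real \<Rightarrow> real"
  assumes left: "concave_on {..a} f" and right: "concave_on {a..} f"
    and support: "\<And>t. f t \<le> f a + d * (t - a)"
  shows "concave_on UNIV f"
  unfolding concave_on_def
proof (rule convex_onI)
  show "convex (UNIV :: real set)" by simp
next
  fix l s t :: real
  assume l: "0 < l" "l < 1"
  define z where "z = (1 - l) * s + l * t"
  have goal: "f ((1 - l) * s + l * t) \<ge> (1 - l) * f s + l * f t" 
    if st: "s < t" and l: "0 < l" "l < 1" for s t l
  proof -
    define z where "z = (1 - l) * s + l * t"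
    have z: "s < z" "z < t"
    proof -
      have "z = s + l * (t - s)" "z = t - (1 - l) * (t - s)" unfolding z_def by algebra+
      moreover have "l * (t - s) > 0" "(1 - l) * (t - s) > 0" using st l by auto
      ultimately show "s < z" "z < t" by linarith+
    qed
    consider "t \<le> a" | "a \<le> s" | "s < a" "a < t" by linarith
    then show ?thesis
    proof cases
      case 1
      then show ?thesis using concave_onD[OF left, of l s t] l st by auto
    next
      case 2
      then show ?thesis using concave_onD[OF right, of l s t] l st by auto
    next
      case 3
      show ?thesis
      proof (cases "z \<le> a")
        case True
        \<comment> \<open>The end \<open>t\<close> is replaced by the nearer end \<open>a\<close>.
          The weight \<open>k\<close> of \<open>a\<close> in \<open>z\<close> satisfies
          \<open>k * (a - s) = l * (t - s)\<close>, so \<open>k\<close> is at least \<open>l\<close>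
          and the slope terms of the supporting line cancel.\<close>
        define k where "k = (z - s) / (a - s)"
        have k: "0 \<le> k" "k \<le> 1" using True z 3 by (auto simp: k_def)
        have "k * (a - s) = z - s" using 3 by (simp add: k_def)
        then have zk: "(1 - k) * s + k * a = z" by (simp add: algebra_simps)
        have "f z \<ge> (1 - k) * f s + k * f a"
          using concave_onD[OF left, of k s a] k 3 zk by auto
        moreover have "(1 - k) * f s + k * f a \<ge> (1 - l) * f s + l * f t"
        proof -
          have kl: "k * (a - s) = l * (t - s)" using \<open>k * (a - s) = z - s\<close> by (simp add: z_def algebra_simps)
          have lk: "l \<le> k"
          proof -
            have "l * (a - s) \<le> l * (t - s)" using l 3 by (intro mult_left_mono) auto
            also have "\<dots> = k * (a - s)" by (rule kl[symmetric])
            finally show ?thesis using 3 by simp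
          qed
          have "(k - l) * f s + l * f t \<le> (k - l) * (f a + d * (s - a)) + l * (f a + d * (t - a))"
            using lk l support by (intro add_mono mult_left_mono) auto
          also have "\<dots> = k * f a + d * (l * (t - s) - k * (a - s))" by algebra
          also have "\<dots> = k * f a" using kl by simp
          finally show ?thesis by (simp add: algebra_simps)
        qed
        ultimately show ?thesis by (simp add: z_def)
      next
        case False
        define k where "k = (t - z) / (t - a)"
        have k: "0 \<le> k" "k \<le> 1" using False z 3 by (auto simp: k_def)
        have "k * (t - a) = t - z" using 3 by (simp add: k_def)
        then have zk: "(1 - k) * t + k * a = z" by (simp add: algebra_simps)
        have "f z \<ge> (1 - k) * f t + k * f a"
          using concave_onD[OF right, of k t a] k 3 zk by auto
        moreover have "(1 - k) * f t + k * f a \<ge> (1 - l) * f s + l * f t"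
        proof -
          have kl: "k * (t - a) = (1 - l) * (t - s)" using \<open>k * (t - a) = t - z\<close> by (simp add: z_def algebra_simps)
          have lk: "1 - l \<le> k"
          proof -
            have "(1 - l) * (t - a) \<le> (1 - l) * (t - s)" using l 3 by (intro mult_left_mono) auto
            also have "\<dots> = k * (t - a)" by (rule kl[symmetric])
            finally show ?thesis using 3 by simp
          qed
          have "(k - (1 - l)) * f t + (1 - l) * f s
              \<le> (k - (1 - l)) * (f a + d * (t - a)) + (1 - l) * (f a + d * (s - a))"
            using lk l support by (intro add_mono mult_left_mono) auto
          also have "\<dots> = k * f a + d * (k * (t - a) - (1 - l) * (t - s))" by algebra
          also have "\<dots> = k * f a" using kl by simp
          finally show ?thesis by (simp add: algebra_simps)
        qed
        ultimately show ?thesis by (simp add: z_def)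
      qed
    qed
  qed
  have "f ((1 - l) * s + l * t) \<ge> (1 - l) * f s + l * f t"
  proof (cases s t rule: linorder_cases)
    case less then show ?thesis using goal l by blast
  next
    case equal
    then show ?thesis by (simp add: algebra_simps)
  next
    case greater
    then show ?thesis using goal[of t s "1 - l"] l by (simp add: add.commute)
  qed
  then show "- f ((1 - l) *\<^sub>R s + l *\<^sub>R t) \<le> (1 - l) * - f s + l * - f t" by simp
qed

text \<open>For \<open>m = p - 1\<close> and \<open>p \<ge> 2\<close> this is, up to a positive
  factor, Burkholder's majorant of
  \<open>\<bar>w\<bar> powr p - (p - 1) powr p * \<bar>x\<bar> powr p\<close> from the theory of
  differentially subordinate martingales.\<close>

definition burkholder :: "real \<Rightarrow> real \<Rightarrow> real \<Rightarrow> real" where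
  "burkholder m x w = (\<bar>x\<bar> + \<bar>w\<bar>) powr m * (\<bar>w\<bar> - m * \<bar>x\<bar>)"

text \<open>These are the two outer pieces of the restriction to the line \<open>w = t + c\<close>.
  Between them \<open>\<bar>t\<bar> + \<bar>w\<bar>\<close> is the constant \<open>c\<close> and the
  restriction is the affine function on the right of the second and fourth claims. That function is
  tangent to the right piece at \<open>0\<close>; at \<open>- c\<close> the left piece has slope
  \<open>(2 * m - 1) * (m + 1) * c powr m\<close>, which for \<open>m \<ge> 1\<close> is at least
  the affine slope, so the corner is concave.\<close>

lemma burkholder_diagonal_pieces:
  fixes c m :: real
  assumes c: "c > 0" and m: "m \<ge> 1"
  shows "concave_on {0..} (\<lambda>t. (2 * t + c) powr m * (t + c - m * t))" (is ?A)
    and "t \<ge> 0 \<Longrightarrow> (2 * t + c) powr m * (t + c - m * t) \<le> c powr m * (c + (m + 1) * t)" (is "_ \<Longrightarrow> ?B")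
    and "concave_on {..-c} (\<lambda>t. (- 2 * t - c) powr m * (- t - c + m * t))" (is ?C)
    and "t \<le> - c \<Longrightarrow> (- 2 * t - c) powr m * (- t - c + m * t) \<le> c powr m * (c + (m + 1) * t)" (is "_ \<Longrightarrow> ?D")
proof -
  define H where "H t = (m + 1) * (m * c * (2 * t + c) powr (m - 1) - (m - 1) * (2 * t + c) powr m)" for t
  define h where "h t = (2 * t + c) powr m * (t + c - m * t)" for t
  have der: "(h has_real_derivative H t) (at t)" if "t \<ge> 0" for t
  proof -
    have S: "2 * t + c > 0" using that c by simp
    have "(h has_real_derivative (2 * t + c) powr m * (1 - m) + m * (2 * t + c) powr (m - 1) * 2 * (t + c - m * t)) (at t)"
      unfolding h_def using S by (auto intro!: derivative_eq_intros)
    moreover have "(2 * t + c) powr m = (2 * t + c) powr (m - 1) * (2 * t + c)"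
      using S by (simp add: powr_diff)
    ultimately show ?thesis unfolding H_def by (simp add: algebra_simps)
  qed
  have Hmono: "H y \<le> H x" if "0 \<le> x" "x \<le> y" for x y
  proof (rule DERIV_nonpos_imp_nonincreasing[OF \<open>x \<le> y\<close>])
    fix t assume t: "x \<le> t" "t \<le> y"
    have S: "2 * t + c > 0" using that c t by simp
    define D where "D = (m + 1) * (m * c * ((m - 1) * (2 * t + c) powr (m - 1 - 1) * 2) - (m - 1) * (m * (2 * t + c) powr (m - 1) * 2))"
    have "(H has_real_derivative D) (at t)"
      unfolding H_def D_def using S by (auto intro!: derivative_eq_intros)
    moreover have "(2 * t + c) powr (m - 1) = (2 * t + c) powr (m - 2) * (2 * t + c)"
      using S powr_add[of "2 * t + c" "m - 2" 1] by simp
    then have "D = - ((m + 1) * m * (m - 1) * (2 * t + c) powr (m - 2) * (4 * t))"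
      unfolding D_def by (simp add: algebra_simps)
    then have "D \<le> 0" using that t m by (simp)
    ultimately show "\<exists>y. (H has_real_derivative y) (at t) \<and> y \<le> 0" by blast
  qed
  have "convex_on {0..} (\<lambda>t. - h t)"
    by (rule convex_on_realI[where f' = "\<lambda>t. - H t"]) (auto intro!: DERIV_minus der Hmono)
  then show ?A by (simp add: concave_on_def h_def)
  have H0: "H 0 = (m + 1) * c powr m"
  proof -
    have "c powr m = c powr (m - 1) * c" using c by (simp add: powr_diff)
    then show ?thesis unfolding H_def by (simp add: algebra_simps)
  qed
  show ?B if t: "t \<ge> 0"
  proof (cases "t = 0")
    case False
    then obtain z where z: "0 < z" "z < t" "h t - h 0 = (t - 0) * H z"
      using MVT2[of 0 t h H] der t by auto
    have "(t - 0) * H z \<le> t * H 0" using z Hmono[of 0 z] t by (auto intro!: mult_left_mono)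
    then show ?thesis using z H0 by (simp add: h_def algebra_simps)
  qed auto
  have powr_conv: "convex_on {..-c} (\<lambda>t. (- 2 * t - c) powr k)" if "k \<ge> 1" for k
  proof (rule convex_on_realI[where f' = "\<lambda>t. -2 * k * (- 2 * t - c) powr (k - 1)"])
    fix x y :: real assume "x \<in> {..-c}" "y \<in> {..-c}" "x \<le> y"
    then show "-2 * k * (- 2 * x - c) powr (k - 1) \<le> -2 * k * (- 2 * y - c) powr (k - 1)"
      using c that by (auto intro!: mult_left_mono powr_mono2)
  qed (use c in \<open>auto intro!: derivative_eq_intros\<close>)
  \<comment> \<open>In the variable \<open>- 2 * t - c\<close> the piece is minus a combination of
    convex powers with nonnegative coefficients.\<close>
  have eq: "(- 2 * t - c) powr m * (- t - c + m * t)
     = - ((m - 1) / 2 * (- 2 * t - c) powr (m + 1) + (m + 1) / 2 * c * (- 2 * t - c) powr m)" if "t \<le> -c" for t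
  proof -
    have "- 2 * t - c > 0" using that c by simp
    then have "(- 2 * t - c) powr (m + 1) = (- 2 * t - c) powr m * (- 2 * t - c)"
      by (simp add: powr_add)
    then show ?thesis by (simp only:) (simp add: field_simps)
  qed
  have "convex_on {..-c} (\<lambda>t. (m - 1) / 2 * (- 2 * t - c) powr (m + 1) + (m + 1) / 2 * c * (- 2 * t - c) powr m)"
    using m c by (intro convex_on_add convex_on_cmul powr_conv) auto
  then have "concave_on {..-c} (\<lambda>t. - ((m - 1) / 2 * (- 2 * t - c) powr (m + 1) + (m + 1) / 2 * c * (- 2 * t - c) powr m))"
    unfolding concave_on_def by (simp only: minus_minus)
  then show ?C
    by (rule concave_on_cong[rotated]) (simp only: eq atMost_iff)
  show ?D if t: "t \<le> - c"
  proof -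
    define r where "r = - t - c"
    have r: "r \<ge> 0" "t = - c - r" using t by (auto simp: r_def)
    have S: "(- 2 * t - c) powr m = (c + 2 * r) powr m" using r by simp
    have bern: "c powr m * (c + 2 * r) \<le> (c + 2 * r) powr m * c"
    proof -
      have "c powr (m - 1) \<le> (c + 2 * r) powr (m - 1)" using r c m by (intro powr_mono2) auto
      then have "c * (c + 2 * r) * c powr (m - 1) \<le> c * (c + 2 * r) * (c + 2 * r) powr (m - 1)"
        using c r by (intro mult_left_mono) auto
      moreover have "c powr m = c powr (m - 1) * c" "(c + 2 * r) powr m = (c + 2 * r) powr (m - 1) * (c + 2 * r)"
        using c r powr_add[of _ "m - 1" 1] by simp_all
      ultimately show ?thesis by (simp only: mult_ac)
    qed
    have "(c + 2 * r) powr m * (m * c) + (c + 2 * r) powr m * ((m - 1) * r) \<ge> c powr m * ((c + 2 * r) * m) + c powr m * ((m - 1) * r)"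
    proof (rule add_mono)
      show "c powr m * ((c + 2 * r) * m) \<le> (c + 2 * r) powr m * (m * c)"
        using mult_right_mono[OF bern, of m] m by (simp add: mult_ac)
      show "c powr m * ((m - 1) * r) \<le> (c + 2 * r) powr m * ((m - 1) * r)"
        using c r m by (intro mult_right_mono powr_mono2) auto
    qed
    moreover have "c powr m * ((c + 2 * r) * m) + c powr m * ((m - 1) * r) \<ge> c powr m * (m * c + (m + 1) * r)"
    proof -
      have "(m + 1) * r \<le> (2 * m) * r + (m - 1) * r" using m r(1) by (simp add: mult_right_mono flip: distrib_right)
      then have "m * c + (m + 1) * r \<le> (c + 2 * r) * m + (m - 1) * r" by (simp add: algebra_simps)
      then show ?thesis by (simp add: mult_left_mono flip: distrib_left)
    qed
    ultimately have "c powr m * (m * c + (m + 1) * r) \<le> (c + 2 * r) powr m * (m * c + (m - 1) * r)"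
      by (simp only: distrib_left)
    moreover have "- t - c + m * t = - (m * c + (m - 1) * r)" "c + (m + 1) * t = - (m * c + (m + 1) * r)"
      unfolding r(2) by (simp_all add: algebra_simps)
    ultimately show ?thesis unfolding S by (simp only: mult_minus_right neg_le_iff_le)
  qed
qed

text \<open>The line carrying the affine middle piece dominates the whole function, hence is a
  supporting line at both junctions, and the pieces are glued first at \<open>- c\<close>, then at
  \<open>0\<close>.\<close>

lemma burkholder_concave_pos:
  fixes c m :: real
  assumes c: "c > 0" and m: "m \<ge> 1"
  shows "concave_on UNIV (\<lambda>t. burkholder m t (t + c))"
proof -
  define h where "h t = burkholder m t (t + c)" for t
  have h1: "h t = (2 * t + c) powr m * (t + c - m * t)" if "t \<ge> 0" for t
    using that c by (simp add: h_def burkholder_def add.commute)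
  have h2: "h t = c powr m * (c + (m + 1) * t)" if "- c \<le> t" "t \<le> 0" for t
    using that c by (simp add: h_def burkholder_def algebra_simps)
  have h3: "h t = (- 2 * t - c) powr m * (- t - c + m * t)" if "t \<le> - c" for t
  proof -
    have "\<bar>t\<bar> + \<bar>t + c\<bar> = - 2 * t - c" "\<bar>t + c\<bar> - m * \<bar>t\<bar> = - t - c + m * t" using that c by auto
    then show ?thesis by (simp only: h_def burkholder_def)
  qed
  have le: "h t \<le> c powr m * (c + (m + 1) * t)" for t
    using burkholder_diagonal_pieces(2,4)[OF c m, of t] h1[of t] h2[of t] h3[of t] by linarith
  have sup: "h t \<le> h a + ((m + 1) * c powr m) * (t - a)" if "- c \<le> a" "a \<le> 0" for a t
    using le[of t] h2[OF that] by (simp add: algebra_simps)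
  have c1: "concave_on {0..} h"
    by (rule concave_on_cong[OF _ burkholder_diagonal_pieces(1)[OF c m]]) (simp add: h1)
  have c3: "concave_on {..-c} h"
    by (rule concave_on_cong[OF _ burkholder_diagonal_pieces(3)[OF c m]]) (simp add: h3)
  \<comment> \<open>The affine piece is prolonged beyond \<open>0\<close>, so that the gluing at
    \<open>- c\<close> joins two half-lines; only the part on \<open>{..0}\<close> is kept.\<close>
  define k where "k t = (if t \<le> -c then h t else c powr m * (c + (m + 1) * t))" for t
  have kh: "k t = h t" if "t \<le> 0" for t using that h2 by (auto simp: k_def)
  have "concave_on UNIV k"
  proof (rule concave_on_glue[where a = "-c"])
    show "concave_on {..-c} k" by (rule concave_on_cong[OF _ c3]) (simp add: k_def)
    have "concave_on {-c..} (\<lambda>t. c powr m * (c + (m + 1) * t))"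
      unfolding concave_on_def by (rule convex_onI) (simp_all add: algebra_simps)
    moreover have "k t = c powr m * (c + (m + 1) * t)" if "t \<ge> -c" for t
      using h2[of t] c that by (auto simp: k_def)
    ultimately show "concave_on {-c..} k" using concave_on_cong[of "{-c..}"] by (metis atLeast_iff)
    show "k t \<le> k (- c) + (m + 1) * c powr m * (t - - c)" for t
      using le[of t] h2[of "-c"] c by (auto simp: k_def algebra_simps)
  qed
  then have "concave_on {..0} k" unfolding concave_on_def by (rule convex_on_subset) auto
  then have c2: "concave_on {..0} h" by (rule concave_on_cong[rotated]) (simp add: kh)
  have "concave_on UNIV h"
    by (rule concave_on_glue[OF c2 c1 sup]) (use c in auto)
  then show ?thesis by (simp add: h_def[abs_def])
qed

text \<open>Evenness in each variable reduces both slopes and both signs of \<open>c\<close> to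
  slope one with \<open>c > 0\<close>; the diagonal through the origin is reached by letting
  \<open>c\<close> tend to \<open>0\<close> from the right.\<close>

lemma burkholder_midpoint:
  fixes m c s t \<tau> :: real
  assumes m: "m \<ge> 1" and "\<tau> = 1 \<or> \<tau> = -1"
  shows "(burkholder m s (c + \<tau> * s) + burkholder m t (c + \<tau> * t)) / 2
    \<le> burkholder m ((s + t) / 2) (c + \<tau> * ((s + t) / 2))"
proof -
  have sym: "burkholder m (- x) w = burkholder m x w" "burkholder m x (- w) = burkholder m x w" for x w
    by (auto simp: burkholder_def)
  have pos: "(burkholder m s (s + c) + burkholder m t (t + c)) / 2 \<le> burkholder m ((s + t) / 2) ((s + t) / 2 + c)"
    if "c > 0" for s t c :: real
    using concave_onD[OF burkholder_concave_pos[OF that m], of "1/2" s t] by (simp add: field_simps)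
  have cont: "((\<lambda>c. burkholder m s (s + c)) \<longlongrightarrow> burkholder m s (s + 0)) (at_right 0)" for s
  proof -
    have "isCont (\<lambda>c. burkholder m s (s + c)) 0"
      unfolding burkholder_def using m by (intro continuous_intros) auto
    then have "((\<lambda>c. burkholder m s (s + c)) \<longlongrightarrow> burkholder m s (s + 0)) (at 0)"
      by (simp add: isCont_def)
    then show ?thesis by (rule tendsto_within_subset) simp
  qed
  have zero: "(burkholder m s s + burkholder m t t) / 2 \<le> burkholder m ((s + t) / 2) ((s + t) / 2)" for s t
  proof (rule tendsto_le[of "at_right (0::real)"])
    show "((\<lambda>c. burkholder m ((s + t) / 2) ((s + t) / 2 + c)) \<longlongrightarrow> burkholder m ((s + t) / 2) ((s + t) / 2)) (at_right 0)"
      using cont[of "(s + t) / 2"] by simp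
    show "((\<lambda>c. (burkholder m s (s + c) + burkholder m t (t + c)) / 2) \<longlongrightarrow> (burkholder m s s + burkholder m t t) / 2) (at_right 0)"
      using tendsto_divide[OF tendsto_add[OF cont[of s] cont[of t]] tendsto_const[of 2]] by simp
    show "\<forall>\<^sub>F x in at_right 0. (burkholder m s (s + x) + burkholder m t (t + x)) / 2 \<le> burkholder m ((s + t) / 2) ((s + t) / 2 + x)"
    proof (rule eventually_at_rightI[of 0 1])
      fix x :: real assume "x \<in> {0<..<1}"
      then show "(burkholder m s (s + x) + burkholder m t (t + x)) / 2 \<le> burkholder m ((s + t) / 2) ((s + t) / 2 + x)"
        using pos[of x s t] by simp
    qed simp
  qed simp
  have one: "(burkholder m s (s + c) + burkholder m t (t + c)) / 2 \<le> burkholder m ((s + t) / 2) ((s + t) / 2 + c)"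
    for s t c :: real
  proof (cases c "0 :: real" rule: linorder_cases)
    case less
    have e: "burkholder m x (x + c) = burkholder m (-x) (-x + - c)" for x
      using sym(1)[of x "x + c"] sym(2)[of "- x" "x + c"] by simp
    show ?thesis using pos[of "- c" "- s" "- t"] less
      by (simp add: e[of s] e[of t] e[of "(s + t) / 2"] minus_divide_left)
  qed (use zero pos in auto)
  show ?thesis
  proof (cases "\<tau> = 1")
    case True then show ?thesis using one[of s c t] by (simp add: add.commute)
  next
    case False
    then have \<tau>: "\<tau> = -1" using assms by simp
    have e: "burkholder m x (c + \<tau> * x) = burkholder m (- x) (- x + c)" for x
      using sym(1)[of x "c - x"] by (simp add: \<tau>)
    show ?thesis unfolding e using one[of "- s" c "- t"] by (simp add: minus_divide_left)
  qed
qed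

text \<open>Coercivity in \<open>w\<close>, the source of finiteness of the Legendre transform.
  Where \<open>\<bar>w\<bar> \<ge> 2 * m * \<bar>x\<bar>\<close> the second factor is at least
  \<open>\<bar>w\<bar> / 2\<close>; elsewhere every term is controlled by a power of
  \<open>\<bar>x\<bar>\<close>.\<close>

lemma burkholder_lower:
  assumes m: "m \<ge> 1"
  shows "burkholder m x w \<ge> \<bar>w\<bar> powr (m + 1) / 2 - (m * (1 + 2 * m) powr m + (2 * m) powr (m + 1)) * \<bar>x\<bar> powr (m + 1)"
proof -
  have pw: "z powr (m + 1) = z powr m * z" if "z \<ge> 0" for z :: real
    using that by (simp add: powr_add)
  show ?thesis
  proof (cases "\<bar>w\<bar> \<ge> 2 * m * \<bar>x\<bar>")
    case True
    have "\<bar>w\<bar> powr m * (\<bar>w\<bar> / 2) \<le> (\<bar>x\<bar> + \<bar>w\<bar>) powr m * (\<bar>w\<bar> - m * \<bar>x\<bar>)"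
      using True m by (intro mult_mono powr_mono2) auto
    then have "\<bar>w\<bar> powr (m + 1) / 2 \<le> burkholder m x w" by (simp add: pw burkholder_def)
    moreover have "0 \<le> (m * (1 + 2 * m) powr m + (2 * m) powr (m + 1)) * \<bar>x\<bar> powr (m + 1)"
      using m by auto
    ultimately show ?thesis by linarith
  next
    case False
    have "(\<bar>x\<bar> + \<bar>w\<bar>) powr m \<le> ((1 + 2 * m) * \<bar>x\<bar>) powr m"
      using False m by (intro powr_mono2) (auto simp: algebra_simps)
    then have "(\<bar>x\<bar> + \<bar>w\<bar>) powr m * (m * \<bar>x\<bar>) \<le> ((1 + 2 * m) * \<bar>x\<bar>) powr m * (m * \<bar>x\<bar>)"
      using m by (intro mult_right_mono) auto
    also have "\<dots> = m * (1 + 2 * m) powr m * \<bar>x\<bar> powr (m + 1)"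
      using m by (simp add: powr_mult pw)
    finally have 1: "(\<bar>x\<bar> + \<bar>w\<bar>) powr m * (m * \<bar>x\<bar>) \<le> m * (1 + 2 * m) powr m * \<bar>x\<bar> powr (m + 1)" .
    have "\<bar>w\<bar> powr (m + 1) \<le> (2 * m * \<bar>x\<bar>) powr (m + 1)"
      using False m by (intro powr_mono2) auto
    also have "\<dots> = (2 * m) powr (m + 1) * \<bar>x\<bar> powr (m + 1)" using m by (simp add: powr_mult)
    finally have 2: "\<bar>w\<bar> powr (m + 1) \<le> (2 * m) powr (m + 1) * \<bar>x\<bar> powr (m + 1)" .
    have "burkholder m x w = (\<bar>x\<bar> + \<bar>w\<bar>) powr m * \<bar>w\<bar> - (\<bar>x\<bar> + \<bar>w\<bar>) powr m * (m * \<bar>x\<bar>)"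
      by (simp add: burkholder_def algebra_simps)
    moreover have "(\<bar>x\<bar> + \<bar>w\<bar>) powr m * \<bar>w\<bar> \<ge> 0" "\<bar>w\<bar> powr (m + 1) \<ge> 0" by auto
    ultimately show ?thesis using 1 2 unfolding distrib_right by linarith
  qed
qed

section \<open>Partial Legendre transform in the second variable\<close>

definition bellman :: "real \<Rightarrow> real \<Rightarrow> real \<Rightarrow> real" where
  "bellman m x y = (SUP w. w * y - burkholder m x w)"

lemma conj_exp_gt1: "1 < p \<Longrightarrow> 1 < conj_exp p"
  by (simp add: conj_exp_def field_simps)

lemma conj_exp_inverse_sum: "1 < p \<Longrightarrow> 1 / p + 1 / conj_exp p = 1"
  by (simp add: conj_exp_def field_simps)

lemma conj_exp_conj_exp: "1 < p \<Longrightarrow> conj_exp (conj_exp p) = p"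
  by (simp add: conj_exp_def field_simps)

text \<open>Young's inequality spends on \<open>w * y\<close> exactly the term
  \<open>\<bar>w\<bar> powr (m + 1) / 2\<close> that \<open>burkholder_lower\<close> provides,
  leaving a bound free of \<open>w\<close>.\<close>

lemma bellman_bound_aux:
  assumes m: "m \<ge> 1"
  shows "w * y - burkholder m x w \<le> (m * (1 + 2 * m) powr m + (2 * m) powr (m + 1)) * \<bar>x\<bar> powr (m + 1)
     + 2 powr conj_exp (m + 1) * \<bar>y\<bar> powr conj_exp (m + 1)"
proof -
  define q where "q = conj_exp (m + 1)"
  have q: "q > 1" "1 / (m + 1) + 1 / q = 1" using m conj_exp_gt1 conj_exp_inverse_sum by (auto simp: q_def)
  have "w * y \<le> (\<bar>w\<bar> / 2) * (2 * \<bar>y\<bar>)" by (simp add: abs_mult[symmetric])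
  also have "\<dots> \<le> (\<bar>w\<bar> / 2) powr (m + 1) / (m + 1) + (2 * \<bar>y\<bar>) powr q / q"
    using m q by (intro Youngs_inequality) auto
  also have "\<dots> \<le> \<bar>w\<bar> powr (m + 1) / 2 + 2 powr q * \<bar>y\<bar> powr q"
  proof (rule add_mono)
    have "(\<bar>w\<bar> / 2) powr (m + 1) / (m + 1) \<le> \<bar>w\<bar> powr (m + 1) / (m + 1)"
      using m by (intro divide_right_mono powr_mono2) auto
    also have "\<dots> \<le> \<bar>w\<bar> powr (m + 1) / 2" using m by (intro divide_left_mono) auto
    finally show "(\<bar>w\<bar> / 2) powr (m + 1) / (m + 1) \<le> \<bar>w\<bar> powr (m + 1) / 2" .
    show "(2 * \<bar>y\<bar>) powr q / q \<le> 2 powr q * \<bar>y\<bar> powr q"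
      using divide_left_mono[of 1 q "(2 * \<bar>y\<bar>) powr q"] q by (simp add: powr_mult)
  qed
  finally show ?thesis using burkholder_lower[OF m, of w x] unfolding q_def by linarith
qed

lemma bellman_bdd: "m \<ge> 1 \<Longrightarrow> bdd_above (range (\<lambda>w. w * y - burkholder m x w))"
  using bellman_bound_aux by (intro bdd_aboveI2) blast

lemma bellman_ge: "m \<ge> 1 \<Longrightarrow> w * y - burkholder m x w \<le> bellman m x y"
  unfolding bellman_def by (rule cSUP_upper[OF UNIV_I bellman_bdd])

lemma bellman_nonneg: "m \<ge> 1 \<Longrightarrow> 0 \<le> bellman m x y"
  using bellman_ge[of m 0 y x] by (simp add: burkholder_def) (smt (verit) mult_nonneg_nonneg powr_ge_zero)

lemma bellman_le:
  assumes m: "m \<ge> 1"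
  shows "bellman m x y \<le> (m * (1 + 2 * m) powr m + (2 * m) powr (m + 1)) * \<bar>x\<bar> powr (m + 1)
     + 2 powr conj_exp (m + 1) * \<bar>y\<bar> powr conj_exp (m + 1)"
  unfolding bellman_def using bellman_bound_aux[OF m] by (intro cSUP_least) auto

text \<open>Adding \<open>\<plusminus> x y\<close> to the supremum shifts \<open>w\<close> by \<open>\<plusminus> x\<close>, so the concavity of the Burkholder function along
  the diagonals says exactly that \<open>bellman m x y \<plusminus> x y\<close> is convex.\<close>

lemma bellman_midpoint:
  assumes m: "m \<ge> 1"
  shows "\<bar>(x1 * y1 + x2 * y2) / 2 - (x1 + x2) / 2 * ((y1 + y2) / 2)\<bar>
    \<le> (bellman m x1 y1 + bellman m x2 y2) / 2 - bellman m ((x1 + x2) / 2) ((y1 + y2) / 2)"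
proof -
  define cov where "cov = (x1 * y1 + x2 * y2) / 2 - (x1 + x2) / 2 * ((y1 + y2) / 2)"
  define x y where "x = (x1 + x2) / 2" and "y = (y1 + y2) / 2"
  have "bellman m x y \<le> (bellman m x1 y1 + bellman m x2 y2) / 2 + \<tau> * cov"
    if \<tau>: "\<tau> = 1 \<or> \<tau> = -1" for \<tau>
    unfolding bellman_def[of m x y]
  proof (rule cSUP_least)
    fix w
    define c where "c = w + \<tau> * x"
    \<comment> \<open>Both points \<open>(x1, w1)\<close> and \<open>(x2, w2)\<close> lie on the
      diagonal of slope \<open>- \<tau>\<close> through their midpoint \<open>(x, w)\<close>. There
      the Burkholder function is midpoint concave, and the shift of \<open>w\<close> changes the
      average of \<open>w * y\<close> by exactly \<open>- \<tau> * cov\<close>.\<close>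
    define w1 w2 where "w1 = c + - \<tau> * x1" and "w2 = c + - \<tau> * x2"
    have "(burkholder m x1 w1 + burkholder m x2 w2) / 2 \<le> burkholder m x (c + - \<tau> * x)"
      unfolding x_def w1_def w2_def using \<tau> m by (intro burkholder_midpoint) auto
    then have "(burkholder m x1 w1 + burkholder m x2 w2) / 2 \<le> burkholder m x w" by (simp add: c_def)
    moreover have "w1 * y1 - burkholder m x1 w1 \<le> bellman m x1 y1" "w2 * y2 - burkholder m x2 w2 \<le> bellman m x2 y2"
      by (rule bellman_ge[OF m])+
    moreover have "(w1 * y1 + w2 * y2) / 2 = w * y - \<tau> * cov"
      unfolding w1_def w2_def c_def cov_def x_def y_def by (simp add: field_simps)
    moreover have "r - u \<le> (b1 + b2) / 2 + k" if "(u1 + u2) / 2 \<le> u" "a1 - u1 \<le> b1" "a2 - u2 \<le> b2" "(a1 + a2) / 2 = r - k"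
      for r u b1 b2 k u1 u2 a1 a2 :: real using that by (simp add: field_simps)
    ultimately show "w * y - burkholder m x w \<le> (bellman m x1 y1 + bellman m x2 y2) / 2 + \<tau> * cov" by blast
  qed simp
  from this[of 1] this[of "-1"] show ?thesis unfolding cov_def[symmetric] unfolding x_def[symmetric] y_def[symmetric] by auto
qed

text \<open>A supremum of functions continuous in both variables is lower semicontinuous: its
  superlevel sets are unions of open sets, so the uncountable supremum does no harm.\<close>

lemma bellman_measurable:
  assumes m: "m \<ge> 1"
  shows "(\<lambda>v. bellman m (fst v) (snd v)) \<in> borel_measurable borel"
proof (rule borel_measurableI_greater)
  fix a
  have "bellman m (fst v) (snd v) > a \<longleftrightarrow> (\<exists>w. w * snd v - burkholder m (fst v) w > a)" for v
    unfolding bellman_def using less_cSUP_iff[OF _ bellman_bdd[OF m], of a "snd v" "fst v"] by auto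
  then have "{v. a < bellman m (fst v) (snd v)} = (\<Union>w. {v. a < w * snd v - burkholder m (fst v) w})"
    by auto
  moreover have "open {v :: real \<times> real. a < w * snd v - burkholder m (fst v) w}" for w
  proof -
    have "continuous_on UNIV (\<lambda>v :: real \<times> real. (\<bar>fst v\<bar> + \<bar>w\<bar>) powr m)"
      using m by (intro continuous_on_powr' continuous_intros) auto
    then show ?thesis unfolding burkholder_def
      by (intro open_Collect_less continuous_on_diff continuous_on_mult continuous_on_add continuous_on_const
        continuous_on_rabs continuous_on_fst continuous_on_snd continuous_on_id)
  qed
  ultimately have "open {v. a < bellman m (fst v) (snd v)}" by auto
  then show "{v \<in> space borel. a < bellman m (fst v) (snd v)} \<in> sets borel" by auto
qed

text \<open>The interface to the analysis on the group, which lets all exponents be treated alike.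
  The last clause is midpoint convexity of \<open>B x y + x * y\<close> and of
  \<open>B x y - x * y\<close> at once.\<close>

definition bellman_function :: "real \<Rightarrow> real \<Rightarrow> (real \<Rightarrow> real \<Rightarrow> real) \<Rightarrow> bool" where
  "bellman_function p C B \<longleftrightarrow>
     (\<lambda>v. B (fst v) (snd v)) \<in> borel_measurable borel \<and>
     (\<forall>x y. 0 \<le> B x y) \<and> (\<forall>x y. B x y \<le> C * (\<bar>x\<bar> powr p + \<bar>y\<bar> powr conj_exp p)) \<and>
     (\<forall>x1 y1 x2 y2. \<bar>(x1 * y1 + x2 * y2) / 2 - (x1 + x2) / 2 * ((y1 + y2) / 2)\<bar>
       \<le> (B x1 y1 + B x2 y2) / 2 - B ((x1 + x2) / 2) ((y1 + y2) / 2))"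

lemma bellman_functionD:
  assumes "bellman_function p C B"
  shows "(\<lambda>v. B (fst v) (snd v)) \<in> borel_measurable borel"
    "0 \<le> B x y" "B x y \<le> C * (\<bar>x\<bar> powr p + \<bar>y\<bar> powr conj_exp p)"
    "\<bar>(x1 * y1 + x2 * y2) / 2 - (x1 + x2) / 2 * ((y1 + y2) / 2)\<bar>
       \<le> (B x1 y1 + B x2 y2) / 2 - B ((x1 + x2) / 2) ((y1 + y2) / 2)"
  using assms by (simp_all only: bellman_function_def)

text \<open>The interface is symmetric under exchanging \<open>x\<close> with \<open>y\<close> and
  \<open>p\<close> with its conjugate exponent. One of the two exponents is at least
  \<open>2\<close>, as the condition \<open>m \<ge> 1\<close> on the Burkholder function
  demands.\<close>

lemma bellman_function_exists:
  assumes p: "1 < (p :: real)"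
  shows "\<exists>C B. C > 0 \<and> bellman_function p C B"
proof -
  have *: "bellman (p - 1) x y \<le> ((p - 1) * (1 + 2 * (p - 1)) powr (p - 1) + (2 * (p - 1)) powr p
      + 2 powr conj_exp p) * (\<bar>x\<bar> powr p + \<bar>y\<bar> powr conj_exp p)" if "p \<ge> 2" for p x y
  proof -
    define a b where "a = (p - 1) * (1 + 2 * (p - 1)) powr (p - 1) + (2 * (p - 1)) powr p" and "b = 2 powr conj_exp p"
    have "a \<ge> 0" "b \<ge> 0" using that by (auto simp: a_def b_def)
    then have "a * X + b * Y \<le> (a + b) * (X + Y)" if "X \<ge> 0" "Y \<ge> 0" for X Y :: real
      using that by (simp add: algebra_simps)
    moreover have "bellman (p - 1) x y \<le> a * \<bar>x\<bar> powr p + b * \<bar>y\<bar> powr conj_exp p"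
      using bellman_le[of "p - 1" x y] that by (simp add: a_def b_def)
    ultimately show ?thesis unfolding a_def b_def by (meson order_trans powr_ge_zero)
  qed
  have pos: "(p - 1) * (1 + 2 * (p - 1)) powr (p - 1) + (2 * (p - 1)) powr p + 2 powr conj_exp p > 0"
    if "p \<ge> 2" for p :: real using that by (auto intro!: add_nonneg_pos)
  show ?thesis
  proof (cases "p \<ge> 2")
    case True
    have "bellman_function p ((p - 1) * (1 + 2 * (p - 1)) powr (p - 1) + (2 * (p - 1)) powr p
      + 2 powr conj_exp p) (bellman (p - 1))"
      unfolding bellman_function_def
      using *[OF True] bellman_measurable[of "p - 1"] bellman_nonneg[of "p - 1"] bellman_midpoint[of "p - 1"] True by simp
    then show ?thesis using pos[OF True] by blast
  next
    case False
    define q where "q = conj_exp p"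
    have q: "q \<ge> 2" "conj_exp q = p" using p False conj_exp_conj_exp
      by (auto simp: q_def conj_exp_def field_simps)
    have "(\<lambda>v. bellman (q - 1) (snd v) (fst v)) = (\<lambda>v. bellman (q - 1) (fst v) (snd v)) \<circ> (\<lambda>v. (snd v, fst v))"
      by auto
    moreover have "(\<lambda>v :: real \<times> real. (snd v, fst v)) \<in> borel_measurable borel"
      by (intro borel_measurable_continuous_onI continuous_intros)
    ultimately have meas: "(\<lambda>v. bellman (q - 1) (snd v) (fst v)) \<in> borel_measurable borel"
      using bellman_measurable[of "q - 1"] q by (auto intro: measurable_comp)
    have "bellman_function p ((q - 1) * (1 + 2 * (q - 1)) powr (q - 1) + (2 * (q - 1)) powr q
          + 2 powr conj_exp q) (\<lambda>x y. bellman (q - 1) y x)"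
      unfolding bellman_function_def
    proof (intro conjI allI meas)
      show "bellman (q - 1) y x \<le> ((q - 1) * (1 + 2 * (q - 1)) powr (q - 1) + (2 * (q - 1)) powr q
          + 2 powr conj_exp q) * (\<bar>x\<bar> powr p + \<bar>y\<bar> powr conj_exp p)" for x y
        using *[OF q(1), of y x] q by (simp add: q_def[symmetric] add.commute)
      show "\<bar>(x1 * y1 + x2 * y2) / 2 - (x1 + x2) / 2 * ((y1 + y2) / 2)\<bar>
          \<le> (bellman (q - 1) y1 x1 + bellman (q - 1) y2 x2) / 2 - bellman (q - 1) ((y1 + y2) / 2) ((x1 + x2) / 2)"
        for x1 y1 x2 y2
        using bellman_midpoint[of "q - 1" y1 x1 y2 x2] q by (simp add: mult.commute)
    qed (use q bellman_nonneg[of "q - 1"] in auto)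
    then show ?thesis using pos[OF q(1)] by blast
  qed
qed

section \<open>Oscillation functionals on the Herz algebra\<close>

text \<open>The recursion expands \<open>\<langle>\<lambda>(x) A\<^sub>s F, A\<^sub>s K\<rangle>\<close> by left invariance into four coefficients of \<open>F\<close> and \<open>K\<close>.\<close>

primrec walk_coeff :: "('a, 'b) monoid_scheme \<Rightarrow> 'a list \<Rightarrow> ('a \<Rightarrow> 'v) \<Rightarrow> 'a \<Rightarrow> 'v::real_vector" where
  "walk_coeff G [] u x = u x"
| "walk_coeff G (s # ss) u x = (1 / 4) *\<^sub>R (walk_coeff G ss u x + walk_coeff G ss u (x \<otimes>\<^bsub>G\<^esub> s)
     + walk_coeff G ss u (inv\<^bsub>G\<^esub> s \<otimes>\<^bsub>G\<^esub> x) + walk_coeff G ss u (inv\<^bsub>G\<^esub> s \<otimes>\<^bsub>G\<^esub> (x \<otimes>\<^bsub>G\<^esub> s)))"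

text \<open>The head of the list is the last averaging step, so \<open>length ss\<close> counts the
  earlier steps and the first difference has sign \<open>+1\<close>. The values range over any real
  vector space, so that the same functional acts on a complex function and on its real and imaginary
  parts.\<close>

primrec oscillation :: "('a, 'b) monoid_scheme \<Rightarrow> 'a list \<Rightarrow> ('a \<Rightarrow> 'v) \<Rightarrow> 'v::real_vector" where
  "oscillation G [] u = 0"
| "oscillation G (s # ss) u = (-1) ^ length ss *\<^sub>R (walk_coeff G ss u \<one>\<^bsub>G\<^esub> - walk_coeff G (s # ss) u \<one>\<^bsub>G\<^esub>) + oscillation G ss u"

primrec walk_avg :: "('a, 'b) monoid_scheme \<Rightarrow> 'a list \<Rightarrow> ('a \<Rightarrow> real) \<Rightarrow> 'a \<Rightarrow> real" where
  "walk_avg G [] f y = f y"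
| "walk_avg G (s # ss) f y = (walk_avg G ss f y + walk_avg G ss f (inv\<^bsub>G\<^esub> s \<otimes>\<^bsub>G\<^esub> y)) / 2"

lemma walk_coeff_linear: "linear \<phi> \<Longrightarrow> walk_coeff G ss (\<lambda>x. \<phi> (u x)) x = \<phi> (walk_coeff G ss u x)"
  by (induction ss arbitrary: x) (simp_all add: linear_add linear_scale)

lemma oscillation_linear: "linear \<phi> \<Longrightarrow> oscillation G ss (\<lambda>x. \<phi> (u x)) = \<phi> (oscillation G ss u)"
  by (induction ss) (simp_all add: linear_add linear_diff linear_scale linear_0 walk_coeff_linear)

lemma walk_coeff_add: "walk_coeff G ss (\<lambda>x. u x + v x) x = walk_coeff G ss u x + walk_coeff G ss v x"
  by (induction ss arbitrary: x) (simp_all add: algebra_simps)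

lemma oscillation_add: "oscillation G ss (\<lambda>x. u x + v x) = oscillation G ss u + oscillation G ss v"
  by (induction ss) (simp_all add: walk_coeff_add algebra_simps)

lemma oscillation_zero: "oscillation G ss (\<lambda>x. 0) = 0"
  using oscillation_linear[of "\<lambda>x. 0" G ss "\<lambda>x. 0"] by (simp add: linear_zero)

lemma oscillation_sum: "oscillation G ss (\<lambda>x. \<Sum>i<n. u i x) = (\<Sum>i<(n::nat). oscillation G ss (u i))"
  by (induction n) (simp_all add: oscillation_add oscillation_zero)

lemma oscillation_diff: "oscillation G ss (\<lambda>x. u x - v x) = oscillation G ss u - oscillation G ss v"
  using oscillation_add[of G ss u "\<lambda>x. - v x"] oscillation_linear[OF linear_uminus, of G ss v] by simp

text \<open>A real counterpart of \<open>in_Lp\<close>, because the Bellman function takes real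
  arguments.\<close>

definition Lp_fun :: "'a measure \<Rightarrow> real \<Rightarrow> ('a \<Rightarrow> real) \<Rightarrow> bool" where
  "Lp_fun \<mu> p f \<longleftrightarrow> f \<in> borel_measurable \<mu> \<and> integrable \<mu> (\<lambda>x. \<bar>f x\<bar> powr p)"

text \<open>Separating left invariance from topology lets one argument serve the Haar measure as
  well as the counting measures of a discrete group and of its subgroups.\<close>

locale invariant_measure = group G for G :: "('a, 'b) monoid_scheme" (structure) +
  fixes \<mu> :: "'a measure"
  assumes space_eq: "space \<mu> = carrier G"
    and trans_meas: "a \<in> carrier G \<Longrightarrow> (\<lambda>y. a \<otimes> y) \<in> measurable \<mu> \<mu>"
    and trans_inv: "a \<in> carrier G \<Longrightarrow> distr \<mu> \<mu> (\<lambda>y. a \<otimes> y) = \<mu>"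
begin

lemma walk_coeff_cong: "(\<And>x. x \<in> carrier G \<Longrightarrow> u x = v x) \<Longrightarrow> set ss \<subseteq> carrier G \<Longrightarrow> x \<in> carrier G \<Longrightarrow>
    walk_coeff G ss u x = walk_coeff G ss v x"
  by (induction ss arbitrary: x) simp_all

lemma oscillation_cong: "(\<And>x. x \<in> carrier G \<Longrightarrow> u x = v x) \<Longrightarrow> set ss \<subseteq> carrier G \<Longrightarrow> oscillation G ss u = oscillation G ss v"
  by (induction ss) (auto simp: walk_coeff_cong[of u v])

lemma walk_coeff_tendsto:
  fixes u :: "nat \<Rightarrow> 'a \<Rightarrow> 'v :: real_normed_vector"
  shows "(\<And>x. x \<in> carrier G \<Longrightarrow> (\<lambda>n. u n x) \<longlonglongrightarrow> v x) \<Longrightarrow> set ss \<subseteq> carrier G \<Longrightarrow> x \<in> carrier G \<Longrightarrow>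
    (\<lambda>n. walk_coeff G ss (u n) x) \<longlonglongrightarrow> walk_coeff G ss v x"
  by (induction ss arbitrary: x) (auto intro!: tendsto_intros)

lemma oscillation_tendsto:
  fixes u :: "nat \<Rightarrow> 'a \<Rightarrow> 'v :: real_normed_vector"
  shows "(\<And>x. x \<in> carrier G \<Longrightarrow> (\<lambda>n. u n x) \<longlonglongrightarrow> v x) \<Longrightarrow> set ss \<subseteq> carrier G \<Longrightarrow>
    (\<lambda>n. oscillation G ss (u n)) \<longlonglongrightarrow> oscillation G ss v"
proof (induction ss)
  case (Cons s ss)
  have "(\<lambda>n. walk_coeff G ss (u n) x) \<longlonglongrightarrow> walk_coeff G ss v x" "(\<lambda>n. walk_coeff G (s # ss) (u n) x) \<longlonglongrightarrow> walk_coeff G (s # ss) v x"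
    if "x \<in> carrier G" for x using Cons.prems that by (auto intro!: walk_coeff_tendsto simp del: walk_coeff.simps)
  then show ?case using Cons by (auto intro!: tendsto_intros simp del: walk_coeff.simps)
qed simp

section \<open>Translates, averages and coefficients of real functions\<close>

lemma integral_translate:
  fixes h :: "'a \<Rightarrow> 'v :: {banach, second_countable_topology}"
  assumes "a \<in> carrier G" "h \<in> borel_measurable \<mu>"
  shows "(\<integral>y. h (a \<otimes> y) \<partial>\<mu>) = integral\<^sup>L \<mu> h"
  using integral_distr[OF trans_meas[OF assms(1)] assms(2)] trans_inv[OF assms(1)] by simp

lemma integrable_translate:
  fixes h :: "'a \<Rightarrow> 'v :: {banach, second_countable_topology}"
  assumes "a \<in> carrier G" "integrable \<mu> h"
  shows "integrable \<mu> (\<lambda>y. h (a \<otimes> y))"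
  using integrable_distr[OF trans_meas[OF assms(1)], of h] trans_inv[OF assms(1)] assms(2) by simp

lemma measurable_translate:
  assumes "a \<in> carrier G" "h \<in> measurable \<mu> N"
  shows "(\<lambda>y. h (a \<otimes> y)) \<in> measurable \<mu> N"
  using measurable_compose[OF trans_meas[OF assms(1)] assms(2)] .

lemma Lp_fun_translate: "a \<in> carrier G \<Longrightarrow> Lp_fun \<mu> p f \<Longrightarrow> Lp_fun \<mu> p (\<lambda>y. f (a \<otimes> y))"
  unfolding Lp_fun_def using measurable_translate[of a f] integrable_translate[of a "\<lambda>x. \<bar>f x\<bar> powr p"] by auto

lemma Lp_fun_mid:
  assumes p: "p > 0" and f: "Lp_fun \<mu> p f" and g: "Lp_fun \<mu> p g"
  shows "Lp_fun \<mu> p (\<lambda>y. (f y + g y) / 2)"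
  unfolding Lp_fun_def
proof
  show "(\<lambda>y. (f y + g y) / 2) \<in> borel_measurable \<mu>" using f g by (auto simp: Lp_fun_def)
  show "integrable \<mu> (\<lambda>x. \<bar>(f x + g x) / 2\<bar> powr p)"
  proof (rule Bochner_Integration.integrable_bound)
    show "integrable \<mu> (\<lambda>x. \<bar>f x\<bar> powr p + \<bar>g x\<bar> powr p)" using f g by (auto simp: Lp_fun_def)
    show "(\<lambda>x. \<bar>(f x + g x) / 2\<bar> powr p) \<in> borel_measurable \<mu>" using f g by (auto simp: Lp_fun_def)
    have "\<bar>(a + b) / 2\<bar> powr p \<le> \<bar>a\<bar> powr p + \<bar>b\<bar> powr p" for a b :: real
    proof -
      have "\<bar>(a + b) / 2\<bar> powr p \<le> (max \<bar>a\<bar> \<bar>b\<bar>) powr p" using p by (intro powr_mono2) auto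
      also have "\<dots> \<le> \<bar>a\<bar> powr p + \<bar>b\<bar> powr p" by (auto simp: max_def)
      finally show ?thesis .
    qed
    then show "AE x in \<mu>. norm (\<bar>(f x + g x) / 2\<bar> powr p) \<le> norm (\<bar>f x\<bar> powr p + \<bar>g x\<bar> powr p)" by auto
  qed
qed

lemma Lp_fun_avg: "p > 0 \<Longrightarrow> Lp_fun \<mu> p f \<Longrightarrow> set ss \<subseteq> carrier G \<Longrightarrow> Lp_fun \<mu> p (walk_avg G ss f)"
proof (induction ss)
  case (Cons s ss)
  then show ?case using Lp_fun_mid[of p "walk_avg G ss f" "\<lambda>y. walk_avg G ss f (inv s \<otimes> y)"]
      Lp_fun_translate[of "inv s" p "walk_avg G ss f"] by (simp add: walk_avg.simps(2)[abs_def])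
qed (simp add: walk_avg.simps(1)[abs_def])

lemma Lp_fun_mult:
  assumes p: "1 < p" and f: "Lp_fun \<mu> p f" and g: "Lp_fun \<mu> (conj_exp p) g"
  shows "integrable \<mu> (\<lambda>y. g y * f y)"
proof (rule Bochner_Integration.integrable_bound)
  show "integrable \<mu> (\<lambda>x. \<bar>f x\<bar> powr p / p + \<bar>g x\<bar> powr (conj_exp p) / conj_exp p)" using f g by (auto simp: Lp_fun_def)
  show "(\<lambda>y. g y * f y) \<in> borel_measurable \<mu>" using f g by (auto simp: Lp_fun_def)
  have "norm (b * a) \<le> norm (\<bar>a\<bar> powr p / p + \<bar>b\<bar> powr (conj_exp p) / conj_exp p)" for a b :: real
    using Youngs_inequality[OF p conj_exp_gt1[OF p] conj_exp_inverse_sum[OF p], of "\<bar>a\<bar>" "\<bar>b\<bar>"]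
    by (simp add: abs_mult mult.commute)
  then show "AE x in \<mu>. norm (g x * f x) \<le> norm (\<bar>f x\<bar> powr p / p + \<bar>g x\<bar> powr (conj_exp p) / conj_exp p)" by auto
qed

lemma walk_coeff_coefficient:
  assumes p: "1 < p" and f: "Lp_fun \<mu> p f" and g: "Lp_fun \<mu> (conj_exp p) g"
    and u: "\<And>x. x \<in> carrier G \<Longrightarrow> u x = (\<integral>y. g y * f (inv x \<otimes> y) \<partial>\<mu>)"
  shows "set ss \<subseteq> carrier G \<Longrightarrow> x \<in> carrier G \<Longrightarrow>
    walk_coeff G ss u x = (\<integral>y. walk_avg G ss g y * walk_avg G ss f (inv x \<otimes> y) \<partial>\<mu>)"
proof (induction ss arbitrary: x)
  case Nil
  then show ?case using u by simp
next
  case (Cons s ss)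
  define F K where "F = walk_avg G ss f" and "K = walk_avg G ss g"
  have s: "s \<in> carrier G" and ss: "set ss \<subseteq> carrier G" using Cons.prems by auto
  have x: "x \<in> carrier G" by fact
  have cancel: "s \<otimes> (inv s \<otimes> y) = y" if "y \<in> carrier G" for y
    using s that by (simp flip: m_assoc)
  have F: "Lp_fun \<mu> p F" and K: "Lp_fun \<mu> (conj_exp p) K"
    unfolding F_def K_def using conj_exp_gt1[OF p] p by (auto intro!: Lp_fun_avg f g ss)
  have IH: "walk_coeff G ss u x = (\<integral>y. K y * F (inv x \<otimes> y) \<partial>\<mu>)" if "x \<in> carrier G" for x
    using Cons.IH[OF ss that] by (simp add: F_def K_def)
  have int: "integrable \<mu> (\<lambda>y. K (b \<otimes> y) * F (a \<otimes> y))" if "a \<in> carrier G" "b \<in> carrier G" for a b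
    using Lp_fun_mult[OF p Lp_fun_translate[OF that(1) F] Lp_fun_translate[OF that(2) K]] .
  have int1: "integrable \<mu> (\<lambda>y. K y * F (a \<otimes> y))" if "a \<in> carrier G" for a
    using Lp_fun_mult[OF p Lp_fun_translate[OF that F] K] .
  \<comment> \<open>The form in which invariance is used: once \<open>s \<otimes> inv s\<close> is
    inserted before \<open>y\<close>, both factors depend on \<open>inv s \<otimes> y\<close> and
    the variable can be changed.\<close>
  have shift: "(\<integral>y. K (inv s \<otimes> y) * F (a \<otimes> (inv s \<otimes> y)) \<partial>\<mu>) = (\<integral>y. K y * F (a \<otimes> y) \<partial>\<mu>)"
    if "a \<in> carrier G" for a
    using integral_translate[of "inv s" "\<lambda>y. K y * F (a \<otimes> y)"] s int1[OF that] by auto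
  have 1: "walk_coeff G ss u x = (\<integral>y. K y * F (inv x \<otimes> y) \<partial>\<mu>)" using IH x .
  have 2: "walk_coeff G ss u (x \<otimes> s) = (\<integral>y. K y * F (inv s \<otimes> (inv x \<otimes> y)) \<partial>\<mu>)"
    using IH[of "x \<otimes> s"] x s
    by (auto simp: inv_mult_group m_assoc space_eq intro!: Bochner_Integration.integral_cong)
  have 3: "walk_coeff G ss u (inv s \<otimes> x) = (\<integral>y. K (inv s \<otimes> y) * F (inv x \<otimes> y) \<partial>\<mu>)"
  proof -
    have "walk_coeff G ss u (inv s \<otimes> x) = (\<integral>y. K (inv s \<otimes> y) * F ((inv x \<otimes> s) \<otimes> (inv s \<otimes> y)) \<partial>\<mu>)"
      using IH[of "inv s \<otimes> x"] x s by (simp add: inv_mult_group shift)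
    also have "\<dots> = (\<integral>y. K (inv s \<otimes> y) * F (inv x \<otimes> y) \<partial>\<mu>)"
      using x s by (auto simp: m_assoc cancel space_eq intro!: Bochner_Integration.integral_cong)
    finally show ?thesis .
  qed
  have 4: "walk_coeff G ss u (inv s \<otimes> (x \<otimes> s)) = (\<integral>y. K (inv s \<otimes> y) * F (inv s \<otimes> (inv x \<otimes> y)) \<partial>\<mu>)"
  proof -
    have "walk_coeff G ss u (inv s \<otimes> (x \<otimes> s)) = (\<integral>y. K (inv s \<otimes> y) * F ((inv s \<otimes> inv x \<otimes> s) \<otimes> (inv s \<otimes> y)) \<partial>\<mu>)"
      using IH[of "inv s \<otimes> (x \<otimes> s)"] x s by (simp add: inv_mult_group m_assoc shift)
    also have "\<dots> = (\<integral>y. K (inv s \<otimes> y) * F (inv s \<otimes> (inv x \<otimes> y)) \<partial>\<mu>)"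
      using x s by (auto simp: m_assoc cancel space_eq intro!: Bochner_Integration.integral_cong)
    finally show ?thesis .
  qed
  have "(\<integral>y. walk_avg G (s # ss) g y * walk_avg G (s # ss) f (inv x \<otimes> y) \<partial>\<mu>)
    = (\<integral>y. (K y * F (inv x \<otimes> y) + K y * F (inv s \<otimes> (inv x \<otimes> y))
        + K (inv s \<otimes> y) * F (inv x \<otimes> y) + K (inv s \<otimes> y) * F (inv s \<otimes> (inv x \<otimes> y))) / 4 \<partial>\<mu>)"
    by (rule Bochner_Integration.integral_cong) (auto simp: F_def K_def field_simps)
  also have "\<dots> = walk_coeff G (s # ss) u x"
  proof -
    have i2: "integrable \<mu> (\<lambda>y. K y * F (inv s \<otimes> (inv x \<otimes> y)))"
      by (rule iffD1[OF Bochner_Integration.integrable_cong int1[of "inv s \<otimes> inv x"]])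
        (use x s in \<open>auto simp: m_assoc space_eq\<close>)
    have i4: "integrable \<mu> (\<lambda>y. K (inv s \<otimes> y) * F (inv s \<otimes> (inv x \<otimes> y)))"
      by (rule iffD1[OF Bochner_Integration.integrable_cong int[of "inv s \<otimes> inv x" "inv s"]])
        (use x s in \<open>auto simp: m_assoc space_eq\<close>)
    show ?thesis
      using int1[of "inv x"] i2 int[of "inv x" "inv s"] i4 x s by (simp add: 1 2 3 4)
  qed
  finally show ?case by simp
qed

text \<open>The integral of \<open>B\<close> over the current averages acts as a potential and has
  to be carried in the claim. A step changes the oscillation, whatever the sign, by at most the drop
  of the potential. This works pointwise: the new pair is the midpoint of \<open>(F, K)\<close> and
  its translate \<open>(F', K')\<close>, and by invariance the translate has the same integrals as
  \<open>(F, K)\<close>.\<close>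

lemma oscillation_coefficient_bound:
  assumes p: "1 < p" and f: "Lp_fun \<mu> p f" and g: "Lp_fun \<mu> (conj_exp p) g"
    and u: "\<And>x. x \<in> carrier G \<Longrightarrow> u x = (\<integral>y. g y * f (inv x \<otimes> y) \<partial>\<mu>)"
    and B: "bellman_function p C B"
  shows "set ss \<subseteq> carrier G \<Longrightarrow>
    \<bar>oscillation G ss u\<bar> + (\<integral>y. B (walk_avg G ss f y) (walk_avg G ss g y) \<partial>\<mu>) \<le> (\<integral>y. B (f y) (g y) \<partial>\<mu>)"
proof (induction ss)
  case Nil
  then show ?case by simp
next
  case (Cons s ss)
  define F K where "F = walk_avg G ss f" and "K = walk_avg G ss g"
  have s: "s \<in> carrier G" and ss: "set ss \<subseteq> carrier G" using Cons.prems by auto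
  have q: "conj_exp p > 1" using conj_exp_gt1[OF p] .
  have F: "Lp_fun \<mu> p F" and K: "Lp_fun \<mu> (conj_exp p) K"
    unfolding F_def K_def using q p by (auto intro!: Lp_fun_avg f g ss)
  have Bint: "integrable \<mu> (\<lambda>y. B (F y) (K y))" if "Lp_fun \<mu> p F" "Lp_fun \<mu> (conj_exp p) K" for F K
  proof (rule Bochner_Integration.integrable_bound)
    show "integrable \<mu> (\<lambda>x. C * (\<bar>F x\<bar> powr p + \<bar>K x\<bar> powr (conj_exp p)))" using that by (auto simp: Lp_fun_def)
    have "(\<lambda>y. (F y, K y)) \<in> borel_measurable \<mu>" using that by (auto simp: Lp_fun_def)
    from measurable_compose[OF this bellman_functionD(1)[OF B]] show "(\<lambda>y. B (F y) (K y)) \<in> borel_measurable \<mu>" by simp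
    have "norm (B (F x) (K x)) \<le> norm (C * (\<bar>F x\<bar> powr p + \<bar>K x\<bar> powr (conj_exp p)))" for x
      using bellman_functionD(2)[OF B, of "F x" "K x"] bellman_functionD(3)[OF B, of "F x" "K x"] by simp
    then show "AE x in \<mu>. norm (B (F x) (K x)) \<le> norm (C * (\<bar>F x\<bar> powr p + \<bar>K x\<bar> powr (conj_exp p)))" by simp
  qed
  define F' K' where "F' y = F (inv s \<otimes> y)" and "K' y = K (inv s \<otimes> y)" for y
  have F': "Lp_fun \<mu> p F'" and K': "Lp_fun \<mu> (conj_exp p) K'"
    unfolding F'_def[abs_def] K'_def[abs_def] using s F K by (auto intro!: Lp_fun_translate)
  define Fm Km where "Fm y = (F y + F' y) / 2" and "Km y = (K y + K' y) / 2" for y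
  have Fm: "Lp_fun \<mu> p Fm" and Km: "Lp_fun \<mu> (conj_exp p) Km"
    unfolding Fm_def[abs_def] Km_def[abs_def] using p q F K F' K' by (auto intro!: Lp_fun_mid)
  have avgs: "walk_avg G (s # ss) f = Fm" "walk_avg G (s # ss) g = Km"
    by (auto simp: Fm_def Km_def F_def K_def F'_def K'_def)
  have d1: "walk_coeff G ss u \<one> = (\<integral>y. K y * F y \<partial>\<mu>)"
    using walk_coeff_coefficient[OF p f g u ss, of \<one>]
    by (auto simp: F_def K_def space_eq intro!: Bochner_Integration.integral_cong)
  have d2: "walk_coeff G (s # ss) u \<one> = (\<integral>y. Km y * Fm y \<partial>\<mu>)"
    using walk_coeff_coefficient[OF p f g u Cons.prems, of \<one>] unfolding avgs
    by (auto simp: space_eq simp del: walk_coeff.simps intro!: Bochner_Integration.integral_cong)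
  have iFK: "integrable \<mu> (\<lambda>y. K y * F y)" "integrable \<mu> (\<lambda>y. K' y * F' y)" "integrable \<mu> (\<lambda>y. Km y * Fm y)"
    using Lp_fun_mult[OF p] F K F' K' Fm Km by auto
  have iB: "integrable \<mu> (\<lambda>y. B (F y) (K y))" "integrable \<mu> (\<lambda>y. B (F' y) (K' y))" "integrable \<mu> (\<lambda>y. B (Fm y) (Km y))"
    using Bint F K F' K' Fm Km by auto
  have t1: "(\<integral>y. K' y * F' y \<partial>\<mu>) = (\<integral>y. K y * F y \<partial>\<mu>)"
    unfolding K'_def F'_def using integral_translate[of "inv s" "\<lambda>y. K y * F y"] s iFK by auto
  have t2: "(\<integral>y. B (F' y) (K' y) \<partial>\<mu>) = (\<integral>y. B (F y) (K y) \<partial>\<mu>)"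
    unfolding K'_def F'_def using integral_translate[of "inv s" "\<lambda>y. B (F y) (K y)"] s iB by auto
  have "walk_coeff G ss u \<one> - walk_coeff G (s # ss) u \<one> = (\<integral>y. (K y * F y + K' y * F' y) / 2 - Km y * Fm y \<partial>\<mu>)"
    using iFK by (simp add: d1 d2 t1 del: walk_coeff.simps)
  also have "\<bar>\<dots>\<bar> \<le> (\<integral>y. (B (F y) (K y) + B (F' y) (K' y)) / 2 - B (Fm y) (Km y) \<partial>\<mu>)"
  proof (rule order_trans[OF integral_abs_bound integral_mono])
    show "\<bar>(K y * F y + K' y * F' y) / 2 - Km y * Fm y\<bar> \<le> (B (F y) (K y) + B (F' y) (K' y)) / 2 - B (Fm y) (Km y)" for y
      using bellman_functionD(4)[OF B, of "F y" "K y" "F' y" "K' y"] by (simp add: Fm_def Km_def mult.commute)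
  qed (use iFK iB in auto)
  also have "\<dots> = (\<integral>y. B (F y) (K y) \<partial>\<mu>) - (\<integral>y. B (Fm y) (Km y) \<partial>\<mu>)"
    using iB by (simp add: t2)
  finally have "\<bar>walk_coeff G ss u \<one> - walk_coeff G (s # ss) u \<one>\<bar> \<le> (\<integral>y. B (F y) (K y) \<partial>\<mu>) - (\<integral>y. B (Fm y) (Km y) \<partial>\<mu>)" .
  moreover have "\<bar>oscillation G (s # ss) u\<bar> \<le> \<bar>walk_coeff G ss u \<one> - walk_coeff G (s # ss) u \<one>\<bar> + \<bar>oscillation G ss u\<bar>"
    using abs_triangle_ineq[of "(-1) ^ length ss *\<^sub>R (walk_coeff G ss u \<one> - walk_coeff G (s # ss) u \<one>)" "oscillation G ss u"]
    by (simp add: abs_mult del: walk_coeff.simps)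
  ultimately show ?case using Cons.IH[OF ss] unfolding avgs F_def[symmetric] K_def[symmetric] by linarith
qed

lemma conv_check_eq:
  assumes "x \<in> carrier G"
  shows "conv G \<mu> g (check G f) x = (\<integral>y. g y * f (inv x \<otimes> y) \<partial>\<mu>)"
  unfolding conv_def check_def using assms
  by (auto intro!: Bochner_Integration.integral_cong simp: space_eq inv_mult_group)

text \<open>The growth bound on \<open>B\<close> adds powers of the two functions instead of
  multiplying their norms, so the estimate is first obtained for normalised functions; homogeneity
  restores the product afterwards.\<close>

lemma oscillation_real_normalized:
  assumes p: "1 < p" and f: "Lp_fun \<mu> p f" and g: "Lp_fun \<mu> (conj_exp p) g"
    and f1: "(\<integral>y. \<bar>f y\<bar> powr p \<partial>\<mu>) \<le> 1" and g1: "(\<integral>y. \<bar>g y\<bar> powr conj_exp p \<partial>\<mu>) \<le> 1"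
    and B: "C > 0" "bellman_function p C B"
    and ss: "set ss \<subseteq> carrier G"
  shows "\<bar>oscillation G ss (\<lambda>x. \<integral>y. g y * f (inv x \<otimes> y) \<partial>\<mu>)\<bar> \<le> 2 * C"
proof -
  have "\<bar>oscillation G ss (\<lambda>x. \<integral>y. g y * f (inv x \<otimes> y) \<partial>\<mu>)\<bar> + (\<integral>y. B (walk_avg G ss f y) (walk_avg G ss g y) \<partial>\<mu>)
    \<le> (\<integral>y. B (f y) (g y) \<partial>\<mu>)"
    by (rule oscillation_coefficient_bound[OF p f g refl B(2) ss])
  also have "\<dots> \<le> (\<integral>y. C * (\<bar>f y\<bar> powr p + \<bar>g y\<bar> powr conj_exp p) \<partial>\<mu>)"
    using f g B(1) bellman_functionD(3)[OF B(2)] by (intro integral_mono') (auto simp: Lp_fun_def)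
  also have "\<dots> = C * ((\<integral>y. \<bar>f y\<bar> powr p \<partial>\<mu>) + (\<integral>y. \<bar>g y\<bar> powr conj_exp p \<partial>\<mu>))"
    using f g by (simp add: Lp_fun_def)
  also have "\<dots> \<le> C * (1 + 1)" using f1 g1 B(1) by (intro mult_left_mono add_mono) auto
  finally have "\<bar>oscillation G ss (\<lambda>x. \<integral>y. g y * f (inv x \<otimes> y) \<partial>\<mu>)\<bar> + (\<integral>y. B (walk_avg G ss f y) (walk_avg G ss g y) \<partial>\<mu>) \<le> 2 * C" by simp
  moreover have "0 \<le> (\<integral>y. B (walk_avg G ss f y) (walk_avg G ss g y) \<partial>\<mu>)" by (rule Bochner_Integration.integral_nonneg) (rule bellman_functionD(2)[OF B(2)])
  ultimately show ?thesis by simp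
qed

section \<open>From real functions to the Herz norm\<close>

lemma in_Lp_Re_Im:
  assumes p: "p > 0" and f: "in_Lp \<mu> p f"
  shows "Lp_fun \<mu> p (\<lambda>x. Re (f x))" "Lp_fun \<mu> p (\<lambda>x. Im (f x))"
    and "(\<integral>y. \<bar>Re (f y)\<bar> powr p \<partial>\<mu>) \<le> (\<integral>y. norm (f y) powr p \<partial>\<mu>)"
    and "(\<integral>y. \<bar>Im (f y)\<bar> powr p \<partial>\<mu>) \<le> (\<integral>y. norm (f y) powr p \<partial>\<mu>)"
proof -
  have m: "(\<lambda>x. Re (f x)) \<in> borel_measurable \<mu>" "(\<lambda>x. Im (f x)) \<in> borel_measurable \<mu>"
    and i: "integrable \<mu> (\<lambda>x. norm (f x) powr p)" using f by (auto simp: in_Lp_def)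
  have le: "\<bar>Re z\<bar> powr p \<le> norm z powr p" "\<bar>Im z\<bar> powr p \<le> norm z powr p" for z
    using p by (auto intro!: powr_mono2 abs_Re_le_cmod abs_Im_le_cmod)
  have 1: "integrable \<mu> (\<lambda>x. \<bar>Re (f x)\<bar> powr p)" "integrable \<mu> (\<lambda>x. \<bar>Im (f x)\<bar> powr p)"
    using m le by (auto intro!: Bochner_Integration.integrable_bound[OF i])
  then show "Lp_fun \<mu> p (\<lambda>x. Re (f x))" "Lp_fun \<mu> p (\<lambda>x. Im (f x))" using m by (auto simp: Lp_fun_def)
  show "(\<integral>y. \<bar>Re (f y)\<bar> powr p \<partial>\<mu>) \<le> (\<integral>y. norm (f y) powr p \<partial>\<mu>)"
    "(\<integral>y. \<bar>Im (f y)\<bar> powr p \<partial>\<mu>) \<le> (\<integral>y. norm (f y) powr p \<partial>\<mu>)"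
    using 1 i le by (auto intro!: integral_mono)
qed

lemma in_Lp_mult:
  assumes p: "1 < p" and f: "in_Lp \<mu> p f" and g: "in_Lp \<mu> (conj_exp p) g"
  shows "integrable \<mu> (\<lambda>y. g y * f y)"
proof -
  have "p > 0" "conj_exp p > 0" using p conj_exp_gt1[OF p] by auto
  note fR = in_Lp_Re_Im(1,2)[OF this(1) f] and gR = in_Lp_Re_Im(1,2)[OF this(2) g]
  have "integrable \<mu> (\<lambda>y. complex_of_real (Re (g y) * Re (f y) - Im (g y) * Im (f y))
     + \<i> * complex_of_real (Re (g y) * Im (f y) + Im (g y) * Re (f y)))"
    by (intro Bochner_Integration.integrable_add Bochner_Integration.integrable_diff integrable_mult_right
        integrable_of_real Lp_fun_mult[OF p] fR gR)
  moreover have "complex_of_real (Re w * Re z - Im w * Im z) + \<i> * complex_of_real (Re w * Im z + Im w * Re z) = w * z" for w z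
    by (simp add: complex_eq_iff)
  ultimately show ?thesis by simp
qed

lemma in_Lp_translate:
  assumes "a \<in> carrier G" "in_Lp \<mu> p f"
  shows "in_Lp \<mu> p (\<lambda>y. f (a \<otimes> y))"
  using assms measurable_translate[of a f borel] integrable_translate[of a "\<lambda>x. norm (f x) powr p"]
  by (auto simp: in_Lp_def)

text \<open>The factor \<open>8\<close> counts four real products, two in the real part and two in
  the imaginary part, at \<open>2 * C\<close> each.\<close>

lemma oscillation_normalized:
  assumes p: "1 < p" and f: "in_Lp \<mu> p f" and g: "in_Lp \<mu> (conj_exp p) g"
    and f1: "(\<integral>y. norm (f y) powr p \<partial>\<mu>) \<le> 1" and g1: "(\<integral>y. norm (g y) powr conj_exp p \<partial>\<mu>) \<le> 1"
    and B: "C > 0" "bellman_function p C B"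
    and ss: "set ss \<subseteq> carrier G"
  shows "norm (oscillation G ss (conv G \<mu> g (check G f))) \<le> 8 * C"
proof -
  have q: "conj_exp p > 0" and p0: "p > 0" using conj_exp_gt1[OF p] p by auto
  define u where "u = conv G \<mu> g (check G f)"
  define r where "r a b x = (\<integral>y. b y * a (inv x \<otimes> y) \<partial>\<mu>)" for a b :: "'a \<Rightarrow> real" and x
  note fR = in_Lp_Re_Im[OF p0 f] and gR = in_Lp_Re_Im[OF q g]
  have rb: "\<bar>oscillation G ss (r (\<lambda>x. h1 (f x)) (\<lambda>x. h2 (g x)))\<bar> \<le> 2 * C" if "h1 \<in> {Re, Im}" "h2 \<in> {Re, Im}" for h1 h2
    unfolding r_def using that fR gR f1 g1 by (intro oscillation_real_normalized[OF p _ _ _ _ B ss]) auto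
  have int: "integrable \<mu> (\<lambda>y. h2 (g y) * h1 (f (inv x \<otimes> y)))"
    if "h1 \<in> {Re, Im}" "h2 \<in> {Re, Im}" "x \<in> carrier G" for h1 h2 x
    using that fR gR by (intro Lp_fun_mult[OF p] Lp_fun_translate[of "inv x" p "\<lambda>y. h1 (f y)"]) auto
  have cint: "integrable \<mu> (\<lambda>y. g y * f (inv x \<otimes> y))" if "x \<in> carrier G" for x
    using in_Lp_mult[OF p in_Lp_translate[OF _ f] g, of "inv x"] that by simp
  have "Re (oscillation G ss u) = oscillation G ss (\<lambda>x. Re (u x))"
    by (rule oscillation_linear[symmetric]) (rule bounded_linear.linear[OF bounded_linear_Re])
  also have "\<dots> = oscillation G ss (\<lambda>x. r (\<lambda>x. Re (f x)) (\<lambda>x. Re (g x)) x - r (\<lambda>x. Im (f x)) (\<lambda>x. Im (g x)) x)"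
  proof (rule oscillation_cong[OF _ ss])
    fix x assume x: "x \<in> carrier G"
    have "Re (u x) = (\<integral>y. Re (g y * f (inv x \<otimes> y)) \<partial>\<mu>)"
      unfolding u_def conv_check_eq[OF x] using integral_Re[OF cint[OF x]] by simp
    then show "Re (u x) = r (\<lambda>x. Re (f x)) (\<lambda>x. Re (g x)) x - r (\<lambda>x. Im (f x)) (\<lambda>x. Im (g x)) x"
      using int[OF _ _ x] by (simp add: r_def)
  qed
  also have "\<bar>\<dots>\<bar> \<le> 4 * C"
    unfolding oscillation_diff using rb[of Re Re] rb[of Im Im] by simp
  finally have 1: "\<bar>Re (oscillation G ss u)\<bar> \<le> 4 * C" .
  have "Im (oscillation G ss u) = oscillation G ss (\<lambda>x. Im (u x))"
    by (rule oscillation_linear[symmetric]) (rule bounded_linear.linear[OF bounded_linear_Im])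
  also have "\<dots> = oscillation G ss (\<lambda>x. r (\<lambda>x. Im (f x)) (\<lambda>x. Re (g x)) x + r (\<lambda>x. Re (f x)) (\<lambda>x. Im (g x)) x)"
  proof (rule oscillation_cong[OF _ ss])
    fix x assume x: "x \<in> carrier G"
    have "Im (u x) = (\<integral>y. Im (g y * f (inv x \<otimes> y)) \<partial>\<mu>)"
      unfolding u_def conv_check_eq[OF x] using integral_Im[OF cint[OF x]] by simp
    then show "Im (u x) = r (\<lambda>x. Im (f x)) (\<lambda>x. Re (g x)) x + r (\<lambda>x. Re (f x)) (\<lambda>x. Im (g x)) x"
      using int[OF _ _ x] by (simp add: r_def)
  qed
  also have "\<bar>\<dots>\<bar> \<le> 4 * C"
    unfolding oscillation_add using rb[of Im Re] rb[of Re Im] by simp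
  finally have 2: "\<bar>Im (oscillation G ss u)\<bar> \<le> 4 * C" .
  show ?thesis using cmod_le[of "oscillation G ss u"] 1 2 unfolding u_def by linarith
qed

lemma Lp_norm_nonneg: "0 \<le> Lp_norm M p f" by (simp add: Lp_norm_def)

lemma in_Lp_cmult: "in_Lp M p f \<Longrightarrow> in_Lp M p (\<lambda>x. c * f x)"
  by (auto simp: in_Lp_def norm_mult powr_mult)

text \<open>Dividing by the norm plus \<open>d\<close> avoids a separate case for functions of norm
  zero; \<open>d\<close> then tends to \<open>0\<close>.\<close>

lemma oscillation_product_bound:
  assumes p: "1 < p" and f: "in_Lp \<mu> p f" and g: "in_Lp \<mu> (conj_exp p) g"
    and B: "C > 0" "bellman_function p C B"
    and ss: "set ss \<subseteq> carrier G"
  shows "norm (oscillation G ss (conv G \<mu> g (check G f))) \<le> 8 * C * (Lp_norm \<mu> p f * Lp_norm \<mu> (conj_exp p) g)"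
proof -
  have scale: "in_Lp \<mu> r (\<lambda>x. complex_of_real (1 / (Lp_norm \<mu> r h + d)) * h x) \<and>
      (\<integral>y. norm (complex_of_real (1 / (Lp_norm \<mu> r h + d)) * h y) powr r \<partial>\<mu>) \<le> 1"
    if "d > 0" "r > 0" "in_Lp \<mu> r h" for d r h
  proof
    show "in_Lp \<mu> r (\<lambda>x. complex_of_real (1 / (Lp_norm \<mu> r h + d)) * h x)" using that by (intro in_Lp_cmult)
    define I where "I = (\<integral>y. norm (h y) powr r \<partial>\<mu>)"
    have I: "I \<ge> 0" by (simp add: I_def)
    have pos: "Lp_norm \<mu> r h + d > 0" using Lp_norm_nonneg[of \<mu> r h] that by simp
    have "I = Lp_norm \<mu> r h powr r"
      unfolding Lp_norm_def I_def[symmetric] using I that by (simp add: powr_powr)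
    also have "\<dots> \<le> (Lp_norm \<mu> r h + d) powr r" using Lp_norm_nonneg that by (intro powr_mono2) auto
    finally have "I / (Lp_norm \<mu> r h + d) powr r \<le> 1" using pos by simp
    moreover have "(\<integral>y. norm (complex_of_real (1 / e) * h y) powr r \<partial>\<mu>) = I / e powr r" if "e > 0" for e
      using that by (simp add: norm_mult norm_divide powr_divide I_def)
    note this[OF pos]
    ultimately show "(\<integral>y. norm (complex_of_real (1 / (Lp_norm \<mu> r h + d)) * h y) powr r \<partial>\<mu>) \<le> 1" by simp
  qed
  have bound: "norm (oscillation G ss (conv G \<mu> g (check G f)))
      \<le> 8 * C * ((Lp_norm \<mu> p f + d) * (Lp_norm \<mu> (conj_exp p) g + d))" if d: "d > 0" for d
  proof -
    define a b where "a = 1 / (Lp_norm \<mu> p f + d)" and "b = 1 / (Lp_norm \<mu> (conj_exp p) g + d)"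
    have ab: "a > 0" "b > 0" using Lp_norm_nonneg[of \<mu> p f] Lp_norm_nonneg[of \<mu> "conj_exp p" g] d by (auto simp: a_def b_def intro!: add_nonneg_pos)
    have "p > 0" "conj_exp p > 0" using p conj_exp_gt1[OF p] by auto
    note sf = scale[OF d \<open>p > 0\<close> f, folded a_def] and sg = scale[OF d \<open>conj_exp p > 0\<close> g, folded b_def]
    have "norm (oscillation G ss (conv G \<mu> (\<lambda>x. complex_of_real b * g x) (check G (\<lambda>x. complex_of_real a * f x)))) \<le> 8 * C"
      by (rule oscillation_normalized[OF p conjunct1[OF sf] conjunct1[OF sg] conjunct2[OF sf] conjunct2[OF sg] B ss])
    moreover have "conv G \<mu> (\<lambda>x. complex_of_real b * g x) (check G (\<lambda>x. complex_of_real a * f x))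
        = (\<lambda>x. complex_of_real (a * b) * conv G \<mu> g (check G f) x)"
    proof
      fix x
      have "conv G \<mu> (\<lambda>x. complex_of_real b * g x) (check G (\<lambda>x. complex_of_real a * f x)) x
          = (\<integral>y. complex_of_real (a * b) * (g y * check G f (inv y \<otimes> x)) \<partial>\<mu>)"
        unfolding conv_def by (rule Bochner_Integration.integral_cong) (simp_all add: check_def)
      then show "conv G \<mu> (\<lambda>x. complex_of_real b * g x) (check G (\<lambda>x. complex_of_real a * f x)) x
          = complex_of_real (a * b) * conv G \<mu> g (check G f) x"
        by (simp only: integral_mult_right_zero conv_def)
    qed
    moreover have "linear (\<lambda>x. complex_of_real (a * b) * x)" by (rule bounded_linear.linear) (rule bounded_linear_mult_right)
    ultimately have "a * b * norm (oscillation G ss (conv G \<mu> g (check G f))) \<le> 8 * C"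
      using ab by (simp add: oscillation_linear norm_mult)
    then have "norm (oscillation G ss (conv G \<mu> g (check G f))) \<le> 8 * C * ((1 / a) * (1 / b))" using ab by (simp add: field_simps)
    then show ?thesis by (simp add: a_def b_def)
  qed
  show ?thesis
  proof (rule tendsto_lowerbound)
    show "((\<lambda>d. 8 * C * ((Lp_norm \<mu> p f + d) * (Lp_norm \<mu> (conj_exp p) g + d))) \<longlongrightarrow>
       8 * C * (Lp_norm \<mu> p f * Lp_norm \<mu> (conj_exp p) g)) (at_right 0)"
      by (auto intro!: tendsto_eq_intros)
    show "\<forall>\<^sub>F d in at_right 0. norm (oscillation G ss (conv G \<mu> g (check G f))) \<le> 8 * C * ((Lp_norm \<mu> p f + d) * (Lp_norm \<mu> (conj_exp p) g + d))"
      by (rule eventually_at_rightI[of 0 1]) (auto intro!: bound)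
  qed simp
qed

lemma herz_rep_nonneg: "summable (\<lambda>i. Lp_norm M p (f i) * Lp_norm M r (g i)) \<Longrightarrow> 0 \<le> (\<Sum>i. Lp_norm M p (f i) * Lp_norm M r (g i))"
  by (intro suminf_nonneg) (auto intro!: mult_nonneg_nonneg Lp_norm_nonneg)

lemma herz_norm_le: "herz_rep G \<mu> p f g u \<Longrightarrow> herz_norm G \<mu> p u \<le> (\<Sum>i. Lp_norm \<mu> p (f i) * Lp_norm \<mu> (conj_exp p) (g i))"
  unfolding herz_norm_def
  by (intro cInf_lower bdd_belowI[of _ 0]) (auto simp: herz_rep_def intro!: herz_rep_nonneg)

lemma herz_norm_greatest:
  assumes "u \<in> herz G \<mu> p"
    and "\<And>f g. herz_rep G \<mu> p f g u \<Longrightarrow> a \<le> (\<Sum>i. Lp_norm \<mu> p (f i) * Lp_norm \<mu> (conj_exp p) (g i))"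
  shows "a \<le> herz_norm G \<mu> p u"
  unfolding herz_norm_def using assms by (intro cInf_greatest) (auto simp: herz_def)

text \<open>Being a finite combination of point evaluations, the functional commutes with the
  pointwise convergent series of any representation. The constant is fixed before the list and
  before \<open>u\<close>.\<close>

theorem oscillation_herz_bound:
  assumes p: "1 < p"
  obtains K where "K > 0" "\<And>ss u. set ss \<subseteq> carrier G \<Longrightarrow> u \<in> herz G \<mu> p \<Longrightarrow> norm (oscillation G ss u) \<le> K * herz_norm G \<mu> p u"
proof -
  obtain C B where B: "C > 0" "bellman_function p C B" using bellman_function_exists[OF p] by blast
  have "norm (oscillation G ss u) \<le> 8 * C * herz_norm G \<mu> p u" if ss: "set ss \<subseteq> carrier G" and u: "u \<in> herz G \<mu> p" for ss u
  proof -
    have "norm (oscillation G ss u) / (8 * C) \<le> (\<Sum>i. Lp_norm \<mu> p (f i) * Lp_norm \<mu> (conj_exp p) (g i))" (is "_ \<le> ?S")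
      if rep: "herz_rep G \<mu> p f g u" for f g
    proof -
      define U where "U n x = (\<Sum>i<n. conv G \<mu> (g i) (check G (f i)) x)" for n x
      have lim: "(\<lambda>n. oscillation G ss (U n)) \<longlonglongrightarrow> oscillation G ss u"
        using rep ss by (intro oscillation_tendsto) (auto simp: U_def herz_rep_def sums_def)
      have "norm (oscillation G ss (U n)) \<le> 8 * C * ?S" for n
      proof -
        have "norm (oscillation G ss (U n)) \<le> (\<Sum>i<n. norm (oscillation G ss (conv G \<mu> (g i) (check G (f i)))))"
          unfolding U_def[abs_def] oscillation_sum by (rule norm_sum)
        also have "\<dots> \<le> (\<Sum>i<n. 8 * C * (Lp_norm \<mu> p (f i) * Lp_norm \<mu> (conj_exp p) (g i)))"
          using rep by (intro sum_mono oscillation_product_bound[OF p _ _ B ss]) (auto simp: herz_rep_def)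
        also have "\<dots> \<le> 8 * C * ?S"
          unfolding sum_distrib_left[symmetric] using B(1) rep
          by (intro mult_left_mono sum_le_suminf) (auto simp: herz_rep_def intro!: mult_nonneg_nonneg Lp_norm_nonneg)
        finally show ?thesis .
      qed
      then have "norm (oscillation G ss u) \<le> 8 * C * ?S"
        by (intro tendsto_upperbound[OF tendsto_norm[OF lim]]) auto
      then show ?thesis using B(1) by (simp add: field_simps)
    qed
    then have "norm (oscillation G ss u) / (8 * C) \<le> herz_norm G \<mu> p u" by (rule herz_norm_greatest[OF u])
    then show ?thesis using B(1) by (simp add: field_simps)
  qed
  then show thesis using that[of "8 * C"] B(1) by simp
qed

end

section \<open>Oscillation against Arens regularity\<close>

text \<open>By Tychonoff's theorem the evaluations \<open>x \<mapsto> x n\<close> have a cluster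
  point in a product of closed discs. Linear identities and norm bounds are closed conditions valid
  for every evaluation, and closeness to an existing limit is one valid for all late evaluations, so
  each passes to the cluster point. Unbounded sequences get the coordinate space
  \<open>{0}\<close>.\<close>

lemma banach_limit_exists:
  obtains \<Lambda> :: "(nat \<Rightarrow> complex) \<Rightarrow> complex" where
    "\<And>x y. Bseq x \<Longrightarrow> Bseq y \<Longrightarrow> \<Lambda> (\<lambda>n. x n + y n) = \<Lambda> x + \<Lambda> y"
    "\<And>c x. Bseq x \<Longrightarrow> \<Lambda> (\<lambda>n. c * x n) = c * \<Lambda> x"
    "\<And>x K. (\<And>n. norm (x n) \<le> K) \<Longrightarrow> norm (\<Lambda> x) \<le> K"
    "\<And>x l. x \<longlonglongrightarrow> l \<Longrightarrow> \<Lambda> x = l"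
proof -
  define K where "K x = (SOME K. \<forall>n. norm (x n) \<le> K)" for x :: "nat \<Rightarrow> complex"
  have K: "norm (x n) \<le> K x" if "Bseq x" for x n
    using someI_ex[of "\<lambda>K. \<forall>n. norm (x n) \<le> K"] BseqD[OF that] unfolding K_def by blast
  define X where "X = product_topology (\<lambda>x. if Bseq x then top_of_set (cball 0 (K x)) else top_of_set {0::complex}) UNIV"
  define e where "e n = (\<lambda>x :: nat \<Rightarrow> complex. if Bseq x then x n else 0)" for n
  have eX: "e n \<in> topspace X" for n using K by (auto simp: X_def e_def)
  have "compact_space X"
    unfolding X_def compact_space_product_topology by (auto simp: compact_space_subtopology)
  then have "(\<Inter>n. X closure_of (e ` {n..})) \<noteq> {}"
  proof (rule compact_space_imp_nest)
    show "X closure_of (e ` {n..}) \<noteq> {}" for n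
      using closure_of_subset[of "e ` {n..}" X] eX by fastforce
    show "decseq (\<lambda>n. X closure_of (e ` {n..}))"
      unfolding decseq_def by (intro allI impI closure_of_mono image_mono) auto
  qed simp
  then obtain \<Lambda> where \<Lambda>: "\<And>n. \<Lambda> \<in> X closure_of (e ` {n..})" by auto
  have transfer: "f \<Lambda> \<in> S" if "closed S" "continuous_map X euclidean f" "\<And>n. n \<ge> M \<Longrightarrow> f (e n) \<in> S"
    for f :: "_ \<Rightarrow> complex" and S M
  proof -
    have "closedin X {x \<in> topspace X. f x \<in> S}"
      using that by (intro closedin_continuous_map_preimage) auto
    then have "X closure_of (e ` {M..}) \<subseteq> {x \<in> topspace X. f x \<in> S}"
      by (intro closure_of_minimal) (use that eX in auto)
    then show ?thesis using \<Lambda>[of M] by auto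
  qed
  have proj: "continuous_map X euclidean (\<lambda>f. f x)" for x
  proof -
    have "continuous_map X (if Bseq x then top_of_set (cball 0 (K x)) else top_of_set {0::complex}) (\<lambda>f. f x)"
      unfolding X_def by (rule continuous_map_product_projection) simp
    then show ?thesis by (auto split: if_splits intro: continuous_map_into_fulltopology)
  qed
  show thesis
  proof
    fix x y :: "nat \<Rightarrow> complex" assume xy: "Bseq x" "Bseq y"
    have b: "Bseq (\<lambda>n. x n + y n)"
      by (rule BseqI'[of _ "K x + K y"]) (intro norm_triangle_mono K xy)
    have "\<Lambda> (\<lambda>n. x n + y n) - (\<Lambda> x + \<Lambda> y) \<in> {0}"
      using xy b by (intro transfer[of "{0}" "\<lambda>f. f (\<lambda>n. x n + y n) - (f x + f y)" 0] continuous_map_diff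
          continuous_map_add proj) (auto simp: e_def)
    then show "\<Lambda> (\<lambda>n. x n + y n) = \<Lambda> x + \<Lambda> y" by simp
  next
    fix c and x :: "nat \<Rightarrow> complex" assume x: "Bseq x"
    then have b: "Bseq (\<lambda>n. c * x n)" by (intro Bseq_mult) auto
    have "continuous_map X euclidean (\<lambda>f. c * f x)"
      using proj[of x] by (auto simp: continuous_map_atin intro: tendsto_mult_left)
    then have "\<Lambda> (\<lambda>n. c * x n) - c * \<Lambda> x \<in> {0}"
      using x b by (intro transfer[of "{0}" "\<lambda>f. f (\<lambda>n. c * x n) - c * f x" 0] continuous_map_diff proj) (auto simp: e_def)
    then show "\<Lambda> (\<lambda>n. c * x n) = c * \<Lambda> x" by simp
  next
    fix x :: "nat \<Rightarrow> complex" and K assume x: "\<And>n. norm (x n) \<le> K"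
    then have "K \<ge> 0" using norm_ge_zero order_trans by blast
    then have "\<Lambda> x \<in> cball 0 K" using x by (intro transfer[of _ "\<lambda>f. f x" 0] proj) (auto simp: e_def)
    then show "norm (\<Lambda> x) \<le> K" by simp
  next
    fix x :: "nat \<Rightarrow> complex" and l assume x: "x \<longlonglongrightarrow> l"
    then have b: "Bseq x" by (auto intro: convergent_imp_Bseq convergentI)
    have "dist l (\<Lambda> x) \<le> d" if d: "d > 0" for d
    proof -
      obtain M where "\<forall>n\<ge>M. dist (x n) l < d" using metric_LIMSEQ_D[OF x d] by blast
      then have "\<Lambda> x \<in> cball l d" using b by (intro transfer[of _ "\<lambda>f. f x" M] proj) (auto simp: e_def dist_commute less_imp_le)
      then show ?thesis by simp
    qed
    then have "dist l (\<Lambda> x) \<le> 0" by (rule field_le_epsilon[of _ 0, simplified])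
    then show "\<Lambda> x = l" by simp
  qed
qed

text \<open>With even terms as \<open>a\<close> and odd terms as \<open>b\<close>, the double
  sequence \<open>T (a n * b m)\<close> is \<open>c * T (a n)\<close> on one side of the diagonal
  and \<open>c * T (b m)\<close> on the other. Its iterated limits are therefore
  \<open>c * l\<close> and \<open>c * l'\<close>; the two alternatives in the hypothesis on products
  differ only in which order gives which.\<close>

lemma not_arens_regularI:
  fixes v :: "nat \<Rightarrow> 'a \<Rightarrow> complex"
  assumes v: "\<And>n. v n \<in> A" "\<And>n. N (v n) \<le> 1" and T: "bounded_functional A N T" and c: "c \<noteq> 0"
    and prod: "(\<forall>n m. n < m \<longrightarrow> (\<forall>x. v n x * v m x = c * v n x)) \<or> (\<forall>n m. n < m \<longrightarrow> (\<forall>x. v n x * v m x = c * v m x))"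
    and l: "(\<lambda>n. T (v (2 * n))) \<longlonglongrightarrow> l" and l': "(\<lambda>n. T (v (2 * n + 1))) \<longlonglongrightarrow> l'" and "l \<noteq> l'"
  shows "\<not> arens_regular A N"
proof
  assume reg: "arens_regular A N"
  \<comment> \<open>The index of \<open>a n\<close> is below that of \<open>b m\<close> exactly when
    \<open>n \<le> m\<close>, so the two indices never coincide.\<close>
  define a b where "a n = v (2 * n)" and "b n = v (2 * n + 1)" for n
  have Tc: "T (\<lambda>x. c * v n x) = c * T (v n)" for n using T v by (auto simp: bounded_functional_def)
  have concl: "l1 = l2" if "\<And>n. (\<lambda>m. T (\<lambda>x. a n x * b m x)) \<longlonglongrightarrow> L1 n" "L1 \<longlonglongrightarrow> l1"
     "\<And>m. (\<lambda>n. T (\<lambda>x. a n x * b m x)) \<longlonglongrightarrow> L2 m" "L2 \<longlonglongrightarrow> l2" for L1 L2 l1 l2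
    using reg[unfolded arens_regular_def, rule_format, of a b T L1 l1 L2 l2] that v T by (auto simp: a_def b_def)
  have la: "(\<lambda>n. T (a n)) \<longlonglongrightarrow> l" and lb: "(\<lambda>n. T (b n)) \<longlonglongrightarrow> l'"
    using l l' by (simp_all add: a_def b_def)
  have "c * l = c * l'"
    using prod
  proof
    assume p: "\<forall>n m. n < m \<longrightarrow> (\<forall>x. v n x * v m x = c * v n x)"
    have 1: "T (\<lambda>x. a n x * b m x) = c * T (a n)" if "n \<le> m" for n m
    proof -
      have "(\<lambda>x. a n x * b m x) = (\<lambda>x. c * a n x)"
        using p[rule_format, of "2 * n" "2 * m + 1"] that by (auto simp: a_def b_def)
      then show ?thesis by (simp add: a_def Tc)
    qed
    have 2: "T (\<lambda>x. a n x * b m x) = c * T (b m)" if "m < n" for n m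
    proof -
      have "(\<lambda>x. a n x * b m x) = (\<lambda>x. c * b m x)"
        using p[rule_format, of "2 * m + 1" "2 * n"] that by (auto simp: a_def b_def mult.commute)
      then show ?thesis by (simp add: b_def Tc del: add_Suc_right)
    qed
    show ?thesis
    proof (rule concl)
      show "(\<lambda>m. T (\<lambda>x. a n x * b m x)) \<longlonglongrightarrow> c * T (a n)" for n
        by (rule tendsto_eventually) (auto simp: eventually_sequentially intro!: exI[of _ n] 1)
      show "(\<lambda>n. T (\<lambda>x. a n x * b m x)) \<longlonglongrightarrow> c * T (b m)" for m
        by (rule tendsto_eventually) (auto simp: eventually_sequentially intro!: exI[of _ "Suc m"] 2)
    qed (use la lb in \<open>auto intro!: tendsto_mult_left\<close>)
  next
    assume p: "\<forall>n m. n < m \<longrightarrow> (\<forall>x. v n x * v m x = c * v m x)"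
    have 1: "T (\<lambda>x. a n x * b m x) = c * T (b m)" if "n \<le> m" for n m
    proof -
      have "(\<lambda>x. a n x * b m x) = (\<lambda>x. c * b m x)"
        using p[rule_format, of "2 * n" "2 * m + 1"] that by (auto simp: a_def b_def)
      then show ?thesis by (simp add: b_def Tc del: add_Suc_right)
    qed
    have 2: "T (\<lambda>x. a n x * b m x) = c * T (a n)" if "m < n" for n m
    proof -
      have "(\<lambda>x. a n x * b m x) = (\<lambda>x. c * a n x)"
        using p[rule_format, of "2 * m + 1" "2 * n"] that by (auto simp: a_def b_def mult.commute)
      then show ?thesis by (simp add: a_def Tc)
    qed
    show ?thesis
    proof (rule concl[symmetric])
      show "(\<lambda>m. T (\<lambda>x. a n x * b m x)) \<longlonglongrightarrow> c * l'" for n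
        by (rule Lim_transform_eventually[OF tendsto_mult_left[OF lb, of c]])
          (auto simp: eventually_sequentially 1 intro!: exI[of _ n])
      show "(\<lambda>n. T (\<lambda>x. a n x * b m x)) \<longlonglongrightarrow> c * l" for m
        by (rule Lim_transform_eventually[OF tendsto_mult_left[OF la, of c]])
          (auto simp: eventually_sequentially 2 intro!: exI[of _ "Suc m"])
    qed auto
  qed
  then show False using c \<open>l \<noteq> l'\<close> by simp
qed

context invariant_measure
begin

section \<open>Explicit elements of the Herz algebra and a criterion for irregularity\<close>

lemma herz_rep_single:
  assumes f: "in_Lp \<mu> p f" and g: "in_Lp \<mu> (conj_exp p) g" 
    and u: "\<And>x. x \<in> carrier G \<Longrightarrow> u x = conv G \<mu> g (check G f) x" "\<And>x. x \<notin> carrier G \<Longrightarrow> u x = 0"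
  shows "u \<in> herz G \<mu> p" and "herz_norm G \<mu> p u \<le> Lp_norm \<mu> p f * Lp_norm \<mu> (conj_exp p) g"
proof -
  define F K where "F i = (if i = 0 then f else (\<lambda>x. 0))" and "K i = (if i = 0 then g else (\<lambda>x. 0))" for i :: nat
  have "(\<lambda>i. Lp_norm \<mu> p (F i) * Lp_norm \<mu> (conj_exp p) (K i)) = (\<lambda>i. if i = 0 then Lp_norm \<mu> p f * Lp_norm \<mu> (conj_exp p) g else 0)"
    by (auto simp: F_def K_def Lp_norm_def)
  then have s: "(\<lambda>i. Lp_norm \<mu> p (F i) * Lp_norm \<mu> (conj_exp p) (K i)) sums (Lp_norm \<mu> p f * Lp_norm \<mu> (conj_exp p) g)"
    using sums_single[of 0 "\<lambda>_. Lp_norm \<mu> p f * Lp_norm \<mu> (conj_exp p) g"] by simp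
  have rep: "herz_rep G \<mu> p F K u"
    unfolding herz_rep_def
  proof (intro conjI allI ballI impI)
    fix i show "in_Lp \<mu> p (F i)" "in_Lp \<mu> (conj_exp p) (K i)"
      using f g by (auto simp: F_def K_def in_Lp_def)
  next
    fix x assume x: "x \<in> carrier G"
    have "(\<lambda>i. conv G \<mu> (K i) (check G (F i)) x) = (\<lambda>i. if i = 0 then u x else 0)"
      using u(1)[OF x] by (auto simp: F_def K_def conv_def)
    then show "(\<lambda>i. conv G \<mu> (K i) (check G (F i)) x) sums u x"
      using sums_single[of 0 "\<lambda>_. u x"] by simp
  qed (use s u in \<open>auto simp: sums_iff\<close>)
  then show "u \<in> herz G \<mu> p" by (auto simp: herz_def)
  show "herz_norm G \<mu> p u \<le> Lp_norm \<mu> p f * Lp_norm \<mu> (conj_exp p) g"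
    using herz_norm_le[OF rep] s by (simp add: sums_iff)
qed

text \<open>The function is \<open>x \<mapsto> measure (xK \<inter> E) / (2 * measure K)\<close>,
  the product of \<open>indicator K\<close> and \<open>indicator E\<close> up to scale. With
  \<open>k = measure \<mu> K\<close>, its norm is at most \<open>k powr (1/p) * (2 * k) powr (1/q) /
  (2 * k) = 2 powr (1/q) / 2\<close>. The height \<open>1/2\<close> pays for letting
  \<open>E\<close> have up to twice the measure of \<open>K\<close>.\<close>

lemma herz_bump:
  assumes p: "1 < p" and K: "K \<in> sets \<mu>" "emeasure \<mu> K \<noteq> \<infinity>" "measure \<mu> K > 0"
    and E: "E \<in> sets \<mu>" "emeasure \<mu> E \<noteq> \<infinity>" "measure \<mu> E \<le> 2 * measure \<mu> K"
  obtains u where "u \<in> herz G \<mu> p" "herz_norm G \<mu> p u \<le> 1"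
    "\<And>x. x \<in> carrier G \<Longrightarrow> (\<And>k. k \<in> K \<Longrightarrow> x \<otimes> k \<in> E) \<Longrightarrow> u x = 1 / 2"
    "\<And>x. x \<in> carrier G \<Longrightarrow> (\<And>k. k \<in> K \<Longrightarrow> x \<otimes> k \<notin> E) \<Longrightarrow> u x = 0"
    "\<And>x. x \<notin> carrier G \<Longrightarrow> u x = 0"
proof -
  define q where "q = conj_exp p"
  define k where "k = measure \<mu> K"
  have q: "q > 0" "1 / p + 1 / q = 1" "p > 0" using conj_exp_gt1[OF p] conj_exp_inverse_sum[OF p] p by (auto simp: q_def)
  have k: "k > 0" using K by (simp add: k_def)
  define f :: "'a \<Rightarrow> complex" where "f = indicator K"
  define g :: "'a \<Rightarrow> complex" where "g y = complex_of_real (1 / (2 * k)) * indicator E y" for y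
  define u where "u x = (if x \<in> carrier G then conv G \<mu> g (check G f) x else 0)" for x
  have ind: "norm (indicator S x :: complex) powr r = indicator S x" for S :: "'a set" and x r by (simp add: indicator_def)
  have ii: "integrable \<mu> (indicator S :: 'a \<Rightarrow> real)" "(\<integral>y. indicator S y \<partial>\<mu>) = measure \<mu> S"
    if "S \<in> sets \<mu>" "emeasure \<mu> S \<noteq> \<infinity>" for S
    using that sets.sets_into_space[OF that(1)] by (auto simp: top.not_eq_extremum Int_absorb2 intro!: integrable_real_indicator)
  have f: "in_Lp \<mu> p f" using K ii[of K] by (auto simp: in_Lp_def f_def ind)
  have nf: "Lp_norm \<mu> p f = k powr (1 / p)" using K ii[of K] by (simp add: Lp_norm_def f_def ind k_def)
  have gE: "in_Lp \<mu> q (indicator E)" using E ii[of E] by (auto simp: in_Lp_def ind)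
  have g: "in_Lp \<mu> q g" unfolding g_def[abs_def] by (rule in_Lp_cmult[OF gE])
  have ng: "Lp_norm \<mu> q g = 1 / (2 * k) * measure \<mu> E powr (1 / q)"
  proof -
    have "norm (g y) powr q = (1 / (2 * k)) powr q * indicator E y" for y
      using k by (cases "y \<in> E") (simp_all add: g_def norm_divide)
    then have "(\<integral>y. norm (g y) powr q \<partial>\<mu>) = (1 / (2 * k)) powr q * measure \<mu> E" using ii[of E] E by simp
    then show ?thesis using k q by (simp add: Lp_norm_def powr_mult powr_powr)
  qed
  have "Lp_norm \<mu> p f * Lp_norm \<mu> q g \<le> k powr (1 / p) * (1 / (2 * k) * (2 * k) powr (1 / q))"
    unfolding nf ng using E k q by (intro mult_left_mono powr_mono2) (auto simp: k_def)
  also have "\<dots> = (k powr (1 / p) * k powr (1 / q)) / k * (2 powr (1 / q) / 2)" using k by (simp add: powr_mult mult_ac)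
  also have "\<dots> = 2 powr (1 / q) / 2" using k q by (simp add: powr_add[symmetric])
  also have "\<dots> \<le> 1"
    using powr_mono[of "1 / q" 1 "2::real"] conj_exp_gt1[OF p] by (simp add: q_def)
  finally have "Lp_norm \<mu> p f * Lp_norm \<mu> q g \<le> 1" .
  with herz_rep_single[OF f g[unfolded q_def], of u] have u: "u \<in> herz G \<mu> p" "herz_norm G \<mu> p u \<le> 1"
    by (auto simp: u_def q_def)
  have cancel: "y = x \<otimes> (inv x \<otimes> y)" if "x \<in> carrier G" "y \<in> carrier G" for x y
    using that by (simp flip: m_assoc)
  show thesis
  proof (rule that[OF u])
    fix x assume x: "x \<in> carrier G" and xK: "\<And>k. k \<in> K \<Longrightarrow> x \<otimes> k \<in> E"
    have "u x = (\<integral>y. g y * f (inv x \<otimes> y) \<partial>\<mu>)" using x by (simp add: u_def conv_check_eq)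
    also have "\<dots> = (\<integral>y. complex_of_real (1 / (2 * k)) * complex_of_real (indicator K (inv x \<otimes> y)) \<partial>\<mu>)"
    proof (rule Bochner_Integration.integral_cong[OF refl])
      fix y assume "y \<in> space \<mu>"
      then have "indicator E y = (1 :: complex)" if "inv x \<otimes> y \<in> K"
        using xK[OF that] cancel[OF x, of y] space_eq by simp
      then show "g y * f (inv x \<otimes> y) = complex_of_real (1 / (2 * k)) * complex_of_real (indicator K (inv x \<otimes> y))"
        by (cases "inv x \<otimes> y \<in> K") (auto simp: g_def f_def)
    qed
    also have "\<dots> = complex_of_real (1 / (2 * k)) * complex_of_real (\<integral>y. indicator K (inv x \<otimes> y) \<partial>\<mu>)"
      by (simp del: of_real_divide)
    also have "(\<integral>y. indicator K (inv x \<otimes> y) \<partial>\<mu>) = k"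
      using integral_translate[of "inv x" "indicator K :: 'a \<Rightarrow> real"] x K ii[of K] by (simp add: k_def)
    finally show "u x = 1 / 2" using k by simp
  next
    fix x assume x: "x \<in> carrier G" and xK: "\<And>k. k \<in> K \<Longrightarrow> x \<otimes> k \<notin> E"
    have "u x = (\<integral>y. g y * f (inv x \<otimes> y) \<partial>\<mu>)" using x by (simp add: u_def conv_check_eq)
    also have "\<dots> = (\<integral>y. 0 \<partial>\<mu>)"
    proof (rule Bochner_Integration.integral_cong[OF refl])
      fix y assume "y \<in> space \<mu>"
      then have "indicator E y = (0 :: complex)" if "inv x \<otimes> y \<in> K"
        using xK[OF that] cancel[OF x, of y] space_eq by simp
      then show "g y * f (inv x \<otimes> y) = 0"
        by (cases "inv x \<otimes> y \<in> K") (auto simp: g_def f_def)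
    qed
    finally show "u x = 0" by simp
  qed (simp add: u_def)
qed

text \<open>The bound uniform in the list makes the oscillations of each \<open>u\<close> a bounded
  sequence, so their generalised limit is one bounded functional. On the test functions genuine
  limits exist and determine its values.\<close>

lemma oscillation_criterion:
  fixes v :: "nat \<Rightarrow> 'a \<Rightarrow> complex" and ss :: "nat \<Rightarrow> 'a list"
  assumes p: "1 < p" and ss: "\<And>N. set (ss N) \<subseteq> carrier G"
    and v: "\<And>n. v n \<in> herz G \<mu> p" "\<And>n. herz_norm G \<mu> p (v n) \<le> 1" and c: "c \<noteq> 0"
    and prod: "(\<forall>n m. n < m \<longrightarrow> (\<forall>x. v n x * v m x = c * v n x)) \<or> (\<forall>n m. n < m \<longrightarrow> (\<forall>x. v n x * v m x = c * v m x))"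
    and t: "\<And>n. (\<lambda>N. oscillation G (ss N) (v n)) \<longlonglongrightarrow> t n"
    and l: "(\<lambda>n. t (2 * n)) \<longlonglongrightarrow> l" and l': "(\<lambda>n. t (2 * n + 1)) \<longlonglongrightarrow> l'" and "l \<noteq> l'"
  shows "\<not> herz_arens_regular G \<mu> p"
proof -
  obtain K where K: "K > 0" "\<And>ss u. set ss \<subseteq> carrier G \<Longrightarrow> u \<in> herz G \<mu> p \<Longrightarrow> norm (oscillation G ss u) \<le> K * herz_norm G \<mu> p u"
    using oscillation_herz_bound[OF p] by blast
  obtain \<Lambda> :: "(nat \<Rightarrow> complex) \<Rightarrow> complex" where \<Lambda>:
    "\<And>x y. Bseq x \<Longrightarrow> Bseq y \<Longrightarrow> \<Lambda> (\<lambda>n. x n + y n) = \<Lambda> x + \<Lambda> y"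
    "\<And>c x. Bseq x \<Longrightarrow> \<Lambda> (\<lambda>n. c * x n) = c * \<Lambda> x"
    "\<And>x K. (\<And>n. norm (x n) \<le> K) \<Longrightarrow> norm (\<Lambda> x) \<le> K"
    "\<And>x l. x \<longlonglongrightarrow> l \<Longrightarrow> \<Lambda> x = l"
    by (rule banach_limit_exists) blast
  define T where "T u = \<Lambda> (\<lambda>N. oscillation G (ss N) u)" for u
  have Bs: "Bseq (\<lambda>N. oscillation G (ss N) u)" if "u \<in> herz G \<mu> p" for u
    using K(2)[OF ss that] by (rule BseqI')
  have T: "bounded_functional (herz G \<mu> p) (herz_norm G \<mu> p) T"
    unfolding bounded_functional_def
  proof (intro conjI ballI allI)
    fix u w assume "u \<in> herz G \<mu> p" "w \<in> herz G \<mu> p"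
    then show "T (\<lambda>x. u x + w x) = T u + T w" unfolding T_def oscillation_add by (intro \<Lambda> Bs)
  next
    fix c u assume u: "u \<in> herz G \<mu> p"
    have "oscillation G (ss N) (\<lambda>x. c * u x) = c * oscillation G (ss N) u" for N
      by (rule oscillation_linear) (rule bounded_linear.linear[OF bounded_linear_mult_right])
    then show "T (\<lambda>x. c * u x) = c * T u" unfolding T_def using \<Lambda>(2)[OF Bs[OF u]] by simp
  next
    show "\<exists>C. \<forall>u\<in>herz G \<mu> p. norm (T u) \<le> C * herz_norm G \<mu> p u"
      unfolding T_def using K(2)[OF ss] by (intro exI[of _ K] ballI \<Lambda>(3)) 
  qed
  have "T (v n) = t n" for n unfolding T_def by (rule \<Lambda>(4)[OF t])
  then show ?thesis
    unfolding herz_arens_regular_def using l l'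
    by (intro not_arens_regularI[where v = v and N = "herz_norm G \<mu> p", OF v T c prod _ _ \<open>l \<noteq> l'\<close>]) simp_all
qed

section \<open>Evaluation points of the coefficients, and the two irregular configurations\<close>

primrec words :: "'a list \<Rightarrow> 'a set" where
  "words [] = {\<one>}"
| "words (s # ss) = words ss \<union> (\<lambda>a. s \<otimes> a) ` words ss"

lemma words_closed: "set ss \<subseteq> carrier G \<Longrightarrow> words ss \<subseteq> carrier G"
  by (induction ss) auto

text \<open>\<open>walk_coeff\<close> is a weighted mean, with weights of sum one, of values of
  \<open>u\<close> at points \<open>inv b \<otimes> (x \<otimes> a)\<close> where \<open>a\<close>
  and \<open>b\<close> are products of sublists of \<open>ss\<close>.\<close>

lemma walk_coeff_eq_const:
  "set ss \<subseteq> carrier G \<Longrightarrow> x \<in> carrier G \<Longrightarrow>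
    (\<And>a b. a \<in> words ss \<Longrightarrow> b \<in> words ss \<Longrightarrow> u (inv b \<otimes> (x \<otimes> a)) = \<kappa>) \<Longrightarrow> walk_coeff G ss u x = \<kappa>"
proof (induction ss arbitrary: x)
  case Nil
  then show ?case using Nil.prems(3)[of \<one> \<one>] by simp
next
  case (Cons s ss)
  have s: "s \<in> carrier G" and ss: "set ss \<subseteq> carrier G" and x: "x \<in> carrier G" using Cons.prems by auto
  have wc: "a \<in> carrier G" if "a \<in> words ss" for a using words_closed[OF ss] that by auto
  have u: "u (inv b \<otimes> (x \<otimes> a)) = \<kappa>" if "a \<in> words (s # ss)" "b \<in> words (s # ss)" for a b
    using Cons.prems(3) that .
  have 1: "walk_coeff G ss u x = \<kappa>"
    by (rule Cons.IH[OF ss x]) (rule u; simp)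
  have 2: "walk_coeff G ss u (x \<otimes> s) = \<kappa>"
  proof (rule Cons.IH[OF ss])
    fix a b assume ab: "a \<in> words ss" "b \<in> words ss"
    show "u (inv b \<otimes> (x \<otimes> s \<otimes> a)) = \<kappa>" using u[of "s \<otimes> a" b] ab wc s x by (simp add: m_assoc)
  qed (use x s in auto)
  have 3: "walk_coeff G ss u (inv s \<otimes> x) = \<kappa>"
  proof (rule Cons.IH[OF ss])
    fix a b assume ab: "a \<in> words ss" "b \<in> words ss"
    show "u (inv b \<otimes> (inv s \<otimes> x \<otimes> a)) = \<kappa>" using u[of a "s \<otimes> b"] ab wc s x by (simp add: m_assoc inv_mult_group)
  qed (use x s in auto)
  have 4: "walk_coeff G ss u (inv s \<otimes> (x \<otimes> s)) = \<kappa>"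
  proof (rule Cons.IH[OF ss])
    fix a b assume ab: "a \<in> words ss" "b \<in> words ss"
    show "u (inv b \<otimes> (inv s \<otimes> (x \<otimes> s) \<otimes> a)) = \<kappa>"
      using u[of "s \<otimes> a" "s \<otimes> b"] ab wc s x by (simp add: m_assoc inv_mult_group)
  qed (use x s in auto)
  have "\<kappa> + \<kappa> + \<kappa> + \<kappa> = (1 + 1 + 1 + 1) *\<^sub>R \<kappa>" by (simp only: scaleR_add_left scaleR_one)
  then show ?case by (simp add: 1 2 3 4)
qed

text \<open>At the identity two of the four points of the recursion coincide, since
  \<open>inv s \<otimes> (\<one> \<otimes> s) = \<one>\<close>: half of the weight stays and half
  moves to \<open>s\<close> and \<open>inv s\<close>. This is the halving that drives both
  configurations below.\<close>

lemma walk_coeff_one_step: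
  assumes "set (s # ss) \<subseteq> carrier G" "walk_coeff G ss u s = \<kappa>" "walk_coeff G ss u (inv s) = \<kappa>"
  shows "walk_coeff G (s # ss) u \<one> = (1 / 2) *\<^sub>R (walk_coeff G ss u \<one> + \<kappa>)"
proof -
  have "a + \<kappa> + \<kappa> + a = (1 + 1) *\<^sub>R (a + \<kappa>)" for a
    by (simp only: scaleR_add_left scaleR_one) (simp add: ac_simps)
  then show ?thesis using assms by simp
qed

text \<open>The test function \<open>v n\<close> is half the indicator of \<open>K n\<close>. Steps
  \<open>s N\<close> with \<open>N < n\<close> remain in \<open>K n\<close> and keep the coefficient
  \<open>1/2\<close>; each step with \<open>N \<ge> n\<close> leaves \<open>K N\<close>, hence
  \<open>K n\<close>, and halves it. The differences start at step \<open>n\<close> with sign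
  \<open>(-1)^n\<close>, and one fourth of the geometric series in \<open>- 1/2\<close> gives the
  limit \<open>(-1)^n / 6\<close>.\<close>

lemma increasing_subgroups_not_regular:
  fixes K :: "nat \<Rightarrow> 'a set"
  assumes p: "1 < p" and K: "\<And>n. subgroup (K n) G" "\<And>n. K n \<subseteq> K (Suc n)"
    and s: "\<And>n. s n \<in> K (Suc n)" "\<And>n. s n \<notin> K n"
    and \<mu>: "\<And>n. K n \<in> sets \<mu>" "\<And>n. emeasure \<mu> (K n) \<noteq> \<infinity>" "\<And>n. measure \<mu> (K n) > 0"
  shows "\<not> herz_arens_regular G \<mu> p"
proof -
  have Kc: "x \<in> carrier G" if "x \<in> K n" for x n using subgroup.mem_carrier[OF K(1) that] .
  have sc: "s n \<in> carrier G" for n using Kc s(1) .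
  have Kmono: "K n \<subseteq> K m" if "n \<le> m" for n m using lift_Suc_mono_le[of K, OF K(2) that] .
  have "\<exists>u \<in> herz G \<mu> p. herz_norm G \<mu> p u \<le> 1 \<and> (\<forall>x. u x = (if x \<in> K n then 1 / 2 else 0))" for n
  proof -
    obtain u where u: "u \<in> herz G \<mu> p" "herz_norm G \<mu> p u \<le> 1"
      "\<And>x. x \<in> carrier G \<Longrightarrow> (\<And>k. k \<in> K n \<Longrightarrow> x \<otimes> k \<in> K n) \<Longrightarrow> u x = 1 / 2"
      "\<And>x. x \<in> carrier G \<Longrightarrow> (\<And>k. k \<in> K n \<Longrightarrow> x \<otimes> k \<notin> K n) \<Longrightarrow> u x = 0"
      "\<And>x. x \<notin> carrier G \<Longrightarrow> u x = 0"
      using herz_bump[OF p \<mu> \<mu>(1,2), of n n] \<mu>(3)[of n] by auto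
    have "u x = (if x \<in> K n then 1 / 2 else 0)" for x
    proof (cases "x \<in> K n")
      case True
      then show ?thesis using u(3)[of x] Kc[OF True] subgroup.m_closed[OF K(1) True] by simp
    next
      case False
      have "x \<otimes> k \<notin> K n" if "x \<in> carrier G" "k \<in> K n" for k
      proof
        assume "x \<otimes> k \<in> K n"
        then have "x \<otimes> k \<otimes> inv k \<in> K n" using that K(1) by (simp add: subgroup.m_closed subgroup.m_inv_closed)
        then show False using False that Kc[of k] by (simp add: m_assoc)
      qed
      then show ?thesis using u(4,5)[of x] False by (cases "x \<in> carrier G") auto
    qed
    then show ?thesis using u by blast
  qed
  then obtain v where v: "\<And>n. v n \<in> herz G \<mu> p" "\<And>n. herz_norm G \<mu> p (v n) \<le> 1"
      "\<And>n x. v n x = (if x \<in> K n then 1 / 2 else 0)"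
    by metis
  \<comment> \<open>Reversed so that \<open>s 0\<close> is averaged first and lists grow at the
    head: the oscillations along \<open>ss N\<close> are partial sums of one series.\<close>
  define ss where "ss N = map s (rev [0..<N])" for N
  have ssc: "set (ss N) \<subseteq> carrier G" for N using sc by (auto simp: ss_def)
  have ss_Suc: "ss (Suc N) = s N # ss N" and ss_len: "length (ss N) = N" for N by (simp_all add: ss_def)
  have W: "words (ss N) \<subseteq> K N" for N
  proof (induction N)
    case 0 then show ?case using subgroup.one_closed[OF K(1)] by (simp add: ss_def)
  next
    case (Suc N)
    then show ?case using K(2)[of N] s(1)[of N] subgroup.m_closed[OF K(1)] by (auto simp: ss_Suc)
  qed
  have small: "walk_coeff G (ss N) (v n) \<one> = 1 / 2" if "N \<le> n" for N n
  proof (rule walk_coeff_eq_const[OF ssc])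
    fix a b assume "a \<in> words (ss N)" "b \<in> words (ss N)"
    then have "a \<in> K n" "b \<in> K n" using W Kmono[OF that] by auto
    then show "v n (inv b \<otimes> (\<one> \<otimes> a)) = 1 / 2"
      using v(3) Kc[of a] by (simp add: K(1) subgroup.m_closed subgroup.m_inv_closed)
  qed simp
  \<comment> \<open>Multiplying \<open>s N\<close> or its inverse on either side by elements of
    \<open>K N\<close> cannot bring it into \<open>K N\<close>.\<close>
  have large: "walk_coeff G (ss N) (v n) x = 0" if "n \<le> N" "x \<in> {s N, inv (s N)}" for N n x
  proof (rule walk_coeff_eq_const[OF ssc])
    show x: "x \<in> carrier G" using that sc by auto
    have xK: "x \<notin> K N"
    proof
      assume "x \<in> K N"
      moreover from this have "inv x \<in> K N" using K(1) by (simp add: subgroup.m_inv_closed)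
      ultimately show False using that s(2)[of N] sc[of N] by auto
    qed
    fix a b assume ab: "a \<in> words (ss N)" "b \<in> words (ss N)"
    then have ab: "a \<in> K N" "b \<in> K N" using W by auto
    have "inv b \<otimes> (x \<otimes> a) \<notin> K N"
    proof
      assume "inv b \<otimes> (x \<otimes> a) \<in> K N"
      then have "b \<otimes> (inv b \<otimes> (x \<otimes> a)) \<otimes> inv a \<in> K N"
        using ab K(1) by (simp add: subgroup.m_closed subgroup.m_inv_closed)
      moreover have "b \<otimes> (inv b \<otimes> (x \<otimes> a)) \<otimes> inv a = x"
        using ab Kc x by (metis inv_closed inv_solve_left inv_solve_right m_assoc m_closed)
      ultimately show False using xK by simp
    qed
    then show "v n (inv b \<otimes> (x \<otimes> a)) = 0" using v(3) Kmono[OF that(1)] by auto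
  qed
  have half: "walk_coeff G (ss (Suc N)) (v n) \<one> = walk_coeff G (ss N) (v n) \<one> / 2" if "n \<le> N" for N n
    unfolding ss_Suc using walk_coeff_one_step[of "s N" "ss N" "v n" 0] large[OF that] ssc[of N] sc
    by (simp add: scaleR_conv_of_real del: walk_coeff.simps)
  have d: "walk_coeff G (ss (n + k)) (v n) \<one> = (1 / 2) ^ Suc k" for n k
    by (induction k) (simp_all add: small half field_simps)
  have oscillation_Suc: "oscillation G (ss (Suc N)) u = (- 1) ^ N * (walk_coeff G (ss N) u \<one> - walk_coeff G (ss (Suc N)) u \<one>) + oscillation G (ss N) u"
    for N and u :: "'a \<Rightarrow> complex"
    by (simp add: ss_Suc ss_len scaleR_conv_of_real del: walk_coeff.simps)
  have o0: "oscillation G (ss N) (v n) = 0" if "N \<le> n" for N n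
    using that
  proof (induction N)
    case 0 then show ?case by (simp add: ss_def)
  next
    case (Suc N) then show ?case by (simp add: oscillation_Suc small)
  qed
  have o: "oscillation G (ss (n + k)) (v n) = (- 1) ^ n * (1 - (- 1 / 2) ^ k) / 6" for n k
  proof (induction k)
    case 0 then show ?case by (simp add: o0)
  next
    case (Suc k)
    have "oscillation G (ss (n + Suc k)) (v n) = (- 1) ^ (n + k) * ((1 / 2) ^ Suc k - (1 / 2) ^ Suc (Suc k)) + (- 1) ^ n * (1 - (- 1 / 2) ^ k) / 6"
      using oscillation_Suc[of "n + k" "v n"] Suc d[of n k] d[of n "Suc k"] by simp
    also have "(- 1) ^ (n + k) * ((1 / 2) ^ Suc k - (1 / 2) ^ Suc (Suc k)) = (- 1) ^ n * ((- 1 / 2) ^ k / (4 :: complex))"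
      unfolding power_divide[of "- 1 :: complex" 2 k] by (simp add: power_add power_divide)
    finally show ?case by (simp add: field_simps)
  qed
  show ?thesis
  proof (rule oscillation_criterion[OF p ssc v(1,2)])
    show "(1 / 2 :: complex) \<noteq> 0" by simp
    have "v n x * v m x = 1 / 2 * v n x" if "n < m" for n m x
      using Kmono[of n m] v(3) that by auto
    then show "(\<forall>n m. n < m \<longrightarrow> (\<forall>x. v n x * v m x = 1 / 2 * v n x)) \<or> (\<forall>n m. n < m \<longrightarrow> (\<forall>x. v n x * v m x = 1 / 2 * v m x))"
      by blast
    show "(\<lambda>N. oscillation G (ss N) (v n)) \<longlonglongrightarrow> (- 1) ^ n / 6" for n
    proof (rule LIMSEQ_offset[of _ n])
      have "(\<lambda>k. (- 1 / 2 :: complex) ^ k) \<longlonglongrightarrow> 0" by (rule LIMSEQ_power_zero) simp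
      then have "(\<lambda>k. (- 1) ^ n * (1 - (- 1 / 2) ^ k) / 6) \<longlonglongrightarrow> (- 1) ^ n * (1 - 0 :: complex) / 6"
        by (intro tendsto_intros) auto
      then show "(\<lambda>k. oscillation G (ss (k + n)) (v n)) \<longlonglongrightarrow> (- 1) ^ n / 6"
        by (simp only: add.commute[of _ n] o diff_zero mult_1_right)
    qed
    show "(\<lambda>n. (- 1) ^ (2 * n) / 6 :: complex) \<longlonglongrightarrow> 1 / 6" by simp
    show "(\<lambda>n. (- 1) ^ (2 * n + 1) / 6 :: complex) \<longlonglongrightarrow> - 1 / 6" by simp
  qed simp
qed

text \<open>The order is opposite to the subgroup case: the elements nearest to the identity act
  first, so that the words formed before step \<open>i\<close> still lie in
  \<open>V (Suc i)\<close>. For \<open>v n\<close>, steps \<open>i \<ge> n\<close> move within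
  \<open>W n\<close>, where \<open>v n\<close> is constant, and each of the remaining
  \<open>n\<close> steps leaves \<open>V n\<close> and halves the coefficient.\<close>

lemma shrinking_neighbourhoods_not_regular:
  fixes V W :: "nat \<Rightarrow> 'a set" and s :: "nat \<Rightarrow> 'a"
  assumes p: "1 < p" and V: "\<And>n. V n \<subseteq> carrier G" "\<And>n. \<one> \<in> V n" "\<And>n. W n \<subseteq> V n" "\<And>n. V (Suc n) \<subseteq> W n"
    and s: "\<And>n. s n \<in> carrier G" "\<And>n a. a \<in> V (Suc n) \<Longrightarrow> s n \<otimes> a \<in> V n"
      "\<And>n a b x. a \<in> V (Suc n) \<Longrightarrow> b \<in> V (Suc n) \<Longrightarrow> x \<in> {s n, inv (s n)} \<Longrightarrow> inv b \<otimes> (x \<otimes> a) \<in> W n - V (Suc n)"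
    and v: "\<And>n. v n \<in> herz G \<mu> p" "\<And>n. herz_norm G \<mu> p (v n) \<le> 1"
      "\<And>n x. x \<in> W n \<Longrightarrow> v n x = 1 / 2" "\<And>n x. x \<notin> V n \<Longrightarrow> v n x = 0"
  shows "\<not> herz_arens_regular G \<mu> p"
proof -
  have Vmono: "V m \<subseteq> V n" if "n \<le> m" for n m
    using lift_Suc_antimono_le[of V, OF _ that] V(3,4) by blast
  \<comment> \<open>\<open>s (N - 1)\<close> sits at the innermost end and is averaged first.
    Enlarging \<open>N\<close> changes the beginning of the walk, so the functionals are not partial
    sums of a series.\<close>
  define L where "L N i = map s [i..<N]" for N i
  have Lc: "set (L N i) \<subseteq> carrier G" for N i using s(1) by (auto simp: L_def)
  have L_step: "L N i = s i # L N (Suc i)" if "i < N" for N i using that by (simp add: L_def upt_conv_Cons)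
  have L_nil: "L N N = []" for N by (simp add: L_def)
  have words_L: "words (L N i) \<subseteq> V i" if "i \<le> N" for N i
    using that
  proof (induction rule: inc_induct)
    case base
    show ?case using V(2) by (simp add: L_nil)
  next
    case (step i)
    then show ?case using V(3,4)[of i] s(2)[of _ i] by (auto simp: L_step)
  qed
  have coeff_s: "walk_coeff G (L N (Suc i)) (v n) x = (if n \<le> i then 1 / 2 else 0)"
    if "i < N" "x \<in> {s i, inv (s i)}" for N n i x
  proof (rule walk_coeff_eq_const[OF Lc])
    show "x \<in> carrier G" using that s(1) by auto
    fix a b assume "a \<in> words (L N (Suc i))" "b \<in> words (L N (Suc i))"
    then have "a \<in> V (Suc i)" "b \<in> V (Suc i)" using words_L[of "Suc i" N] that by auto
    then have x: "inv b \<otimes> (x \<otimes> a) \<in> W i - V (Suc i)" using s(3) that by blast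
    show "v n (inv b \<otimes> (x \<otimes> a)) = (if n \<le> i then 1 / 2 else 0)"
    proof (cases "n \<le> i")
      case True
      have "W i \<subseteq> W n"
      proof (cases "n = i")
        case False
        then have "V i \<subseteq> V (Suc n)" using True by (intro Vmono) auto
        then show ?thesis using V(3)[of i] V(4)[of n] by blast
      qed simp
      then show ?thesis using x True v(3) by auto
    next
      case False
      then show ?thesis using x v(4) Vmono[of "Suc i" n] by auto
    qed
  qed
  have one: "walk_coeff G (L N i) (v n) \<one> = (walk_coeff G (L N (Suc i)) (v n) \<one> + (if n \<le> i then 1 / 2 else 0)) / 2"
    if "i < N" for N n i
    using walk_coeff_one_step[OF _ coeff_s[OF that, of "s i" n] coeff_s[OF that, of "inv (s i)" n]] Lc[of N i]
    unfolding L_step[OF that] by (simp add: scaleR_conv_of_real del: walk_coeff.simps)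
  have small: "walk_coeff G (L N i) (v n) \<one> = 1 / 2" if "i \<le> N" "n \<le> i" for N n i
    using that
  proof (induction rule: inc_induct)
    case base
    have "\<one> \<in> W n" using V(2)[of "Suc n"] V(4)[of n] by blast
    then show ?case by (simp add: L_nil v(3))
  next
    case (step i)
    then show ?case by (simp add: one)
  qed
  have d: "walk_coeff G (L N (n - k)) (v n) \<one> = (1 / 2) ^ Suc k" if "k \<le> n" "n \<le> N" for N n k
    using that
  proof (induction k)
    case 0 then show ?case by (simp add: small)
  next
    case (Suc k)
    then have "n - Suc k < N" "\<not> n \<le> n - Suc k" "Suc (n - Suc k) = n - k" by auto
    then show ?case using one[of "n - Suc k" N n] Suc by simp
  qed
  have oscillation_step: "oscillation G (L N i) u = (- 1) ^ (N - Suc i) * (walk_coeff G (L N (Suc i)) u \<one> - walk_coeff G (L N i) u \<one>) + oscillation G (L N (Suc i)) u"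
    if "i < N" for N i and u :: "'a \<Rightarrow> complex"
    unfolding L_step[OF that] by (simp add: L_def scaleR_conv_of_real del: walk_coeff.simps)
  have o0: "oscillation G (L N i) (v n) = 0" if "i \<le> N" "n \<le> i" for N n i
    using that
  proof (induction rule: inc_induct)
    case base
    then show ?case by (simp add: L_nil)
  next
    case (step i)
    then show ?case by (simp add: oscillation_step small)
  qed
  \<comment> \<open>Step \<open>i\<close> carries the sign \<open>(-1)^(N - Suc i)\<close>, which
    depends on the parity of \<open>N\<close>; only lists of even length are used, so that the value
    no longer depends on \<open>N\<close> once \<open>N \<ge> n\<close>.\<close>
  have o: "oscillation G (L N (n - k)) (v n) = (- 1) ^ n * (1 - (- 1 / 2) ^ k) / 6" if "even N" "k \<le> n" "n \<le> N" for N n k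
    using that(2)
  proof (induction k)
    case 0
    then show ?case using that by (simp add: o0)
  next
    case (Suc k)
    define i where "i = n - Suc k"
    have i: "i < N" "Suc i = n - k" "n = i + Suc k" using Suc.prems that by (auto simp: i_def)
    have sign: "(- 1 :: complex) ^ (N - Suc i) = (- 1) ^ (n + k)"
    proof -
      have "even (N - Suc i) \<longleftrightarrow> even (n + k)" using i that by auto
      then show ?thesis by (simp add: minus_one_power_iff)
    qed
    have "oscillation G (L N i) (v n) = (- 1) ^ (n + k) * ((1 / 2) ^ Suc k - (1 / 2) ^ Suc (Suc k)) + (- 1) ^ n * (1 - (- 1 / 2) ^ k) / 6"
    proof -
      have "walk_coeff G (L N (Suc i)) (v n) \<one> = (1 / 2) ^ Suc k"
        unfolding i(2) by (rule d) (use Suc.prems that in auto)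
      moreover have "walk_coeff G (L N i) (v n) \<one> = (1 / 2) ^ Suc (Suc k)"
        unfolding i_def by (rule d) (use Suc.prems that in auto)
      moreover have "oscillation G (L N (Suc i)) (v n) = (- 1) ^ n * (1 - (- 1 / 2) ^ k) / 6"
        unfolding i(2) by (rule Suc.IH) (use Suc.prems in auto)
      ultimately show ?thesis by (simp only: oscillation_step[OF i(1), of "v n"] sign)
    qed
    also have "(- 1) ^ (n + k) * ((1 / 2) ^ Suc k - (1 / 2) ^ Suc (Suc k)) = (- 1) ^ n * ((- 1 / 2) ^ k / (4 :: complex))"
      unfolding power_divide[of "- 1 :: complex" 2 k] by (simp add: power_add power_divide)
    finally show ?case unfolding i_def by (simp add: field_simps)
  qed
  have f: "filterlim (\<lambda>n :: nat. 2 * n) at_top sequentially" "filterlim (\<lambda>n :: nat. 2 * n + 1) at_top sequentially"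
    by (rule filterlim_subseq, simp add: strict_mono_def)+
  have lim0: "(\<lambda>n. (- 1 / 2 :: complex) ^ f n) \<longlonglongrightarrow> 0" if "filterlim f at_top sequentially" for f :: "nat \<Rightarrow> nat"
    by (rule filterlim_compose[OF LIMSEQ_power_zero that]) simp
  show ?thesis
  proof (rule oscillation_criterion[OF p Lc v(1,2)])
    show "(1 / 2 :: complex) \<noteq> 0" by simp
    have "v n x * v m x = 1 / 2 * v m x" if "n < m" for n m x
    proof (cases "x \<in> V m")
      case True
      then have "x \<in> W n" using Vmono[of "Suc n" m] V(4)[of n] that by auto
      then show ?thesis by (simp add: v(3))
    qed (simp add: v(4))
    then show "(\<forall>n m. n < m \<longrightarrow> (\<forall>x. v n x * v m x = 1 / 2 * v n x)) \<or> (\<forall>n m. n < m \<longrightarrow> (\<forall>x. v n x * v m x = 1 / 2 * v m x))"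
      by blast
    show "(\<lambda>N. oscillation G (L (2 * N) 0) (v n)) \<longlonglongrightarrow> (- 1) ^ n * (1 - (- 1 / 2) ^ n) / 6" for n
    proof (rule tendsto_eventually)
      have "oscillation G (L (2 * N) 0) (v n) = (- 1) ^ n * (1 - (- 1 / 2) ^ n) / 6" if "n \<le> N" for N
        using o[of "2 * N" n n] that by simp
      then show "\<forall>\<^sub>F N in sequentially. oscillation G (L (2 * N) 0) (v n) = (- 1) ^ n * (1 - (- 1 / 2) ^ n) / 6"
        unfolding eventually_sequentially by blast
    qed
    have "(\<lambda>n. (1 - (- 1 / 2) ^ (2 * n)) / 6) \<longlonglongrightarrow> (1 - 0 :: complex) / 6"
      by (rule tendsto_divide[OF tendsto_diff[OF tendsto_const lim0[OF f(1)]] tendsto_const]) simp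
    then show "(\<lambda>n. (- 1) ^ (2 * n) * (1 - (- 1 / 2) ^ (2 * n)) / 6 :: complex) \<longlonglongrightarrow> 1 / 6" by simp
    have "(\<lambda>n. - (1 - (- 1 / 2) ^ (2 * n + 1)) / 6) \<longlonglongrightarrow> - (1 - 0 :: complex) / 6"
      by (rule tendsto_divide[OF tendsto_minus[OF tendsto_diff[OF tendsto_const lim0[OF f(2)]]] tendsto_const]) simp
    then show "(\<lambda>n. (- 1) ^ (2 * n + 1) * (1 - (- 1 / 2) ^ (2 * n + 1)) / 6 :: complex) \<longlonglongrightarrow> - 1 / 6" by simp
  qed simp
qed

end

section \<open>Non-discrete groups\<close>

locale haar_group =
  fixes G :: "('a, 'b) monoid_scheme" (structure) and T :: "'a topology" and \<mu> :: "'a measure"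
  assumes lc: "lc_group G T" and haar: "left_haar G T \<mu>"
begin

lemma group_G: "group G" and topspace_eq: "topspace T = carrier G" and Hausdorff: "Hausdorff_space T"
  and locally_compact: "locally_compact_space T"
  and cont_mult: "continuous_map (prod_topology T T) T (\<lambda>(x, y). x \<otimes> y)"
  and cont_inv: "continuous_map T T (\<lambda>x. inv x)"
  using lc by (auto simp: lc_group_def)

lemma sets_eq: "sets \<mu> = sigma_sets (carrier G) {U. openin T U}"
  using haar topspace_eq by (simp add: left_haar_def)

lemma emeasure_compact_finite: "compactin T K \<Longrightarrow> emeasure \<mu> K < \<infinity>"
  and emeasure_open_pos: "openin T U \<Longrightarrow> U \<noteq> {} \<Longrightarrow> 0 < emeasure \<mu> U"
  and outer_regular: "A \<in> sets \<mu> \<Longrightarrow> emeasure \<mu> A = (INF U\<in>{U. openin T U \<and> A \<subseteq> U}. emeasure \<mu> U)"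
  using haar unfolding left_haar_def by blast+

lemma openin_sets: "openin T U \<Longrightarrow> U \<in> sets \<mu>"
  by (simp add: sets_eq)

lemma closedin_sets:
  assumes "closedin T C" shows "C \<in> sets \<mu>"
proof -
  have "space \<mu> - (topspace T - C) \<in> sets \<mu>" using assms by (intro sets.compl_sets openin_sets) auto
  moreover have "space \<mu> - (topspace T - C) = C"
    using closedin_subset[OF assms] haar topspace_eq by (auto simp: left_haar_def)
  ultimately show ?thesis by simp
qed

lemma cont_mult2:
  assumes "continuous_map X T f" "continuous_map X T g"
  shows "continuous_map X T (\<lambda>x. f x \<otimes> g x)"
proof -
  have "continuous_map X (prod_topology T T) (\<lambda>x. (f x, g x))" using assms by (simp add: continuous_map_pairedI)
  from continuous_map_compose[OF this cont_mult] show ?thesis by (simp add: o_def)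
qed

lemma cont_inv2: "continuous_map X T f \<Longrightarrow> continuous_map X T (\<lambda>x. inv (f x))"
  using continuous_map_compose[OF _ cont_inv] by (simp add: o_def)

lemma cont_const: "a \<in> carrier G \<Longrightarrow> continuous_map X T (\<lambda>x. a)"
  by (simp add: topspace_eq)

lemma cont_left: "a \<in> carrier G \<Longrightarrow> continuous_map T T (\<lambda>x. a \<otimes> x)"
  using continuous_map_id by (intro cont_mult2 cont_const) (simp_all add: id_def)

sublocale invariant_measure G \<mu>
proof -
  interpret group G by (rule group_G)
  have space: "space \<mu> = carrier G"
    and inv: "\<And>g A. g \<in> carrier G \<Longrightarrow> A \<in> sets \<mu> \<Longrightarrow> emeasure \<mu> ((\<lambda>x. g \<otimes> x) ` A) = emeasure \<mu> A"
    using haar by (auto simp: left_haar_def)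
  have meas: "(\<lambda>y. a \<otimes> y) \<in> measurable \<mu> \<mu>" if a: "a \<in> carrier G" for a
  proof (rule measurable_sigma_sets[OF sets_eq])
    show "{U. openin T U} \<subseteq> Pow (carrier G)" using openin_subset topspace_eq by auto
    show "(\<lambda>y. a \<otimes> y) \<in> space \<mu> \<rightarrow> carrier G" using a by (auto simp: space)
    fix U assume "U \<in> {U. openin T U}"
    then have "openin T {x \<in> topspace T. a \<otimes> x \<in> U}"
      using openin_continuous_map_preimage[OF cont_left[OF a]] by simp
    moreover have "{x \<in> topspace T. a \<otimes> x \<in> U} = (\<lambda>y. a \<otimes> y) -` U \<inter> space \<mu>"
      by (auto simp: space topspace_eq)
    ultimately show "(\<lambda>y. a \<otimes> y) -` U \<inter> space \<mu> \<in> sets \<mu>" by (simp add: openin_sets)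
  qed
  show "invariant_measure G \<mu>"
  proof
    show "space \<mu> = carrier G" by (rule space)
    fix a assume a: "a \<in> carrier G"
    show "(\<lambda>y. a \<otimes> y) \<in> measurable \<mu> \<mu>" by (rule meas[OF a])
    show "distr \<mu> \<mu> (\<lambda>y. a \<otimes> y) = \<mu>"
    proof (rule measure_eqI)
      fix A assume "A \<in> sets (distr \<mu> \<mu> (\<lambda>y. a \<otimes> y))"
      then have A: "A \<in> sets \<mu>" by simp
      have Ac: "x \<in> carrier G" if "x \<in> A" for x using sets.sets_into_space[OF A] that space by auto
      have "(\<lambda>y. a \<otimes> y) -` A \<inter> space \<mu> = (\<lambda>y. inv a \<otimes> y) ` A"
      proof (intro equalityI subsetI)
        fix x assume "x \<in> (\<lambda>y. a \<otimes> y) -` A \<inter> space \<mu>"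
        then have "x \<in> carrier G" "a \<otimes> x \<in> A" by (auto simp: space)
        moreover have "x = inv a \<otimes> (a \<otimes> x)" using a \<open>x \<in> carrier G\<close> by (simp flip: m_assoc)
        ultimately show "x \<in> (\<lambda>y. inv a \<otimes> y) ` A" by blast
      next
        fix x assume "x \<in> (\<lambda>y. inv a \<otimes> y) ` A"
        then obtain y where y: "y \<in> A" "x = inv a \<otimes> y" by auto
        then have "a \<otimes> x = y" using a Ac[OF y(1)] by (simp flip: m_assoc)
        then show "x \<in> (\<lambda>y. a \<otimes> y) -` A \<inter> space \<mu>" using y a Ac[OF y(1)] by (auto simp: space)
      qed
      then show "emeasure (distr \<mu> \<mu> (\<lambda>y. a \<otimes> y)) A = emeasure \<mu> A"
        using emeasure_distr[OF meas[OF a] A] inv[of "inv a" A] a A by simp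
    qed simp
  qed
qed

lemma nbhd_of_one:
  assumes f: "continuous_map (prod_topology T T) T f" and U: "openin T U" "f (\<one>, \<one>) \<in> U"
  obtains V where "openin T V" "\<one> \<in> V" "\<And>a b. a \<in> V \<Longrightarrow> b \<in> V \<Longrightarrow> f (a, b) \<in> U"
proof -
  define S where "S = {z \<in> topspace (prod_topology T T). f z \<in> U}"
  have "openin (prod_topology T T) S"
    unfolding S_def by (rule openin_continuous_map_preimage[OF f U(1)])
  moreover have "(\<one>, \<one>) \<in> S" using U by (simp add: S_def topspace_eq)
  ultimately obtain A B where AB: "openin T A" "openin T B" "\<one> \<in> A" "\<one> \<in> B" "A \<times> B \<subseteq> S"
    using openin_prod_topology_alt[THEN iffD1, rule_format, of T T S \<one> \<one>] by metis
  have "f (a, b) \<in> U" if "a \<in> A" "b \<in> B" for a b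
  proof -
    have "(a, b) \<in> S" using AB(5) that by blast
    then show ?thesis by (simp add: S_def)
  qed
  with AB show thesis by (intro that[of "A \<inter> B"]) auto
qed

text \<open>Inner and outer sets for \<open>herz_bump\<close>: outer regularity bounds the measure
  of an open \<open>E\<close> around a compact \<open>K\<close>, the tube lemma gives
  \<open>xK \<subseteq> E\<close> for \<open>x\<close> near the identity, and
  \<open>E \<subseteq> M\<close> with \<open>a \<otimes> inv b \<in> V\<close> for \<open>a\<close>,
  \<open>b\<close> in \<open>M\<close> keeps the support in \<open>V\<close>.\<close>

lemma bump_at_one:
  assumes p: "1 < p" and V: "openin T V" "\<one> \<in> V"
  obtains v W where "v \<in> herz G \<mu> p" "herz_norm G \<mu> p v \<le> 1" "openin T W" "\<one> \<in> W" "W \<subseteq> V"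
    "\<And>x. x \<in> W \<Longrightarrow> v x = 1 / 2" "\<And>x. x \<notin> V \<Longrightarrow> v x = 0"
proof -
  have fs: "continuous_map (prod_topology T T) T fst" "continuous_map (prod_topology T T) T snd"
    by (auto intro: continuous_map_fst continuous_map_snd)
  obtain M where M: "openin T M" "\<one> \<in> M" "\<And>a b. a \<in> M \<Longrightarrow> b \<in> M \<Longrightarrow> a \<otimes> inv b \<in> V"
    using nbhd_of_one[OF cont_mult2[OF fs(1) cont_inv2[OF fs(2)]], of V] V by auto
  have "neighbourhood_base_of (compactin T) T"
    using locally_compact_space_neighbourhood_base[of T] Hausdorff locally_compact by blast
  then obtain U K where K: "openin T U" "compactin T K" "\<one> \<in> U" "U \<subseteq> K" "K \<subseteq> M"
    using neighbourhood_base_of[THEN iffD1, rule_format, of "compactin T" T M \<one>] M(1,2) by metis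
  have Ks: "K \<in> sets \<mu>" by (intro closedin_sets compactin_imp_closedin Hausdorff K)
  have Kfin: "emeasure \<mu> K \<noteq> \<infinity>" using emeasure_compact_finite[OF K(2)] by simp
  have "0 < emeasure \<mu> U" using K by (intro emeasure_open_pos) auto
  also have "\<dots> \<le> emeasure \<mu> K" by (rule emeasure_mono[OF K(4) Ks])
  finally have K0: "0 < emeasure \<mu> K" .
  then have Kpos: "0 < measure \<mu> K" using Kfin by (simp add: measure_def enn2real_positive_iff top.not_eq_extremum)
  note outer_regular[OF Ks]
  moreover have "emeasure \<mu> K < ennreal (2 * measure \<mu> K)"
    using Kfin Kpos by (simp add: emeasure_eq_ennreal_measure ennreal_less_iff)
  ultimately obtain E0 where E0: "openin T E0" "K \<subseteq> E0" "emeasure \<mu> E0 < ennreal (2 * measure \<mu> K)"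
    by (auto simp: INF_less_iff)
  define E where "E = E0 \<inter> M"
  have E: "openin T E" "K \<subseteq> E" using E0 M K by (auto simp: E_def)
  have "emeasure \<mu> E \<le> emeasure \<mu> E0" using E0 openin_sets by (intro emeasure_mono) (auto simp: E_def)
  then have Ele: "emeasure \<mu> E < ennreal (2 * measure \<mu> K)" using E0(3) by simp
  then have Efin: "emeasure \<mu> E \<noteq> \<infinity>" by auto
  have Em: "measure \<mu> E \<le> 2 * measure \<mu> K"
    using Ele Efin by (simp add: emeasure_eq_ennreal_measure ennreal_less_iff)
  obtain v where v: "v \<in> herz G \<mu> p" "herz_norm G \<mu> p v \<le> 1"
    "\<And>x. x \<in> carrier G \<Longrightarrow> (\<And>k. k \<in> K \<Longrightarrow> x \<otimes> k \<in> E) \<Longrightarrow> v x = 1 / 2"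
    "\<And>x. x \<in> carrier G \<Longrightarrow> (\<And>k. k \<in> K \<Longrightarrow> x \<otimes> k \<notin> E) \<Longrightarrow> v x = 0"
    "\<And>x. x \<notin> carrier G \<Longrightarrow> v x = 0"
    using herz_bump[OF p Ks Kfin Kpos openin_sets[OF E(1)] Efin Em] by blast
  have Kc: "K \<subseteq> carrier G" using compactin_subset_topspace[OF K(2)] topspace_eq by simp
  define S where "S = {z \<in> topspace (prod_topology T T). (\<lambda>(x, y). x \<otimes> y) z \<in> E}"
  have "openin (prod_topology T T) S"
    unfolding S_def by (rule openin_continuous_map_preimage[OF cont_mult E(1)])
  moreover have "{\<one>} \<times> K \<subseteq> S"
    using Kc E by (auto simp: S_def topspace_eq subset_iff)
  moreover have "\<one> \<in> topspace T" by (simp add: topspace_eq)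
  ultimately obtain U' V' where UV: "openin T U'" "\<one> \<in> U'" "K \<subseteq> V'" "U' \<times> V' \<subseteq> S"
    using tube_lemma_right[of T T S K \<one>] K(2) by metis
  have UE: "x \<otimes> k \<in> E" if "x \<in> U'" "k \<in> K" for x k 
  proof -
    have "(x, k) \<in> S" using UV(3,4) that by blast
    then show ?thesis by (simp add: S_def)
  qed
  show thesis
  proof (rule that[OF v(1,2)])
    show "openin T (U' \<inter> V)" "\<one> \<in> U' \<inter> V" "U' \<inter> V \<subseteq> V" using UV V by auto
    show "v x = 1 / 2" if "x \<in> U' \<inter> V" for x
      using that v(3)[of x] UE openin_subset[OF UV(1)] topspace_eq by auto
    show "v x = 0" if x: "x \<notin> V" for x
    proof (cases "x \<in> carrier G")
      case True
      have "x \<otimes> k \<notin> E" if k: "k \<in> K" for k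
      proof
        assume "x \<otimes> k \<in> E"
        then have "x \<otimes> k \<otimes> inv k \<in> V" using M(3) K(5) k by (auto simp: E_def)
        then show False using x True k Kc by (auto simp: m_assoc)
      qed
      then show ?thesis by (rule v(4)[OF True])
    qed (rule v(5))
  qed
qed

text \<open>Since \<open>s\<close> and \<open>inv s\<close> differ from the identity, the Hausdorff
  property separates them from it, and continuity gives a \<open>V'\<close> so small that
  multiplying them on both sides by \<open>V'\<close> neither leaves \<open>W\<close> nor meets
  \<open>V'\<close>.\<close>

lemma neighbourhood_step:
  assumes p: "1 < p" and nondiscrete: "\<not> openin T {\<one>}" and V: "openin T V" "\<one> \<in> V"
  shows "\<exists>W s V' v. v \<in> herz G \<mu> p \<and> herz_norm G \<mu> p v \<le> 1 \<and> W \<subseteq> V \<and>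
    (\<forall>x\<in>W. v x = 1 / 2) \<and> (\<forall>x. x \<notin> V \<longrightarrow> v x = 0) \<and> s \<in> carrier G \<and>
    openin T V' \<and> \<one> \<in> V' \<and> V' \<subseteq> W \<and> (\<forall>a\<in>V'. s \<otimes> a \<in> V) \<and>
    (\<forall>a\<in>V'. \<forall>b\<in>V'. \<forall>x\<in>{s, inv s}. inv b \<otimes> (x \<otimes> a) \<in> W - V')"
proof -
  obtain v W where v: "v \<in> herz G \<mu> p" "herz_norm G \<mu> p v \<le> 1" "openin T W" "\<one> \<in> W" "W \<subseteq> V"
    "\<And>x. x \<in> W \<Longrightarrow> v x = 1 / 2" "\<And>x. x \<notin> V \<Longrightarrow> v x = 0"
    using bump_at_one[OF p V] by blast
  \<comment> \<open>A step at the identity evaluates at \<open>s\<close> and at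
    \<open>inv s\<close>, so both have to lie in \<open>W\<close>.\<close>
  define W' where "W' = W \<inter> {x \<in> topspace T. inv x \<in> W}"
  have "openin T W'" unfolding W'_def
    by (intro openin_Int v openin_continuous_map_preimage[OF cont_inv])
  moreover have "\<one> \<in> W'" using v by (simp add: W'_def topspace_eq)
  ultimately obtain s where "s \<in> W'" "s \<noteq> \<one>" using nondiscrete by (metis insertI1 is_singletonI' is_singleton_the_elem singletonD empty_iff)
  then have s: "s \<in> carrier G" "s \<in> W" "inv s \<in> W" "s \<noteq> \<one>" "inv s \<noteq> \<one>"
    by (auto simp: W'_def topspace_eq)
  have "\<exists>A. openin T A \<and> \<one> \<in> A \<and> (\<forall>a\<in>A. \<forall>b\<in>A. inv b \<otimes> (x \<otimes> a) \<in> W - A)"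
    if x: "x \<in> carrier G" "x \<in> W" "x \<noteq> \<one>" for x
  proof -
    obtain P Q where PQ: "openin T P" "openin T Q" "x \<in> P" "\<one> \<in> Q" "disjnt P Q"
      using Hausdorff x unfolding Hausdorff_space_def by (metis one_closed topspace_eq)
    have "continuous_map (prod_topology T T) T (\<lambda>z. inv (fst z) \<otimes> (x \<otimes> snd z))"
      using x by (intro cont_mult2 cont_inv2 cont_const) (auto intro: continuous_map_fst continuous_map_snd)
    from nbhd_of_one[OF this, of "W \<inter> P"]
    obtain A where A: "openin T A" "\<one> \<in> A" "\<And>a b. a \<in> A \<Longrightarrow> b \<in> A \<Longrightarrow> inv a \<otimes> (x \<otimes> b) \<in> W \<inter> P"
      using v PQ x by auto
    show ?thesis
      by (rule exI[of _ "A \<inter> Q"]) (use A PQ in \<open>auto simp: disjnt_iff\<close>)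
  qed
  from this[of s] this[of "inv s"] obtain A B where
    A: "openin T A" "\<one> \<in> A" "\<forall>a\<in>A. \<forall>b\<in>A. inv b \<otimes> (s \<otimes> a) \<in> W - A" and
    B: "openin T B" "\<one> \<in> B" "\<forall>a\<in>B. \<forall>b\<in>B. inv b \<otimes> (inv s \<otimes> a) \<in> W - B"
    using s by auto
  define V' where "V' = A \<inter> B \<inter> W \<inter> {x \<in> topspace T. s \<otimes> x \<in> V}"
  have V': "openin T V'" unfolding V'_def
    by (intro openin_Int A B v openin_continuous_map_preimage[OF cont_left] V s)
  have one: "\<one> \<in> V'" using A B v s by (auto simp: V'_def topspace_eq)
  show ?thesis
  proof (intro exI conjI)
    show "\<forall>a\<in>V'. \<forall>b\<in>V'. \<forall>x\<in>{s, inv s}. inv b \<otimes> (x \<otimes> a) \<in> W - V'"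
      using A(3) B(3) unfolding V'_def by blast
    show "\<forall>a\<in>V'. s \<otimes> a \<in> V" "V' \<subseteq> W" by (auto simp: V'_def)
  qed (use v s V' one in auto)
qed

lemma regular_imp_discrete:
  assumes p: "1 < p" and reg: "herz_arens_regular G \<mu> p"
  shows "openin T {\<one>}"
proof (rule ccontr)
  assume nd: "\<not> openin T {\<one>}"
  define R where "R V W s V' v \<longleftrightarrow> v \<in> herz G \<mu> p \<and> herz_norm G \<mu> p v \<le> 1 \<and> W \<subseteq> V \<and>
    (\<forall>x\<in>W. v x = 1 / 2) \<and> (\<forall>x. x \<notin> V \<longrightarrow> v x = 0) \<and> s \<in> carrier G \<and>
    openin T V' \<and> \<one> \<in> V' \<and> V' \<subseteq> W \<and> (\<forall>a\<in>V'. s \<otimes> a \<in> V) \<and>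
    (\<forall>a\<in>V'. \<forall>b\<in>V'. \<forall>x\<in>{s, inv s}. inv b \<otimes> (x \<otimes> a) \<in> W - V')" for V W s V' v
  have "\<exists>W s V' v. R V W s V' v" if "openin T V" "\<one> \<in> V" for V
    unfolding R_def by (rule neighbourhood_step[OF p nd that])
  \<comment> \<open>The choice is made total in \<open>V\<close>, so that the next neighbourhood
    becomes a function of \<open>V\<close> that can be iterated.\<close>
  then have "\<forall>V. \<exists>W s V' v. openin T V \<longrightarrow> \<one> \<in> V \<longrightarrow> R V W s V' v" by metis
  then obtain W s V' v where step: "\<And>V. openin T V \<Longrightarrow> \<one> \<in> V \<Longrightarrow> R V (W V) (s V) (V' V) (v V)"
    by metis
  define U where "U n = (V' ^^ n) (carrier G)" for n
  have U_Suc: "U (Suc n) = V' (U n)" for n by (simp add: U_def)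
  have U: "openin T (U n) \<and> \<one> \<in> U n" for n
  proof (induction n)
    case 0
    show ?case using openin_topspace[of T] by (simp add: U_def topspace_eq)
  next
    case (Suc n)
    then show ?case using step[of "U n"] by (simp add: U_Suc R_def)
  qed
  note st = step[OF conjunct1[OF U] conjunct2[OF U], unfolded R_def]
  have "\<not> herz_arens_regular G \<mu> p"
  proof (rule shrinking_neighbourhoods_not_regular[OF p, where V = U and W = "\<lambda>n. W (U n)" and s = "\<lambda>n. s (U n)" and v = "\<lambda>n. v (U n)"])
    show "U n \<subseteq> carrier G" for n using openin_subset[OF conjunct1[OF U]] topspace_eq by simp
    show "\<one> \<in> U n" for n using U by simp
  qed (use st in \<open>simp_all only: U_Suc\<close>, blast+)
  then show False using reg by simp
qed

end

section \<open>Discrete groups and their subgroups\<close>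

lemma integrable_count_space_iff:
  fixes f :: "'a \<Rightarrow> 'b :: {banach, second_countable_topology}"
  shows "integrable (count_space A) f \<longleftrightarrow> (\<lambda>x. norm (f x)) summable_on A"
  using abs_summable_equivalent[of f A] by (simp add: abs_summable_on_def)

lemma integral_count_space_infsum:
  fixes f :: "'a \<Rightarrow> 'b :: {banach, second_countable_topology}"
  assumes "integrable (count_space A) f"
  shows "(\<integral>x. f x \<partial>count_space A) = infsum f A"
  using infsetsum_infsum[of f A] assms by (simp add: abs_summable_on_def infsetsum_def)

lemma in_Lp_count_space: "in_Lp (count_space A) p f \<longleftrightarrow> (\<lambda>x. norm (f x) powr p) summable_on A"
  by (simp add: in_Lp_def integrable_count_space_iff)

lemma Lp_norm_count_space:
  "in_Lp (count_space A) p f \<Longrightarrow> Lp_norm (count_space A) p f = (infsum (\<lambda>x. norm (f x) powr p) A) powr (1 / p)"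
  by (simp add: in_Lp_def Lp_norm_def integral_count_space_infsum)

lemma Holder_inequality:
  assumes p: "1 < p" and f: "in_Lp M p f" and g: "in_Lp M (conj_exp p) g"
  shows "integrable M (\<lambda>x. norm (f x) * norm (g x))"
    and "(\<integral>x. norm (f x) * norm (g x) \<partial>M) \<le> Lp_norm M p f * Lp_norm M (conj_exp p) g"
proof -
  define q where "q = conj_exp p"
  have q: "q > 1" "1 / p + 1 / q = 1" using conj_exp_gt1[OF p] conj_exp_inverse_sum[OF p] by (auto simp: q_def)
  have fm: "f \<in> borel_measurable M" and gm: "g \<in> borel_measurable M"
    and fi: "integrable M (\<lambda>x. norm (f x) powr p)" and gi: "integrable M (\<lambda>x. norm (g x) powr q)"
    using f g by (auto simp: in_Lp_def q_def)
  define F K where "F = (\<integral>x. norm (f x) powr p \<partial>M)" and "K = (\<integral>x. norm (g x) powr q \<partial>M)"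
  have FK: "F \<ge> 0" "K \<ge> 0" by (auto simp: F_def K_def)
  have young: "norm (f x) * norm (g x) \<le> a * b * (norm (f x) powr p / (p * a powr p) + norm (g x) powr q / (q * b powr q))"
    if "a > 0" "b > 0" for a b x
  proof -
    have "norm (f x) / a * (norm (g x) / b) \<le> (norm (f x) / a) powr p / p + (norm (g x) / b) powr q / q"
      using that by (intro Youngs_inequality p q) auto
    then have "norm (f x) * norm (g x) / (a * b) \<le> norm (f x) powr p / (p * a powr p) + norm (g x) powr q / (q * b powr q)"
      using that by (simp add: powr_divide mult.commute)
    then show ?thesis using that by (simp add: divide_le_eq mult.commute)
  qed
  show int: "integrable M (\<lambda>x. norm (f x) * norm (g x))"
  proof (rule Bochner_Integration.integrable_bound)
    show "integrable M (\<lambda>x. 1 * 1 * (norm (f x) powr p / (p * 1 powr p) + norm (g x) powr q / (q * 1 powr q)))"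
      using fi gi by (intro integrable_mult_right Bochner_Integration.integrable_add) simp_all
    show "(\<lambda>x. norm (f x) * norm (g x)) \<in> borel_measurable M" using fm gm by measurable
    show "AE x in M. norm (norm (f x) * norm (g x)) \<le> norm (1 * 1 * (norm (f x) powr p / (p * 1 powr p) + norm (g x) powr q / (q * 1 powr q)))"
      using young[of 1 1] by (auto intro: order_trans[OF _ abs_ge_self])
  qed
  \<comment> \<open>Young's inequality after scaling by the norms increased by \<open>d\<close>,
    which covers functions of norm zero.\<close>
  have bound: "(\<integral>x. norm (f x) * norm (g x) \<partial>M) \<le> (F powr (1 / p) + d) * (K powr (1 / q) + d)" if d: "d > 0" for d
  proof -
    define a b where "a = F powr (1 / p) + d" and "b = K powr (1 / q) + d"
    have ab: "a > 0" "b > 0" using d by (auto simp: a_def b_def intro!: add_nonneg_pos)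
    have Fa: "F \<le> a powr p"
    proof -
      have "F = (F powr (1 / p)) powr p" using FK p by (simp add: powr_powr)
      also have "\<dots> \<le> a powr p" unfolding a_def using d p by (intro powr_mono2) auto
      finally show ?thesis .
    qed
    have Kb: "K \<le> b powr q"
    proof -
      have "K = (K powr (1 / q)) powr q" using FK q by (simp add: powr_powr)
      also have "\<dots> \<le> b powr q" unfolding b_def using d q by (intro powr_mono2) auto
      finally show ?thesis .
    qed
    have "(\<integral>x. norm (f x) * norm (g x) \<partial>M) \<le> (\<integral>x. a * b * (norm (f x) powr p / (p * a powr p) + norm (g x) powr q / (q * b powr q)) \<partial>M)"
      by (rule integral_mono[OF int _ young[OF ab]])
        (use fi gi in \<open>intro integrable_mult_right Bochner_Integration.integrable_add, simp_all\<close>)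
    also have "\<dots> = a * b * (F / a powr p / p + K / b powr q / q)"
      using fi gi by (simp add: F_def K_def mult.commute)
    also have "\<dots> \<le> a * b * (1 / p + 1 / q)"
      using ab Fa Kb p q by (intro mult_left_mono add_mono divide_right_mono) auto
    finally show ?thesis using q by (simp add: a_def b_def)
  qed
  have "(\<integral>x. norm (f x) * norm (g x) \<partial>M) \<le> F powr (1 / p) * K powr (1 / q)"
  proof (rule tendsto_lowerbound)
    show "((\<lambda>d. (F powr (1 / p) + d) * (K powr (1 / q) + d)) \<longlongrightarrow> F powr (1 / p) * K powr (1 / q)) (at_right 0)"
      by (auto intro!: tendsto_eq_intros)
    show "\<forall>\<^sub>F d in at_right 0. (\<integral>x. norm (f x) * norm (g x) \<partial>M) \<le> (F powr (1 / p) + d) * (K powr (1 / q) + d)"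
      by (rule eventually_at_rightI[of 0 1]) (auto intro!: bound)
  qed simp
  then show "(\<integral>x. norm (f x) * norm (g x) \<partial>M) \<le> Lp_norm M p f * Lp_norm M (conj_exp p) g"
    by (simp add: Lp_norm_def F_def K_def q_def)
qed

lemma invariant_measure_count_space:
  assumes "group G"
  shows "invariant_measure G (count_space (carrier G))"
proof -
  interpret group G by fact
  show ?thesis
  proof
    fix a assume a: "a \<in> carrier G"
    show "(\<lambda>y. a \<otimes>\<^bsub>G\<^esub> y) \<in> measurable (count_space (carrier G)) (count_space (carrier G))" using a by auto
    have "bij_betw (\<lambda>y. a \<otimes>\<^bsub>G\<^esub> y) (carrier G) (carrier G)"
      by (rule bij_betwI[where g = "\<lambda>y. inv\<^bsub>G\<^esub> a \<otimes>\<^bsub>G\<^esub> y"]) (use a in \<open>auto simp flip: m_assoc\<close>)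
    then show "distr (count_space (carrier G)) (count_space (carrier G)) (\<lambda>y. a \<otimes>\<^bsub>G\<^esub> y) = count_space (carrier G)"
      by (rule distr_bij_count_space)
  qed simp
qed

text \<open>Restricting to a subgroup splits each term of a representation over cosets, so terms
  come indexed by pairs. An injection into the natural numbers, with zero functions in the gaps,
  turns them into a sequence.\<close>

lemma (in invariant_measure) herz_countable_sum:
  assumes I: "countable I" and f: "\<And>i. i \<in> I \<Longrightarrow> in_Lp \<mu> p (f i)" and g: "\<And>i. i \<in> I \<Longrightarrow> in_Lp \<mu> (conj_exp p) (g i)"
    and S: "((\<lambda>i. Lp_norm \<mu> p (f i) * Lp_norm \<mu> (conj_exp p) (g i)) has_sum S) I"
    and u: "\<And>x. x \<in> carrier G \<Longrightarrow> ((\<lambda>i. conv G \<mu> (g i) (check G (f i)) x) has_sum u x) I"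
    and u0: "\<And>x. x \<notin> carrier G \<Longrightarrow> u x = 0"
  shows "u \<in> herz G \<mu> p" and "herz_norm G \<mu> p u \<le> S"
proof -
  define e where "e = to_nat_on I"
  have e: "inj_on e I" unfolding e_def by (rule inj_on_to_nat_on[OF I])
  define ext where "ext h n = (if n \<in> e ` I then h (inv_into I e n) else (\<lambda>x. 0))" for h :: "'c \<Rightarrow> 'a \<Rightarrow> complex" and n
  have sums: "(\<lambda>n. if n \<in> e ` I then h (inv_into I e n) else 0) sums s" if "(h has_sum s) I"
    for h :: "'c \<Rightarrow> 'd :: {comm_monoid_add, topological_space}" and s
  proof -
    have "(((\<lambda>n. h (inv_into I e n)) \<circ> e) has_sum s) I"
      using that by (rule iffD1[OF has_sum_cong, rotated]) (simp add: e)
    then have "((\<lambda>n. h (inv_into I e n)) has_sum s) (e ` I)" by (simp only: has_sum_reindex[OF e])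
    then have "((\<lambda>n. if n \<in> e ` I then h (inv_into I e n) else 0) has_sum s) UNIV"
      by (rule iffD1[OF has_sum_cong_neutral, rotated -1]) auto
    then show ?thesis by (rule has_sum_imp_sums)
  qed
  have ext_eq: "(\<lambda>n. Lp_norm \<mu> p (ext f n) * Lp_norm \<mu> (conj_exp p) (ext g n))
      = (\<lambda>n. if n \<in> e ` I then Lp_norm \<mu> p (f (inv_into I e n)) * Lp_norm \<mu> (conj_exp p) (g (inv_into I e n)) else 0)"
    by (auto simp: ext_def Lp_norm_def)
  note S' = sums[OF S, folded ext_eq]
  have rep: "herz_rep G \<mu> p (ext f) (ext g) u"
    unfolding herz_rep_def
  proof (intro conjI allI ballI impI u0)
    fix n
    show "in_Lp \<mu> p (ext f n)" "in_Lp \<mu> (conj_exp p) (ext g n)"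
      using f[of "inv_into I e n"] g[of "inv_into I e n"] by (auto simp: ext_def inv_into_into in_Lp_def)
  next
    fix x assume x: "x \<in> carrier G"
    have "(\<lambda>n. conv G \<mu> (ext g n) (check G (ext f n)) x)
      = (\<lambda>n. if n \<in> e ` I then conv G \<mu> (g (inv_into I e n)) (check G (f (inv_into I e n))) x else 0)"
      by (auto simp: ext_def conv_def)
    then show "(\<lambda>n. conv G \<mu> (ext g n) (check G (ext f n)) x) sums u x" using sums[OF u[OF x]] by simp
  qed (use S' in \<open>auto simp: sums_iff\<close>)
  then show "u \<in> herz G \<mu> p" by (auto simp: herz_def)
  show "herz_norm G \<mu> p u \<le> S" using herz_norm_le[OF rep] S' by (simp add: sums_iff)
qed

text \<open>This makes the pointwise series of a representation absolutely summable, as rearranging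
  it over pairs of indices requires.\<close>

lemma (in invariant_measure) conv_check_bound:
  assumes p: "1 < p" and f: "in_Lp \<mu> p f" and g: "in_Lp \<mu> (conj_exp p) g" and x: "x \<in> carrier G"
  shows "norm (conv G \<mu> g (check G f) x) \<le> Lp_norm \<mu> p f * Lp_norm \<mu> (conj_exp p) g"
proof -
  have fx: "in_Lp \<mu> p (\<lambda>y. f (inv x \<otimes> y))" using x by (intro in_Lp_translate f) auto
  have n: "Lp_norm \<mu> p (\<lambda>y. f (inv x \<otimes> y)) = Lp_norm \<mu> p f"
    unfolding Lp_norm_def using integral_translate[of "inv x" "\<lambda>y. norm (f y) powr p"] x f by (auto simp: in_Lp_def)
  have "norm (conv G \<mu> g (check G f) x) \<le> (\<integral>y. norm (g y * f (inv x \<otimes> y)) \<partial>\<mu>)"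
    unfolding conv_check_eq[OF x] by (rule integral_norm_bound)
  also have "\<dots> = (\<integral>y. norm (f (inv x \<otimes> y)) * norm (g y) \<partial>\<mu>)" by (simp add: norm_mult mult.commute)
  also have "\<dots> \<le> Lp_norm \<mu> p f * Lp_norm \<mu> (conj_exp p) g"
    using Holder_inequality(2)[OF p fx g] n by simp
  finally show ?thesis .
qed

text \<open>Multiplying \<open>f\<close> by \<open>c powr (1/p)\<close> and \<open>g\<close> by
  \<open>c powr (1/q)\<close> is a bijection between the representations for the two measures that
  preserves norms and convolutions, because \<open>1/p + 1/q = 1\<close>. The Haar measure of a
  discrete group is counting measure only up to such a factor, whereas the finiteness hypothesis on
  subgroups speaks of counting measure.\<close>

lemma herz_scaled_count_space:
  fixes c :: real and G :: "('a, 'b) monoid_scheme"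
  assumes p: "1 < p" and c: "c > 0"
  defines "M \<equiv> count_space (carrier G)"
  shows "herz G (density M (\<lambda>_. c)) p = herz G M p" and "herz_norm G (density M (\<lambda>_. c)) p = herz_norm G M p"
proof -
  define q a b where "q = conj_exp p" and "a = c powr (1 / p)" and "b = c powr (1 / q)"
  have q: "q > 1" "1 / p + 1 / q = 1" using conj_exp_gt1[OF p] conj_exp_inverse_sum[OF p] by (auto simp: q_def)
  have ab: "a > 0" "b > 0" "a * b = c" using c q(2) by (auto simp: a_def b_def simp flip: powr_add)
  have dens: "integrable (density M (\<lambda>_. c)) h \<longleftrightarrow> integrable M h" "integral\<^sup>L (density M (\<lambda>_. c)) h = c *\<^sub>R integral\<^sup>L M h"
    for h :: "'a \<Rightarrow> 'c :: {banach, second_countable_topology}"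
    using c integrable_density[of h M "\<lambda>_. c"] integral_density[of h M "\<lambda>_. c"]
      integrable_scaleR_right[of "1 / c" M "\<lambda>x. c *\<^sub>R h x"] by (auto simp: M_def)
  have Lp: "in_Lp (density M (\<lambda>_. c)) r f \<longleftrightarrow> in_Lp M r (\<lambda>x. complex_of_real k * f x)" if "k > 0" for r f k
    using that by (simp add: in_Lp_def dens norm_mult powr_mult) (simp add: M_def)
  have norm: "Lp_norm (density M (\<lambda>_. c)) r f = Lp_norm M r (\<lambda>x. complex_of_real (c powr (1 / r)) * f x)"
    if "r > 1" for r f
    unfolding Lp_norm_def using c that by (simp add: dens norm_mult powr_mult powr_powr)
  have conv: "conv G (density M (\<lambda>_. c)) g (check G f) x
      = conv G M (\<lambda>x. complex_of_real b * g x) (check G (\<lambda>x. complex_of_real a * f x)) x" for f g x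
  proof -
    have "conv G (density M (\<lambda>_. c)) g (check G f) x = complex_of_real (a * b) * (\<integral>y. g y * check G f (inv\<^bsub>G\<^esub> y \<otimes>\<^bsub>G\<^esub> x) \<partial>M)"
      unfolding conv_def dens ab(3) by (simp add: scaleR_conv_of_real)
    also have "\<dots> = (\<integral>y. complex_of_real (a * b) * (g y * check G f (inv\<^bsub>G\<^esub> y \<otimes>\<^bsub>G\<^esub> x)) \<partial>M)"
      by (rule integral_mult_right_zero[symmetric])
    also have "\<dots> = conv G M (\<lambda>x. complex_of_real b * g x) (check G (\<lambda>x. complex_of_real a * f x)) x"
      unfolding conv_def check_def by (rule Bochner_Integration.integral_cong) simp_all
    finally show ?thesis .
  qed
  define S where "S N f g = (\<lambda>i. Lp_norm N p (f i) * Lp_norm N (conj_exp p) (g i))"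
    for N :: "'a measure" and f g :: "nat \<Rightarrow> 'a \<Rightarrow> complex"
  have S: "S (density M (\<lambda>_. c)) f g = S M (\<lambda>i x. complex_of_real a * f i x) (\<lambda>i x. complex_of_real b * g i x)" for f g
    unfolding S_def using norm[OF p] norm[OF q(1)] by (simp add: a_def b_def q_def)
  have rep: "herz_rep G (density M (\<lambda>_. c)) p f g u
      \<longleftrightarrow> herz_rep G M p (\<lambda>i x. complex_of_real a * f i x) (\<lambda>i x. complex_of_real b * g i x) u" for f g u
    unfolding herz_rep_def S_def[symmetric] S conv Lp[OF ab(1), of p] Lp[OF ab(2), of "conj_exp p"] ..
  have inverse: "(\<lambda>i x. complex_of_real k * (complex_of_real (1 / k) * h i x)) = h" if "k > 0" for k and h :: "nat \<Rightarrow> 'a \<Rightarrow> complex"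
    using that by simp
  have rep': "herz_rep G (density M (\<lambda>_. c)) p (\<lambda>i x. complex_of_real (1 / a) * f i x) (\<lambda>i x. complex_of_real (1 / b) * g i x) u
      \<longleftrightarrow> herz_rep G M p f g u" for f g u
    unfolding rep inverse[OF ab(1)] inverse[OF ab(2)] ..
  have S': "S (density M (\<lambda>_. c)) (\<lambda>i x. complex_of_real (1 / a) * f i x) (\<lambda>i x. complex_of_real (1 / b) * g i x) = S M f g" for f g
    unfolding S inverse[OF ab(1)] inverse[OF ab(2)] ..
  show "herz G (density M (\<lambda>_. c)) p = herz G M p"
    unfolding herz_def using rep rep' by blast
  have "{suminf (S (density M (\<lambda>_. c)) f g) | f g. herz_rep G (density M (\<lambda>_. c)) p f g u}
     = {suminf (S M f g) | f g. herz_rep G M p f g u}" for u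
  proof (intro equalityI subsetI)
    fix s assume "s \<in> {suminf (S (density M (\<lambda>_. c)) f g) | f g. herz_rep G (density M (\<lambda>_. c)) p f g u}"
    then show "s \<in> {suminf (S M f g) | f g. herz_rep G M p f g u}" unfolding rep S by blast
  next
    fix s assume "s \<in> {suminf (S M f g) | f g. herz_rep G M p f g u}"
    then obtain f g where "herz_rep G M p f g u" "s = suminf (S M f g)" by blast
    then have "herz_rep G (density M (\<lambda>_. c)) p (\<lambda>i x. complex_of_real (1 / a) * f i x) (\<lambda>i x. complex_of_real (1 / b) * g i x) u"
      "s = suminf (S (density M (\<lambda>_. c)) (\<lambda>i x. complex_of_real (1 / a) * f i x) (\<lambda>i x. complex_of_real (1 / b) * g i x))"
      unfolding rep' S' .
    then show "s \<in> {suminf (S (density M (\<lambda>_. c)) f g) | f g. herz_rep G (density M (\<lambda>_. c)) p f g u}" by blast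
  qed
  then show "herz_norm G (density M (\<lambda>_. c)) p = herz_norm G M p"
    unfolding herz_norm_def S_def by presburger
qed

context haar_group
begin

section \<open>The Haar measure of a discrete group\<close>

lemma discrete_openin:
  assumes d: "openin T {\<one>}" and A: "A \<subseteq> carrier G"
  shows "openin T A"
proof -
  have "openin T {x}" if x: "x \<in> carrier G" for x
  proof -
    have "openin T {y \<in> topspace T. inv x \<otimes> y \<in> {\<one>}}"
      by (rule openin_continuous_map_preimage[OF cont_left d]) (use x in simp)
    moreover have "{y \<in> topspace T. inv x \<otimes> y \<in> {\<one>}} = {x}"
    proof -
      have "y = x" if "y \<in> carrier G" "inv x \<otimes> y = \<one>" for y
        using that x inv_equality[of "inv x" y] by (metis inv_closed inv_inv)
      then show ?thesis using x by (auto simp: topspace_eq)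
    qed
    ultimately show ?thesis by simp
  qed
  then have "openin T (\<Union>x\<in>A. {x})" using A by (intro openin_Union) auto
  then show ?thesis by simp
qed

lemma discrete_measure_finite_pos:
  assumes d: "openin T {\<one>}" and K: "finite K" "K \<noteq> {}" "K \<subseteq> carrier G"
  shows "K \<in> sets \<mu>" "emeasure \<mu> K \<noteq> \<infinity>" "measure \<mu> K > 0"
proof -
  show "K \<in> sets \<mu>" by (rule openin_sets[OF discrete_openin[OF d K(3)]])
  have "compactin T K" using K topspace_eq by (intro finite_imp_compactin) auto
  then show fin: "emeasure \<mu> K \<noteq> \<infinity>" using emeasure_compact_finite[of K] by simp
  have "0 < emeasure \<mu> K" using emeasure_open_pos[OF discrete_openin[OF d K(3)] K(2)] .
  then show "measure \<mu> K > 0" using fin by (simp add: measure_def enn2real_positive_iff top.not_eq_extremum)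
qed

text \<open>The constant is the mass of the identity, which invariance gives to every point.
  Infinite sets have infinite measure because they contain finite sets of every size.\<close>

lemma discrete_haar_measure:
  assumes d: "openin T {\<one>}"
  obtains c :: real where "c > 0" "\<mu> = density (count_space (carrier G)) (\<lambda>_. c)"
proof
  define c where "c = measure \<mu> {\<one>}"
  show c: "c > 0" using discrete_measure_finite_pos(3)[OF d, of "{\<one>}"] by (simp add: c_def)
  have sets: "A \<in> sets \<mu>" if "A \<subseteq> carrier G" for A using openin_sets[OF discrete_openin[OF d that]] .
  have sing: "emeasure \<mu> {x} = ennreal c" if x: "x \<in> carrier G" for x
  proof -
    have "emeasure \<mu> ((\<lambda>y. x \<otimes> y) ` {\<one>}) = emeasure \<mu> {\<one>}"
      using haar x sets[of "{\<one>}"] unfolding left_haar_def by blast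
    then show ?thesis using x discrete_measure_finite_pos(2)[OF d, of "{\<one>}"] by (simp add: emeasure_eq_ennreal_measure c_def)
  qed
  have fin: "emeasure \<mu> A = ennreal (c * card A)" if A: "finite A" "A \<subseteq> carrier G" for A
  proof -
    have "emeasure \<mu> A = (\<Sum>x\<in>A. emeasure \<mu> {x})" using A sets by (intro emeasure_eq_sum_singleton) auto
    also have "\<dots> = (\<Sum>x\<in>A. ennreal c)" using A sing by (intro sum.cong) auto
    also have "\<dots> = ennreal (c * card A)" using c by (simp add: ennreal_of_nat_eq_real_of_nat ennreal_mult mult.commute)
    finally show ?thesis .
  qed
  show "\<mu> = density (count_space (carrier G)) (\<lambda>_. c)"
  proof (rule measure_eqI)
    show "sets \<mu> = sets (density (count_space (carrier G)) (\<lambda>_. c))"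
      using sets sets.sets_into_space[of _ \<mu>] space_eq by auto
    fix A assume "A \<in> sets \<mu>"
    then have A: "A \<subseteq> carrier G" using sets.sets_into_space space_eq by blast
    then have dA: "emeasure (density (count_space (carrier G)) (\<lambda>_. c)) A = c * emeasure (count_space (carrier G)) A"
      by (intro emeasure_density_const) simp
    show "emeasure \<mu> A = emeasure (density (count_space (carrier G)) (\<lambda>_. c)) A"
    proof (cases "finite A")
      case True
      then show ?thesis using A c fin by (simp add: dA ennreal_of_nat_eq_real_of_nat ennreal_mult)
    next
      case False
      have "emeasure \<mu> A = \<infinity>"
      proof (rule ccontr)
        assume f: "emeasure \<mu> A \<noteq> \<infinity>"
        obtain n :: nat where n: "measure \<mu> A < n * c" using reals_Archimedean3[OF c] by blast
        obtain B where B: "B \<subseteq> A" "finite B" "card B = n" using infinite_arbitrarily_large[OF False] by blast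
        have "ennreal (c * n) \<le> emeasure \<mu> A"
          using fin[of B] B A sets emeasure_mono[of B A \<mu>] by auto
        then have "c * n \<le> measure \<mu> A" using f c by (simp add: emeasure_eq_ennreal_measure)
        then show False using n by (simp add: mult.commute)
      qed
      then show ?thesis using A c False by (simp add: dA ennreal_mult_top)
    qed
  qed
qed

end

section \<open>Extension from a subgroup and restriction to it\<close>

locale group_with_subgroup = group G for G :: "('a, 'b) monoid_scheme" (structure) +
  fixes H :: "'a set" and p :: real
  assumes sub: "subgroup H G" and p: "1 < p"
begin

abbreviation "GH \<equiv> G\<lparr>carrier := H\<rparr>"
abbreviation "MG \<equiv> count_space (carrier G)"
abbreviation "MH \<equiv> count_space H"

lemma H_carrier: "x \<in> H \<Longrightarrow> x \<in> carrier G" by (rule subgroup.mem_carrier[OF sub])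

lemma inv_GH: "x \<in> H \<Longrightarrow> inv\<^bsub>GH\<^esub> x = inv x"
  by (rule m_inv_consistent[OF sub])

sublocale GI: invariant_measure G MG
  by (rule invariant_measure_count_space[OF is_group])

sublocale HI: invariant_measure GH MH
  using invariant_measure_count_space[OF subgroup_imp_group[OF sub]] by simp

text \<open>Extend the functions of a representation by zero: a nonzero integrand needs
  \<open>y\<close> and \<open>inv x \<otimes> y\<close> in \<open>H\<close>, hence \<open>x\<close>
  in \<open>H\<close>. Elements of \<open>herz\<close> vanish off the carrier, so \<open>u\<close>
  is already its own extension.\<close>

lemma herz_extend:
  assumes u: "u \<in> herz GH MH p"
  shows "u \<in> herz G MG p" and "herz_norm G MG p u \<le> herz_norm GH MH p u"
proof -
  have HG: "H \<subseteq> carrier G" using H_carrier by auto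
  define ext where "ext h y = (if y \<in> H then h y else 0)" for h :: "'a \<Rightarrow> complex" and y
  have Lp: "in_Lp MG r (ext h) \<longleftrightarrow> in_Lp MH r h" for r h
    unfolding in_Lp_count_space by (rule summable_on_cong_neutral) (use HG in \<open>auto simp: ext_def\<close>)
  have nrm: "Lp_norm MG r (ext h) = Lp_norm MH r h" if "in_Lp MH r h" for r h
  proof -
    have "infsum (\<lambda>x. norm (ext h x) powr r) (carrier G) = infsum (\<lambda>x. norm (h x) powr r) H"
      by (rule infsum_cong_neutral) (use HG in \<open>auto simp: ext_def\<close>)
    then show ?thesis using that Lp[of r h] by (simp add: Lp_norm_count_space)
  qed
  have restr: "(\<integral>y. h y \<partial>MH) = (\<integral>y. indicator H y *\<^sub>R h y \<partial>MG)" for h :: "'a \<Rightarrow> complex"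
    unfolding restrict_count_space_subset[OF HG, symmetric] by (rule integral_restrict_space) simp
  have conv: "conv G MG (ext g) (check G (ext f)) x = (if x \<in> H then conv GH MH g (check GH f) x else 0)"
    if x: "x \<in> carrier G" for f g x
  proof (cases "x \<in> H")
    case True
    have "conv GH MH g (check GH f) x = (\<integral>y. g y * f (inv x \<otimes> y) \<partial>MH)"
      using HI.conv_check_eq[of x g f] True inv_GH by simp
    also have "\<dots> = (\<integral>y. indicator H y *\<^sub>R (g y * f (inv x \<otimes> y)) \<partial>MG)" by (rule restr)
    also have "\<dots> = (\<integral>y. ext g y * ext f (inv x \<otimes> y) \<partial>MG)"
      using True sub by (intro Bochner_Integration.integral_cong)
        (auto simp: ext_def indicator_def subgroup.m_closed subgroup.m_inv_closed)
    finally show ?thesis using GI.conv_check_eq[OF x] True by simp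
  next
    case False
    have "(\<integral>y. ext g y * ext f (inv x \<otimes> y) \<partial>MG) = (\<integral>y. 0 \<partial>MG)"
    proof (rule Bochner_Integration.integral_cong[OF refl])
      fix y assume "y \<in> space MG"
      have "inv x \<otimes> y \<notin> H" if y: "y \<in> H"
      proof
        assume "inv x \<otimes> y \<in> H"
        then have "y \<otimes> inv (inv x \<otimes> y) \<in> H" using y sub by (simp add: subgroup.m_closed subgroup.m_inv_closed)
        moreover have "y \<otimes> inv (inv x \<otimes> y) = x" using x H_carrier[OF y] by (simp add: inv_mult_group flip: m_assoc)
        ultimately show False using False by simp
      qed
      then show "ext g y * ext f (inv x \<otimes> y) = 0" by (auto simp: ext_def)
    qed
    then show ?thesis using GI.conv_check_eq[OF x] False by simp
  qed
  have rep: "herz_rep G MG p (\<lambda>i. ext (f i)) (\<lambda>i. ext (g i)) u" if "herz_rep GH MH p f g u" for f g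
    unfolding herz_rep_def
  proof (intro conjI allI ballI impI)
    show "in_Lp MG p (ext (f i))" "in_Lp MG (conj_exp p) (ext (g i))" for i
      using that by (auto simp: herz_rep_def Lp)
    show "summable (\<lambda>i. Lp_norm MG p (ext (f i)) * Lp_norm MG (conj_exp p) (ext (g i)))"
      using that by (simp add: herz_rep_def nrm)
    show "(\<lambda>i. conv G MG (ext (g i)) (check G (ext (f i))) x) sums u x" if x: "x \<in> carrier G" for x
      using \<open>herz_rep GH MH p f g u\<close> by (cases "x \<in> H") (auto simp: conv[OF x] herz_rep_def)
    show "u x = 0" if "x \<notin> carrier G" for x
      using \<open>herz_rep GH MH p f g u\<close> that HG by (auto simp: herz_rep_def)
  qed
  obtain f g where "herz_rep GH MH p f g u" using u by (auto simp: herz_def)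
  from rep[OF this] show "u \<in> herz G MG p" unfolding herz_def by blast
  show "herz_norm G MG p u \<le> herz_norm GH MH p u"
  proof (rule HI.herz_norm_greatest[OF u])
    fix f g assume r: "herz_rep GH MH p f g u"
    have "(\<Sum>i. Lp_norm MG p (ext (f i)) * Lp_norm MG (conj_exp p) (ext (g i))) = (\<Sum>i. Lp_norm MH p (f i) * Lp_norm MH (conj_exp p) (g i))"
      using r by (simp add: herz_rep_def nrm)
    then show "herz_norm G MG p u \<le> (\<Sum>i. Lp_norm MH p (f i) * Lp_norm MH (conj_exp p) (g i))"
      using GI.herz_norm_le[OF rep[OF r]] by simp
  qed
qed

text \<open>Choosing by \<open>SOME\<close> from the coset as a set gives equal cosets the same
  representative. Countability of \<open>S\<close> is available because a p-summable function has
  countable support, and it is wanted because Herz representations are sequences.\<close>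

lemma coset_representatives:
  assumes S: "countable S" "S \<subseteq> carrier G"
  obtains R where "countable R" "R \<subseteq> carrier G" "inj_on (\<lambda>(r, h). h \<otimes> r) (R \<times> H)"
    "\<And>y. y \<in> S \<Longrightarrow> \<exists>r\<in>R. y \<in> H #> r"
proof -
  define \<rho> where "\<rho> x = (SOME y. y \<in> H #> x)" for x
  have \<rho>: "\<rho> x \<in> H #> x" if "x \<in> carrier G" for x
    unfolding \<rho>_def by (rule someI[of _ x]) (rule rcos_self[OF that sub])
  have \<rho>c: "\<rho> x \<in> carrier G" if "x \<in> carrier G" for x
    using \<rho>[OF that] r_coset_subset_G[of H x] H_carrier that by blast
  have \<rho>_eq: "H #> \<rho> x = H #> x" if "x \<in> carrier G" for x
    using repr_independence[OF \<rho>[OF that] that sub] by simp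
  show thesis
  proof (rule that[of "\<rho> ` S"])
    show "countable (\<rho> ` S)" using S by simp
    show "\<rho> ` S \<subseteq> carrier G" using S \<rho>c by auto
    show "\<exists>r\<in>\<rho> ` S. y \<in> H #> r" if "y \<in> S" for y
    proof -
      have "y \<in> carrier G" using that S by auto
      then have "y \<in> H #> \<rho> y" using rcos_self[of y H] sub by (simp add: \<rho>_eq)
      then show ?thesis using that by blast
    qed
    show "inj_on (\<lambda>(r, h). h \<otimes> r) (\<rho> ` S \<times> H)"
    proof (rule inj_onI, clarsimp)
      fix x x' h h' assume x: "x \<in> S" "x' \<in> S" and h: "h \<in> H" "h' \<in> H" and eq: "h \<otimes> \<rho> x = h' \<otimes> \<rho> x'"
      have c: "x \<in> carrier G" "x' \<in> carrier G" "h \<in> carrier G" "h' \<in> carrier G" using x S h H_carrier by auto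
      have hx: "h \<otimes> \<rho> x \<in> H #> \<rho> x" "h' \<otimes> \<rho> x' \<in> H #> \<rho> x'" using h by (auto simp: r_coset_def)
      have "H #> \<rho> x = H #> \<rho> x'"
        using repr_independence[OF hx(1) \<rho>c[OF c(1)] sub] repr_independence[OF hx(2) \<rho>c[OF c(2)] sub] eq by simp
      then have "H #> x = H #> x'" using \<rho>_eq[OF c(1)] \<rho>_eq[OF c(2)] by simp
      then have "\<rho> x = \<rho> x'" by (simp add: \<rho>_def)
      then show "\<rho> x = \<rho> x' \<and> h = h'" using eq c \<rho>c[OF c(2)] by simp
    qed
  qed
qed

text \<open>Left translation by elements of \<open>H\<close> preserves every right coset of
  \<open>H\<close>. On \<open>H\<close> each term therefore splits into a sum over representatives
  \<open>r\<close> of coefficients of the functions \<open>y \<mapsto> f i (y \<otimes> r)\<close>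
  and \<open>y \<mapsto> g i (y \<otimes> r)\<close>, and Hoelder's inequality over \<open>r\<close>
  shows that the split does not increase the norm.\<close>

lemma herz_restrict_rep:
  assumes rep: "herz_rep G MG p f g u"
  shows "(\<lambda>x. if x \<in> H then u x else 0) \<in> herz GH MH p"
    and "herz_norm GH MH p (\<lambda>x. if x \<in> H then u x else 0) \<le> (\<Sum>i. Lp_norm MG p (f i) * Lp_norm MG (conj_exp p) (g i))"
proof -
  define q where "q = conj_exp p"
  have q: "q > 1" using conj_exp_gt1[OF p] by (simp add: q_def)
  have f: "in_Lp MG p (f i)" and g: "in_Lp MG q (g i)" for i using rep by (auto simp: herz_rep_def q_def)
  have sm: "summable (\<lambda>i. Lp_norm MG p (f i) * Lp_norm MG q (g i))" using rep by (simp add: herz_rep_def q_def)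
  \<comment> \<open>The supports of the \<open>f i\<close> suffice: if the integrand at
    \<open>y\<close> is nonzero, then \<open>inv x \<otimes> y\<close> is in such a support, and for
    \<open>x\<close> in \<open>H\<close> it lies in the same right coset as
    \<open>y\<close>.\<close>
  define S where "S = (\<Union>i. {x \<in> carrier G. norm (f i x) powr p \<noteq> 0})"
  have "countable S" unfolding S_def
    using f by (intro countable_UN summable_countable_real) (auto simp: in_Lp_count_space)
  then obtain R where R: "countable R" "R \<subseteq> carrier G" "inj_on (\<lambda>(r, h). h \<otimes> r) (R \<times> H)"
    "\<And>y. y \<in> S \<Longrightarrow> \<exists>r\<in>R. y \<in> H #> r"
    using coset_representatives[of S] by (auto simp: S_def)
  define J where "J = (\<lambda>(r, h). h \<otimes> r)"
  have J: "inj_on J (R \<times> H)" "J ` (R \<times> H) \<subseteq> carrier G" using R H_carrier by (auto simp: J_def)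
  have coset_sum: "(\<lambda>r. infsum (\<lambda>h. \<phi> (h \<otimes> r)) H) summable_on R"
      "infsum (\<lambda>r. infsum (\<lambda>h. \<phi> (h \<otimes> r)) H) R \<le> infsum \<phi> (carrier G)"
      "r \<in> R \<Longrightarrow> (\<lambda>h. \<phi> (h \<otimes> r)) summable_on H"
    if \<phi>: "\<phi> summable_on carrier G" "\<And>x. \<phi> x \<ge> 0" for \<phi> :: "'a \<Rightarrow> real" and r
  proof -
    have s1: "\<phi> summable_on J ` (R \<times> H)" using summable_on_subset_banach[OF \<phi>(1) J(2)] .
    then have s2: "(\<lambda>(r, h). \<phi> (h \<otimes> r)) summable_on R \<times> H"
      unfolding summable_on_reindex[OF J(1)] by (simp add: J_def o_def case_prod_unfold)
    show "(\<lambda>r. infsum (\<lambda>h. \<phi> (h \<otimes> r)) H) summable_on R"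
      using summable_on_Sigma_banach[OF s2] by simp
    show "(\<lambda>h. \<phi> (h \<otimes> r)) summable_on H" if "r \<in> R"
      using summable_on_SigmaD1[OF s2 that] .
    have "infsum (\<lambda>r. infsum (\<lambda>h. \<phi> (h \<otimes> r)) H) R = infsum (\<lambda>(r, h). \<phi> (h \<otimes> r)) (R \<times> H)"
      using infsum_Sigma'_banach[OF s2] by simp
    also have "\<dots> = infsum \<phi> (J ` (R \<times> H))"
      unfolding infsum_reindex[OF J(1)] by (simp add: J_def o_def case_prod_unfold)
    also have "\<dots> \<le> infsum \<phi> (carrier G)" using \<phi> s1 J(2) by (intro infsum_mono2) auto
    finally show "infsum (\<lambda>r. infsum (\<lambda>h. \<phi> (h \<otimes> r)) H) R \<le> infsum \<phi> (carrier G)" .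
  qed
  \<comment> \<open>Fubini over cosets: the p-th powers of the norms on the single cosets add up to
    at most that of the whole function, which prepares Hoelder's inequality on
    \<open>R\<close>.\<close>
  have fibre: "in_Lp (count_space R) s (\<lambda>r. complex_of_real (Lp_norm MH s (\<lambda>y. h (y \<otimes> r))))"
      "Lp_norm (count_space R) s (\<lambda>r. complex_of_real (Lp_norm MH s (\<lambda>y. h (y \<otimes> r)))) \<le> Lp_norm MG s h"
      "r \<in> R \<Longrightarrow> in_Lp MH s (\<lambda>y. h (y \<otimes> r))"
    if h: "in_Lp MG s h" and s: "s > 1" for h s r
  proof -
    note cs = coset_sum[of "\<lambda>x. norm (h x) powr s", OF h[unfolded in_Lp_count_space] powr_ge_zero]
    show inH: "in_Lp MH s (\<lambda>y. h (y \<otimes> r))" if "r \<in> R" for r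
      unfolding in_Lp_count_space using cs(3)[OF that] .
    have pw: "norm (complex_of_real (Lp_norm MH s (\<lambda>y. h (y \<otimes> r)))) powr s = infsum (\<lambda>y. norm (h (y \<otimes> r)) powr s) H"
      if "r \<in> R" for r
      using s GI.Lp_norm_nonneg[of MH s] infsum_nonneg[of H "\<lambda>y. norm (h (y \<otimes> r)) powr s"]
      by (simp add: Lp_norm_count_space[OF inH[OF that]] powr_powr)
    show i: "in_Lp (count_space R) s (\<lambda>r. complex_of_real (Lp_norm MH s (\<lambda>y. h (y \<otimes> r))))"
      unfolding in_Lp_count_space using cs(1) by (rule iffD2[OF summable_on_cong, rotated]) (rule pw)
    have "infsum (\<lambda>r. norm (complex_of_real (Lp_norm MH s (\<lambda>y. h (y \<otimes> r)))) powr s) R \<le> infsum (\<lambda>x. norm (h x) powr s) (carrier G)"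
      using cs(2) infsum_cong[OF pw, of R] by simp
    then show "Lp_norm (count_space R) s (\<lambda>r. complex_of_real (Lp_norm MH s (\<lambda>y. h (y \<otimes> r)))) \<le> Lp_norm MG s h"
      unfolding Lp_norm_count_space[OF i] Lp_norm_count_space[OF h] using s
      by (intro powr_mono2 infsum_nonneg) auto
  qed
  define F K where "F i r y = f i (y \<otimes> r)" and "K i r y = g i (y \<otimes> r)" for i :: nat and r y
  \<comment> \<open>The norm product of each piece also bounds its pointwise contribution, so
    summability of \<open>P\<close> justifies the double series in \<open>total\<close>.\<close>
  define P where "P = (\<lambda>(i, r). Lp_norm MH p (F i r) * Lp_norm MH q (K i r))"
  have FL: "in_Lp MH p (F i r)" and KL: "in_Lp MH q (K i r)" if "r \<in> R" for i r
    unfolding F_def[abs_def] K_def[abs_def] using fibre(3)[OF f p that] fibre(3)[OF g q that] by auto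
  have P_nonneg: "P z \<ge> 0" for z
    by (cases z) (auto simp: P_def intro!: mult_nonneg_nonneg GI.Lp_norm_nonneg)
  have inner: "(\<lambda>r. P (i, r)) summable_on R" "infsum (\<lambda>r. P (i, r)) R \<le> Lp_norm MG p (f i) * Lp_norm MG q (g i)" for i
  proof -
    have norm_eq: "norm (complex_of_real (Lp_norm MH s h)) = Lp_norm MH s h" for s h
      using GI.Lp_norm_nonneg[of MH s h] by simp
    note hi = Holder_inequality[OF p fibre(1)[OF f p] fibre(1)[OF g q, unfolded q_def], unfolded norm_eq, of i i]
    have int: "integrable (count_space R) (\<lambda>r. P (i, r))"
      using hi(1) by (simp add: P_def F_def[abs_def] K_def[abs_def] q_def)
    have "(\<lambda>r. norm (P (i, r))) summable_on R" using int by (simp add: integrable_count_space_iff)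
    then show "(\<lambda>r. P (i, r)) summable_on R" using P_nonneg by simp
    have "infsum (\<lambda>r. P (i, r)) R = (\<integral>r. P (i, r) \<partial>count_space R)"
      using integral_count_space_infsum[OF int] by simp
    also have "\<dots> \<le> Lp_norm (count_space R) p (\<lambda>r. complex_of_real (Lp_norm MH p (F i r)))
        * Lp_norm (count_space R) q (\<lambda>r. complex_of_real (Lp_norm MH q (K i r)))"
      using hi(2) by (simp add: P_def F_def[abs_def] K_def[abs_def] q_def)
    also have "\<dots> \<le> Lp_norm MG p (f i) * Lp_norm MG q (g i)"
      unfolding F_def[abs_def] K_def[abs_def]
      by (intro mult_mono fibre(2) f g p q GI.Lp_norm_nonneg)
    finally show "infsum (\<lambda>r. P (i, r)) R \<le> Lp_norm MG p (f i) * Lp_norm MG q (g i)" .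
  qed
  have N_nonneg: "infsum (\<lambda>r. P (i, r)) R \<ge> 0" for i by (intro infsum_nonneg P_nonneg)
  have N_sm: "summable (\<lambda>i. infsum (\<lambda>r. P (i, r)) R)"
    by (rule summable_comparison_test'[OF sm, of 0]) (use inner(2) N_nonneg in simp)
  have N_son: "(\<lambda>i. infsum (\<lambda>r. P (i, r)) R) summable_on UNIV"
    by (rule summable_nonneg_imp_summable_on[OF N_sm N_nonneg])
  have P_son: "P summable_on UNIV \<times> R"
    by (rule summable_on_SigmaI[OF has_sum_infsum[OF inner(1)] N_son P_nonneg])
  have "infsum P (UNIV \<times> R) = infsum (\<lambda>i. infsum (\<lambda>r. P (i, r)) R) UNIV"
    using infsum_Sigma_banach[OF P_son] by simp
  also have "\<dots> = (\<Sum>i. infsum (\<lambda>r. P (i, r)) R)"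
    using has_sum_imp_sums[OF has_sum_infsum[OF N_son]] by (simp add: sums_iff)
  also have "\<dots> \<le> (\<Sum>i. Lp_norm MG p (f i) * Lp_norm MG q (g i))"
    by (rule suminf_le[OF inner(2) N_sm sm])
  finally have P_le: "infsum P (UNIV \<times> R) \<le> (\<Sum>i. Lp_norm MG p (f i) * Lp_norm MG q (g i))" .
  have conv_sum: "((\<lambda>r. conv GH MH (K i r) (check GH (F i r)) x) has_sum conv G MG (g i) (check G (f i)) x) R"
    if x: "x \<in> H" for i x
  proof -
    have xc: "x \<in> carrier G" using H_carrier[OF x] .
    define h where "h y = g i y * f i (inv x \<otimes> y)" for y
    have hi: "integrable MG h" unfolding h_def[abs_def]
      by (rule GI.in_Lp_mult[OF p GI.in_Lp_translate[OF inv_closed[OF xc] f] g[unfolded q_def]])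
    have hs: "h summable_on carrier G"
      by (rule abs_summable_summable) (rule hi[unfolded integrable_count_space_iff])
    have h0: "h y = 0" if "y \<in> carrier G - J ` (R \<times> H)" for y
    proof (rule ccontr)
      assume "h y \<noteq> 0"
      then have "inv x \<otimes> y \<in> S" using that xc by (auto simp: h_def S_def)
      then obtain r where r: "r \<in> R" "inv x \<otimes> y \<in> H #> r" using R(4) by blast
      then obtain k where k: "k \<in> H" "inv x \<otimes> y = k \<otimes> r" by (auto simp: r_coset_def)
      have rc: "r \<in> carrier G" using r R by auto
      have "y = x \<otimes> (inv x \<otimes> y)" using that xc by (simp flip: m_assoc)
      then have "y = (x \<otimes> k) \<otimes> r" using k H_carrier[OF k(1)] rc xc by (simp add: m_assoc)
      moreover have "x \<otimes> k \<in> H" using x k sub by (simp add: subgroup.m_closed)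
      ultimately have "y \<in> J ` (R \<times> H)" using r by (auto simp: J_def intro!: image_eqI[of _ _ "(r, x \<otimes> k)"])
      then show False using that by simp
    qed
    have "(h has_sum infsum h (carrier G)) (carrier G)" by (rule has_sum_infsum[OF hs])
    then have "(h has_sum infsum h (carrier G)) (J ` (R \<times> H))"
      by (rule iffD1[OF has_sum_cong_neutral, rotated -1]) (use h0 J in auto)
    then have hJ: "((\<lambda>(r, k). h (k \<otimes> r)) has_sum infsum h (carrier G)) (R \<times> H)"
      unfolding has_sum_reindex[OF J(1)] by (simp add: J_def o_def case_prod_unfold)
    have "((\<lambda>r. conv GH MH (K i r) (check GH (F i r)) x) has_sum infsum h (carrier G)) R"
    proof (rule has_sum_SigmaD[OF hJ])
      fix r assume r: "r \<in> R"
      then have rc: "r \<in> carrier G" using R by auto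
      have Hint: "integrable MH (\<lambda>y. K i r y * F i r (inv\<^bsub>GH\<^esub> x \<otimes>\<^bsub>GH\<^esub> y))"
        using HI.in_Lp_mult[OF p HI.in_Lp_translate[OF _ FL[OF r]] KL[OF r, unfolded q_def], of "inv\<^bsub>GH\<^esub> x" i]
          HI.inv_closed[of x] x by simp
      have eq: "K i r y * F i r (inv\<^bsub>GH\<^esub> x \<otimes>\<^bsub>GH\<^esub> y) = h (y \<otimes> r)" if "y \<in> H" for y
        using H_carrier[OF that] xc rc by (simp add: inv_GH[OF x] h_def F_def K_def m_assoc)
      have "conv GH MH (K i r) (check GH (F i r)) x = infsum (\<lambda>y. K i r y * F i r (inv\<^bsub>GH\<^esub> x \<otimes>\<^bsub>GH\<^esub> y)) H"
        using HI.conv_check_eq[of x] x integral_count_space_infsum[OF Hint] by simp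
      also have "\<dots> = infsum (\<lambda>y. h (y \<otimes> r)) H" by (rule infsum_cong[OF eq])
      finally have e: "conv GH MH (K i r) (check GH (F i r)) x = infsum (\<lambda>y. h (y \<otimes> r)) H" .
      have "(\<lambda>y. K i r y * F i r (inv\<^bsub>GH\<^esub> x \<otimes>\<^bsub>GH\<^esub> y)) summable_on H"
        by (rule abs_summable_summable) (rule Hint[unfolded integrable_count_space_iff])
      then have "(\<lambda>y. h (y \<otimes> r)) summable_on H" by (rule iffD1[OF summable_on_cong, rotated]) (rule eq)
      then show "((\<lambda>y. case (r, y) of (r, k) \<Rightarrow> h (k \<otimes> r)) has_sum conv GH MH (K i r) (check GH (F i r)) x) H"
        by (simp add: e)
    qed
    moreover have "infsum h (carrier G) = conv G MG (g i) (check G (f i)) x"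
      using GI.conv_check_eq[OF xc] integral_count_space_infsum[OF hi] by (simp add: h_def)
    ultimately show ?thesis by simp
  qed
  have total: "((\<lambda>(i, r). conv GH MH (K i r) (check GH (F i r)) x) has_sum u x) (UNIV \<times> R)" if x: "x \<in> H" for x
  proof (rule has_sum_SigmaI)
    show "((\<lambda>r. case (i, r) of (i, r) \<Rightarrow> conv GH MH (K i r) (check GH (F i r)) x) has_sum conv G MG (g i) (check G (f i)) x) R" for i
      using conv_sum[OF x] by simp
    have xc: "x \<in> carrier G" using H_carrier[OF x] .
    show "((\<lambda>i. conv G MG (g i) (check G (f i)) x) has_sum u x) UNIV"
    proof (rule norm_summable_imp_has_sum)
      show "summable (\<lambda>i. norm (conv G MG (g i) (check G (f i)) x))"
        by (rule summable_comparison_test'[OF sm, of 0])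
          (use GI.conv_check_bound[OF p f g[unfolded q_def] xc] in \<open>simp add: q_def\<close>)
      show "(\<lambda>i. conv G MG (g i) (check G (f i)) x) sums u x" using rep xc by (simp add: herz_rep_def)
    qed
    have "norm (case z of (i, r) \<Rightarrow> conv GH MH (K i r) (check GH (F i r)) x) \<le> P z" if "z \<in> UNIV \<times> R" for z
      using that x HI.conv_check_bound[OF p FL KL[unfolded q_def]] by (auto simp: P_def q_def)
    then show "(\<lambda>(i, r). conv GH MH (K i r) (check GH (F i r)) x) summable_on UNIV \<times> R"
      by (intro abs_summable_summable[OF Infinite_Sum.abs_summable_on_comparison_test'[OF P_son]])
  qed
  define I where "I = (UNIV :: nat set) \<times> R"
  have I: "countable I" unfolding I_def using R(1) by simp
  note hc = HI.herz_countable_sum[OF I, of p "\<lambda>z. F (fst z) (snd z)" "\<lambda>z. K (fst z) (snd z)" "infsum P I"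
      "\<lambda>x. if x \<in> H then u x else 0"]
  have P_hs: "((\<lambda>z. Lp_norm MH p (F (fst z) (snd z)) * Lp_norm MH (conj_exp p) (K (fst z) (snd z))) has_sum infsum P I) I"
    using has_sum_infsum[OF P_son] by (simp add: I_def P_def case_prod_unfold q_def)
  have t: "((\<lambda>z. conv GH MH (K (fst z) (snd z)) (check GH (F (fst z) (snd z))) x) has_sum (if x \<in> H then u x else 0)) I"
    if "x \<in> carrier GH" for x
    using total[of x] that by (simp add: I_def case_prod_unfold)
  show "(\<lambda>x. if x \<in> H then u x else 0) \<in> herz GH MH p"
    by (rule hc(1)[OF _ _ P_hs t]) (auto simp: I_def FL KL[unfolded q_def])
  have "herz_norm GH MH p (\<lambda>x. if x \<in> H then u x else 0) \<le> infsum P I"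
    by (rule hc(2)[OF _ _ P_hs t]) (auto simp: I_def FL KL[unfolded q_def])
  then show "herz_norm GH MH p (\<lambda>x. if x \<in> H then u x else 0) \<le> (\<Sum>i. Lp_norm MG p (f i) * Lp_norm MG (conj_exp p) (g i))"
    using P_le by (simp add: I_def q_def)
qed

text \<open>A functional for \<open>H\<close> is pulled back along restriction. The sequences
  themselves pass to the larger group by zero extension without growing in norm, and their products
  vanish off \<open>H\<close>, so the pulled back functional takes the same values on them.\<close>

lemma herz_arens_regular_subgroup:
  assumes reg: "herz_arens_regular G MG p"
  shows "herz_arens_regular GH MH p"
  unfolding herz_arens_regular_def arens_regular_def
proof (intro allI impI, elim conjE)
  fix a b T L1 L2 l1 l2
  assume a: "\<forall>n. a n \<in> herz GH MH p \<and> herz_norm GH MH p (a n) \<le> 1"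
    and b: "\<forall>n. b n \<in> herz GH MH p \<and> herz_norm GH MH p (b n) \<le> 1"
    and T: "bounded_functional (herz GH MH p) (herz_norm GH MH p) T"
    and lim: "\<forall>n. (\<lambda>m. T (\<lambda>x. a n x * b m x)) \<longlonglongrightarrow> L1 n" "L1 \<longlonglongrightarrow> l1"
      "\<forall>m. (\<lambda>n. T (\<lambda>x. a n x * b m x)) \<longlonglongrightarrow> L2 m" "L2 \<longlonglongrightarrow> l2"
  define r where "r u x = (if x \<in> H then u x else 0)" for u :: "'a \<Rightarrow> complex" and x
  have r: "r u \<in> herz GH MH p" "herz_norm GH MH p (r u) \<le> herz_norm G MG p u" if u: "u \<in> herz G MG p" for u
  proof -
    obtain f g where "herz_rep G MG p f g u" using u by (auto simp: herz_def)
    then show "r u \<in> herz GH MH p" using herz_restrict_rep(1) by (simp add: r_def[abs_def])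
    show "herz_norm GH MH p (r u) \<le> herz_norm G MG p u"
      using GI.herz_norm_greatest[OF u] herz_restrict_rep(2) by (simp add: r_def[abs_def])
  qed
  have T': "bounded_functional (herz G MG p) (herz_norm G MG p) (\<lambda>u. T (r u))"
    unfolding bounded_functional_def
  proof (intro conjI ballI allI)
    fix u v assume "u \<in> herz G MG p" "v \<in> herz G MG p"
    moreover have "r (\<lambda>x. u x + v x) = (\<lambda>x. r u x + r v x)" by (auto simp: r_def)
    ultimately show "T (r (\<lambda>x. u x + v x)) = T (r u) + T (r v)" using T r by (simp add: bounded_functional_def)
  next
    fix c u assume "u \<in> herz G MG p"
    moreover have "r (\<lambda>x. c * u x) = (\<lambda>x. c * r u x)" by (auto simp: r_def)
    ultimately show "T (r (\<lambda>x. c * u x)) = c * T (r u)" using T r by (simp add: bounded_functional_def)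
  next
    obtain C where C: "\<And>u. u \<in> herz GH MH p \<Longrightarrow> norm (T u) \<le> C * herz_norm GH MH p u"
      using T unfolding bounded_functional_def by blast
    \<comment> \<open>\<open>bounded_functional\<close> permits a negative constant, so it is
      replaced by its absolute value before the norm is enlarged.\<close>
    have "norm (T (r u)) \<le> \<bar>C\<bar> * herz_norm G MG p u" if u: "u \<in> herz G MG p" for u
    proof -
      have nn: "0 \<le> herz_norm GH MH p (r u)"
        by (rule HI.herz_norm_greatest[OF r(1)[OF u]]) (auto simp: herz_rep_def intro!: HI.herz_rep_nonneg)
      have "norm (T (r u)) \<le> C * herz_norm GH MH p (r u)" by (rule C[OF r(1)[OF u]])
      also have "\<dots> \<le> \<bar>C\<bar> * herz_norm GH MH p (r u)" using nn by (intro mult_right_mono) auto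
      also have "\<dots> \<le> \<bar>C\<bar> * herz_norm G MG p u" using r(2)[OF u] by (intro mult_left_mono) auto
      finally show ?thesis .
    qed
    then show "\<exists>C. \<forall>u\<in>herz G MG p. norm (T (r u)) \<le> C * herz_norm G MG p u" by blast
  qed
  have ra: "r (\<lambda>x. a n x * b m x) = (\<lambda>x. a n x * b m x)" for n m
  proof -
    have "a n x = 0" if "x \<notin> H" for x
      using a[rule_format, of n] that by (auto simp: herz_def herz_rep_def)
    then show ?thesis by (auto simp: r_def)
  qed
  have aG: "a n \<in> herz G MG p \<and> herz_norm G MG p (a n) \<le> 1" and bG: "b n \<in> herz G MG p \<and> herz_norm G MG p (b n) \<le> 1" for n
    using a b herz_extend order_trans by blast+
  have lims: "\<forall>n. (\<lambda>m. T (r (\<lambda>x. a n x * b m x))) \<longlonglongrightarrow> L1 n" "\<forall>m. (\<lambda>n. T (r (\<lambda>x. a n x * b m x))) \<longlonglongrightarrow> L2 m"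
    using lim(1,3) unfolding ra .
  show "l1 = l2"
    using reg[unfolded herz_arens_regular_def arens_regular_def, rule_format, of a b "\<lambda>u. T (r u)" L1 l1 L2 l2]
      aG bG T' lims lim(2,4) by blast
qed

end

section \<open>Local finiteness\<close>

theorem theorem3p2:
  fixes G :: "('a, 'b) monoid_scheme" and T :: "'a topology" and \<mu> :: "'a measure" and p :: real
  assumes "lc_group G T" and "left_haar G T \<mu>" and "1 < p"
    and "herz_arens_regular G \<mu> p"
    and "\<And>H. subgroup H G \<Longrightarrow> (\<exists>S. finite S \<and> S \<subseteq> carrier G \<and> H = generate G S) \<Longrightarrow>
           herz_arens_regular (G\<lparr>carrier := H\<rparr>) (count_space H) p \<Longrightarrow> finite H"
  shows "finite (carrier G)"
proof (rule ccontr)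
  assume inf: "infinite (carrier G)"
  interpret haar_group G T \<mu> using assms(1,2) by unfold_locales
  have d: "openin T {\<one>\<^bsub>G\<^esub>}" by (rule regular_imp_discrete[OF assms(3,4)])
  obtain c :: real where c: "c > 0" "\<mu> = density (count_space (carrier G)) (\<lambda>_. c)"
    by (rule discrete_haar_measure[OF d])
  have reg: "herz_arens_regular G (count_space (carrier G)) p"
    using assms(4) unfolding herz_arens_regular_def c(2)
      herz_scaled_count_space(1)[OF assms(3) c(1)] herz_scaled_count_space(2)[OF assms(3) c(1), abs_def] .
  have locally_finite: "finite (generate G S)" if S: "finite S" "S \<subseteq> carrier G" for S
  proof -
    have sub: "subgroup (generate G S) G" by (rule generate_is_subgroup[OF S(2)])
    interpret group_with_subgroup G "generate G S" p 
      by (intro group_with_subgroup.intro group_with_subgroup_axioms.intro group_G sub assms(3))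
    show ?thesis by (rule assms(5)[OF sub _ herz_arens_regular_subgroup[OF reg]]) (use S in blast)
  qed
  \<comment> \<open>In an infinite, locally finite group every finite set leaves an element outside
    the subgroup it generates. Adjoining such elements one by one, starting from the empty set,
    yields the strictly increasing chain of finite subgroups.\<close>
  define s where "s S = (SOME x. x \<in> carrier G - generate G S)" for S
  have s: "s S \<in> carrier G - generate G S" if "finite S" "S \<subseteq> carrier G" for S
  proof -
    have "carrier G - generate G S \<noteq> {}" using inf locally_finite[OF that] by (metis Diff_eq_empty_iff rev_finite_subset)
    then obtain x where "x \<in> carrier G - generate G S" by blast
    then show ?thesis unfolding s_def by (rule someI)
  qed
  define S where "S n = ((\<lambda>S. insert (s S) S) ^^ n) {}" for n
  have S_Suc: "S (Suc n) = insert (s (S n)) (S n)" for n by (simp add: S_def)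
  have S: "finite (S n) \<and> S n \<subseteq> carrier G" for n
  proof (induction n)
    case 0
    show ?case by (simp add: S_def)
  next
    case (Suc n)
    then show ?case using s[of "S n"] by (simp add: S_Suc)
  qed
  define K where "K n = generate G (S n)" for n
  have K: "finite (K n)" "subgroup (K n) G" for n
    using S locally_finite generate_is_subgroup by (simp_all add: K_def)
  have K': "K n \<noteq> {}" "K n \<subseteq> carrier G" for n
    using subgroup.one_closed[OF K(2)] subgroup.subset[OF K(2)] by auto
  have "\<not> herz_arens_regular G \<mu> p"
  proof (rule increasing_subgroups_not_regular[OF assms(3), of K "\<lambda>n. s (S n)"])
    show "K n \<subseteq> K (Suc n)" for n unfolding K_def S_Suc by (rule mono_generate) auto
    show "s (S n) \<in> K (Suc n)" for n unfolding K_def S_Suc by (rule generate.incl) simp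
    show "s (S n) \<notin> K n" for n using s[of "S n"] S by (simp add: K_def)
  qed (rule K discrete_measure_finite_pos[OF d K(1) K'])+
  then show False using assms(4) by simp
qed

end
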